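(* Let $(X,\Sigma_X,\mu_X)$ and $(Y,\Sigma_Y,\mu_Y)$ be separable and $\sigma$-finite measure spaces, $\varphi\colon Y\to X$ a measurable map with $\varphi_*\mu_Y\ll\mu_X$, $p,q\in(1,\infty)$ with $\frac1p+\frac1q=1$, and $\mathscr M$ an $L^p(\mu_X)$-normed module. Let $\mathsf I_\varphi\colon\varphi^*\mathscr M^*\to(\varphi^*\mathscr M)^*$ be the unique $L^\infty(\mu_Y)$-linear, pointwise norm preserving map with $$\langle\mathsf I_\varphi(\varphi^*\omega),\varphi^*v\rangle=\langle\omega,v\rangle\circ\varphi\qquad\text{for every }\omega\in\mathscr M^*,\ v\in\mathscr M.$$ Then for any $L\in(\varphi^*\mathscr M)^*$ there is a sequence $(L_n)\subset\varphi^*\mathscr M^*$ such that $\mathsf I_\varphi(L_n)(V)\to L(V)$ in $L^1(\mu_Y)$ for every $V\in\varphi^*\mathscr M$.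
   Context: **Separability.** A measure space $(X,\Sigma,\mu)$ is separable if there is a sequence $(A_n)\subset\Sigma$ with $\inf_n\mu(A_n\Delta B)=0$ for every $B\in\Sigma$ with $\mu(B)<\infty$. **Normed modules.** For a $\sigma$-finite measure $\mu$ and $p\in(1,\infty)$, an $L^p(\mu)$-normed module is a Banach space $\mathscr M$ which is a module over $L^\infty(\mu)$ and has a pointwise norm $|\cdot|\colon\mathscr M\to L^p(\mu)^+$ with $\|v\|_{\mathscr M}=\||v|\|_{L^p(\mu)}$ and $|fv|=|f||v|$ $\mu$-a.e. for $f\in L^\infty(\mu)$, $v\in\mathscr M$. A set generates $\mathscr M$ if its $L^\infty(\mu)$-linear combinations are dense in $\mathscr M$. **Dual.** The dual $\mathscr M^*$ of an $L^p(\mu)$-normed module is the space of $L^\infty(\mu)$-linear continuous maps $L\colon\mathscr M\to L^1(\mu)$, with the operator norm, the obvious multiplication by $L^\infty(\mu)$-functions and pointwise norm $|L|:=\operatorname{ess\,sup}\{L(v):v\in\mathscr M,\ |v|\le1\ \mu\text{-a.e.}\}$; it is an $L^q(\mu)$-normed module. We write $\langle\omega,v\rangle:=\omega(v)$. **Pullback.** For $r\in(1,\infty)$ and an $L^r(\mu_X)$-normed module $\mathscr N$, the pullback $(\varphi^*\mathscr N,\varphi^* )$ is the couple, unique up to unique isomorphism, where $\varphi^*\mathscr N$ is an $L^r(\mu_Y)$-normed module and $\varphi^*\colon\mathscr N\to\varphi^*\mathscr N$ is linear, with $|\varphi^*v|=|v|\circ\varphi$ for all $v$, and $\{\varphi^*v:v\in\mathscr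 N\}$ generates $\varphi^*\mathscr N$. Here $\varphi^*\mathscr M^*$ denotes $\varphi^*(\mathscr M^* )$, an $L^q(\mu_Y)$-normed module. The existence and uniqueness of $\mathsf I_\varphi$ is taken as known. *)

theory Defs
  imports "HOL-Analysis.Analysis" "HOL-Algebra.Module"
begin

definition separable_measure :: "'x measure \<Rightarrow> bool" where
  "separable_measure \<mu> \<longleftrightarrow>
    (\<exists>A :: nat \<Rightarrow> 'x set. range A \<subseteq> sets \<mu> \<and>
      (\<forall>B\<in>sets \<mu>. emeasure \<mu> B < \<infinity> \<longrightarrow> (INF n. emeasure \<mu> (sym_diff (A n) B)) = 0))"


section \<open>Functions modulo almost everywhere equality\<close>

text \<open>Elements of $L^p(\mu)$ are genuine equivalence classes, represented as sets of measurable
  functions; this makes equality in these spaces, and of maps into them, the equality of HOL.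
  Operations on classes go through an arbitrary representative.\<close>

type_synonym 'x fclass = "('x \<Rightarrow> real) set"

definition ae_class :: "'x measure \<Rightarrow> ('x \<Rightarrow> real) \<Rightarrow> 'x fclass" where
  "ae_class \<mu> f = {g \<in> borel_measurable \<mu>. AE x in \<mu>. g x = f x}"

definition ae_rep :: "'x fclass \<Rightarrow> 'x \<Rightarrow> real" where
  "ae_rep F = (SOME f. f \<in> F)"

abbreviation ae_const :: "'x measure \<Rightarrow> real \<Rightarrow> 'x fclass" where
  "ae_const \<mu> c \<equiv> ae_class \<mu> (\<lambda>_. c)"

definition ae_abs :: "'x measure \<Rightarrow> 'x fclass \<Rightarrow> 'x fclass" where
  "ae_abs \<mu> F = ae_class \<mu> (\<lambda>x. \<bar>ae_rep F x\<bar>)"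

definition ae_add :: "'x measure \<Rightarrow> 'x fclass \<Rightarrow> 'x fclass \<Rightarrow> 'x fclass" where
  "ae_add \<mu> F G = ae_class \<mu> (\<lambda>x. ae_rep F x + ae_rep G x)"

definition ae_mult :: "'x measure \<Rightarrow> 'x fclass \<Rightarrow> 'x fclass \<Rightarrow> 'x fclass" where
  "ae_mult \<mu> F G = ae_class \<mu> (\<lambda>x. ae_rep F x * ae_rep G x)"

definition ae_le :: "'x measure \<Rightarrow> 'x fclass \<Rightarrow> 'x fclass \<Rightarrow> bool" where
  "ae_le \<mu> F G \<longleftrightarrow> (AE x in \<mu>. ae_rep F x \<le> ae_rep G x)"

text \<open>The class of $f \circ \varphi$; independent of the representative as soon as
  $\varphi_*\mu_Y \ll \mu_X$.\<close>

definition ae_comp :: "'y measure \<Rightarrow> 'x fclass \<Rightarrow> ('y \<Rightarrow> 'x) \<Rightarrow> 'y fclass" where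
  "ae_comp \<mu>Y F \<phi> = ae_class \<mu>Y (\<lambda>y. ae_rep F (\<phi> y))"

definition L0_space :: "'x measure \<Rightarrow> 'x fclass set" where
  "L0_space \<mu> = ae_class \<mu> ` borel_measurable \<mu>"

definition Lp_space :: "'x measure \<Rightarrow> real \<Rightarrow> 'x fclass set" where
  "Lp_space \<mu> p = ae_class \<mu> ` {f \<in> borel_measurable \<mu>. integrable \<mu> (\<lambda>x. \<bar>f x\<bar> powr p)}"

definition Lp_norm :: "'x measure \<Rightarrow> real \<Rightarrow> 'x fclass \<Rightarrow> real" where
  "Lp_norm \<mu> p F = (\<integral>x. \<bar>ae_rep F x\<bar> powr p \<partial>\<mu>) powr (1 / p)"

definition Linf_space :: "'x measure \<Rightarrow> 'x fclass set" where
  "Linf_space \<mu> = ae_class \<mu> ` {f \<in> borel_measurable \<mu>. \<exists>C. AE x in \<mu>. \<bar>f x\<bar> \<le> C}"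

definition Linf_ring :: "'x measure \<Rightarrow> 'x fclass ring" where
  "Linf_ring \<mu> =
    \<lparr>carrier = Linf_space \<mu>, mult = ae_mult \<mu>, one = ae_const \<mu> 1,
     zero = ae_const \<mu> 0, add = ae_add \<mu>\<rparr>"

text \<open>The essential supremum of a family of classes, as the least upper bound for the almost
  everywhere order among real-valued functions. It is only meaningful if the family has a finite
  measurable upper bound, which is the case for the family defining the pointwise norm of an
  element of a dual module.\<close>

definition ess_Sup :: "'x measure \<Rightarrow> 'x fclass set \<Rightarrow> 'x fclass" where
  "ess_Sup \<mu> \<F> = (THE G. G \<in> L0_space \<mu> \<and> (\<forall>F\<in>\<F>. ae_le \<mu> F G) \<and>
     (\<forall>H\<in>L0_space \<mu>. (\<forall>F\<in>\<F>. ae_le \<mu> F H) \<longrightarrow> ae_le \<mu> G H))"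


section \<open>Normed modules\<close>

record ('x, 'm) normed_module = "('x fclass, 'm) module" +
  pnorm :: "'m \<Rightarrow> 'x fclass"
  mnorm :: "'m \<Rightarrow> real"

text \<open>The value 0 outside the carrier is needed because the locale \<open>Metric_space\<close> demands
  symmetry and nonnegativity on the whole type.\<close>

definition mdist :: "('x, 'm) normed_module \<Rightarrow> 'm \<Rightarrow> 'm \<Rightarrow> real" where
  "mdist M v w =
    (if v \<in> carrier M \<and> w \<in> carrier M then mnorm M (v \<ominus>\<^bsub>M\<^esub> w) else 0)"

definition mtop :: "('x, 'm) normed_module \<Rightarrow> 'm topology" where
  "mtop M = Metric_space.mtopology (carrier M) (mdist M)"

text \<open>Real scalars act through constant functions.\<close>

locale Lp_normed_module = Module.module "Linf_ring \<mu>" M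
  for \<mu> :: "'x measure" and p :: real and M :: "('x, 'm) normed_module" (structure) +
  assumes norm_eq_0_iff: "v \<in> carrier M \<Longrightarrow> mnorm M v = 0 \<longleftrightarrow> v = \<zero>"
    and norm_triangle:
      "v \<in> carrier M \<Longrightarrow> w \<in> carrier M \<Longrightarrow> mnorm M (v \<oplus> w) \<le> mnorm M v + mnorm M w"
    and norm_scale: "v \<in> carrier M \<Longrightarrow> mnorm M (ae_const \<mu> c \<odot> v) = \<bar>c\<bar> * mnorm M v"
    and complete: "Metric_space.mcomplete (carrier M) (mdist M)"
    and pnorm_closed: "v \<in> carrier M \<Longrightarrow> pnorm M v \<in> Lp_space \<mu> p"
    and pnorm_nonneg: "v \<in> carrier M \<Longrightarrow> ae_le \<mu> (ae_const \<mu> 0) (pnorm M v)"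
    and norm_eq: "v \<in> carrier M \<Longrightarrow> mnorm M v = Lp_norm \<mu> p (pnorm M v)"
    and pnorm_smult:
      "f \<in> Linf_space \<mu> \<Longrightarrow> v \<in> carrier M \<Longrightarrow>
        pnorm M (f \<odot> v) = ae_mult \<mu> (ae_abs \<mu> f) (pnorm M v)"

definition linear_combinations ::
    "'x measure \<Rightarrow> ('x, 'm) normed_module \<Rightarrow> 'm set \<Rightarrow> 'm set" where
  "linear_combinations \<mu> M S =
    {finsum M (\<lambda>v. a v \<odot>\<^bsub>M\<^esub> v) A | a A. finite A \<and> A \<subseteq> S \<and> a \<in> A \<rightarrow> Linf_space \<mu>}"

definition generates :: "'x measure \<Rightarrow> ('x, 'm) normed_module \<Rightarrow> 'm set \<Rightarrow> bool" where
  "generates \<mu> M S \<longleftrightarrow>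
    S \<subseteq> carrier M \<and> mtop M closure_of linear_combinations \<mu> M S = carrier M"

definition Linf_linear ::
    "'x measure \<Rightarrow> ('x, 'm) normed_module \<Rightarrow> ('x, 'n) normed_module \<Rightarrow> ('m \<Rightarrow> 'n) \<Rightarrow> bool" where
  "Linf_linear \<mu> M N T \<longleftrightarrow>
    T \<in> carrier M \<rightarrow> carrier N \<and>
    (\<forall>v\<in>carrier M. \<forall>w\<in>carrier M. T (v \<oplus>\<^bsub>M\<^esub> w) = T v \<oplus>\<^bsub>N\<^esub> T w) \<and>
    (\<forall>f\<in>Linf_space \<mu>. \<forall>v\<in>carrier M. T (f \<odot>\<^bsub>M\<^esub> v) = f \<odot>\<^bsub>N\<^esub> T v)"

text \<open>\<open>L1\<close> is the space $L^1(\mu)$ as a module over $L^\infty(\mu)$. In this record and in that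
  of the dual below, the ring fields \<open>mult\<close> and \<open>one\<close> inherited by the record type of modules
  carry no meaning.\<close>

definition L1 :: "'x measure \<Rightarrow> ('x, 'x fclass) normed_module" where
  "L1 \<mu> =
    \<lparr>carrier = Lp_space \<mu> 1, mult = undefined, one = undefined,
     zero = ae_const \<mu> 0, add = ae_add \<mu>, smult = ae_mult \<mu>,
     pnorm = ae_abs \<mu>, mnorm = Lp_norm \<mu> 1\<rparr>"


section \<open>Dual and pullback\<close>

definition dual_carrier ::
    "'x measure \<Rightarrow> ('x, 'm) normed_module \<Rightarrow> ('m \<Rightarrow> 'x fclass) set" where
  "dual_carrier \<mu> M =
    {L \<in> extensional (carrier M).
      Linf_linear \<mu> M (L1 \<mu>) L \<and> continuous_map (mtop M) (mtop (L1 \<mu>)) L}"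

definition dual ::
    "'x measure \<Rightarrow> ('x, 'm) normed_module \<Rightarrow> ('x, 'm \<Rightarrow> 'x fclass) normed_module" where
  "dual \<mu> M =
    \<lparr>carrier = dual_carrier \<mu> M, mult = undefined, one = undefined,
     zero = (\<lambda>v\<in>carrier M. ae_const \<mu> 0),
     add = (\<lambda>L K. \<lambda>v\<in>carrier M. ae_add \<mu> (L v) (K v)),
     smult = (\<lambda>f L. \<lambda>v\<in>carrier M. ae_mult \<mu> f (L v)),
     pnorm = (\<lambda>L. ess_Sup \<mu> (L ` {v \<in> carrier M. ae_le \<mu> (pnorm M v) (ae_const \<mu> 1)})),
     mnorm = (\<lambda>L. SUP v\<in>{v \<in> carrier M. mnorm M v \<le> 1}. Lp_norm \<mu> 1 (L v))\<rparr>"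

text \<open>\<open>is_pullback \<mu>X \<mu>Y \<phi> r N P T\<close>: the couple \<open>(P, T)\<close> is the pullback of the
  $L^r(\mu_X)$-normed module \<open>N\<close> under \<open>\<phi>\<close>. It is characterised by these properties up to
  unique isomorphism.\<close>

definition is_pullback ::
    "'x measure \<Rightarrow> 'y measure \<Rightarrow> ('y \<Rightarrow> 'x) \<Rightarrow> real \<Rightarrow>
     ('x, 'm) normed_module \<Rightarrow> ('y, 'n) normed_module \<Rightarrow> ('m \<Rightarrow> 'n) \<Rightarrow> bool" where
  "is_pullback \<mu>X \<mu>Y \<phi> r N P T \<longleftrightarrow>
    Lp_normed_module \<mu>Y r P \<and>
    T \<in> carrier N \<rightarrow> carrier P \<and>
    (\<forall>v\<in>carrier N. \<forall>w\<in>carrier N. T (v \<oplus>\<^bsub>N\<^esub> w) = T v \<oplus>\<^bsub>P\<^esub> T w) \<and>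
    (\<forall>c. \<forall>v\<in>carrier N. T (ae_const \<mu>X c \<odot>\<^bsub>N\<^esub> v) = ae_const \<mu>Y c \<odot>\<^bsub>P\<^esub> T v) \<and>
    (\<forall>v\<in>carrier N. pnorm P (T v) = ae_comp \<mu>Y (pnorm N v) \<phi>) \<and>
    generates \<mu>Y P (T ` carrier N)"


section \<open>The ring of essentially bounded functions\<close>

lemma ae_rep_class:
  assumes "f \<in> borel_measurable \<mu>"
  shows "ae_rep (ae_class \<mu> f) \<in> borel_measurable \<mu>"
    and "AE x in \<mu>. ae_rep (ae_class \<mu> f) x = f x"
proof -
  have "f \<in> ae_class \<mu> f"
    using assms by (simp add: ae_class_def)
  then have "ae_rep (ae_class \<mu> f) \<in> ae_class \<mu> f"
    unfolding ae_rep_def by (rule someI[of "\<lambda>g. g \<in> ae_class \<mu> f"])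
  then show "ae_rep (ae_class \<mu> f) \<in> borel_measurable \<mu>"
    and "AE x in \<mu>. ae_rep (ae_class \<mu> f) x = f x"
    by (simp_all add: ae_class_def)
qed

lemma ae_class_eqI:
  assumes "AE x in \<mu>. f x = g x"
  shows "ae_class \<mu> f = ae_class \<mu> g"
  unfolding ae_class_def using assms by auto

lemma ae_add_class:
  assumes "f \<in> borel_measurable \<mu>" "g \<in> borel_measurable \<mu>"
  shows "ae_add \<mu> (ae_class \<mu> f) (ae_class \<mu> g) = ae_class \<mu> (\<lambda>x. f x + g x)"
  unfolding ae_add_def
  by (rule ae_class_eqI) (use ae_rep_class[OF assms(1)] ae_rep_class[OF assms(2)] in auto)

lemma ae_mult_class:
  assumes "f \<in> borel_measurable \<mu>" "g \<in> borel_measurable \<mu>"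
  shows "ae_mult \<mu> (ae_class \<mu> f) (ae_class \<mu> g) = ae_class \<mu> (\<lambda>x. f x * g x)"
  unfolding ae_mult_def
  by (rule ae_class_eqI) (use ae_rep_class[OF assms(1)] ae_rep_class[OF assms(2)] in auto)

lemma Linf_spaceE:
  assumes "F \<in> Linf_space \<mu>"
  obtains f C where "F = ae_class \<mu> f" "f \<in> borel_measurable \<mu>" "AE x in \<mu>. \<bar>f x\<bar> \<le> C"
  using assms by (auto simp: Linf_space_def)

lemma Linf_spaceI:
  assumes "f \<in> borel_measurable \<mu>" "AE x in \<mu>. \<bar>f x\<bar> \<le> C"
  shows "ae_class \<mu> f \<in> Linf_space \<mu>"
  using assms by (auto simp: Linf_space_def)

lemma Linf_add:
  assumes "F \<in> Linf_space \<mu>" "G \<in> Linf_space \<mu>"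
  shows "ae_add \<mu> F G \<in> Linf_space \<mu>"
proof -
  obtain f C where f: "F = ae_class \<mu> f" "f \<in> borel_measurable \<mu>" "AE x in \<mu>. \<bar>f x\<bar> \<le> C"
    using assms(1) by (rule Linf_spaceE)
  obtain g D where g: "G = ae_class \<mu> g" "g \<in> borel_measurable \<mu>" "AE x in \<mu>. \<bar>g x\<bar> \<le> D"
    using assms(2) by (rule Linf_spaceE)
  have "AE x in \<mu>. \<bar>f x + g x\<bar> \<le> C + D"
    using f(3) g(3) by eventually_elim linarith
  then show ?thesis
    using f g by (auto simp: ae_add_class intro!: Linf_spaceI)
qed

lemma Linf_mult:
  assumes "F \<in> Linf_space \<mu>" "G \<in> Linf_space \<mu>"
  shows "ae_mult \<mu> F G \<in> Linf_space \<mu>"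
proof -
  obtain f C where f: "F = ae_class \<mu> f" "f \<in> borel_measurable \<mu>" "AE x in \<mu>. \<bar>f x\<bar> \<le> C"
    using assms(1) by (rule Linf_spaceE)
  obtain g D where g: "G = ae_class \<mu> g" "g \<in> borel_measurable \<mu>" "AE x in \<mu>. \<bar>g x\<bar> \<le> D"
    using assms(2) by (rule Linf_spaceE)
  have "AE x in \<mu>. \<bar>f x * g x\<bar> \<le> C * D"
    using f(3) g(3) by eventually_elim (auto simp: abs_mult intro!: mult_mono)
  then show ?thesis
    using f g by (auto simp: ae_mult_class intro!: Linf_spaceI)
qed

lemma Linf_const: "ae_const \<mu> c \<in> Linf_space \<mu>"
  by (rule Linf_spaceI[where C = "\<bar>c\<bar>"]) auto

lemma cring_Linf_ring: "cring (Linf_ring \<mu>)"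
proof (rule cringI)
  show "abelian_group (Linf_ring \<mu>)"
  proof (rule abelian_groupI; (simp add: Linf_ring_def)?)
    fix F G H
    assume "F \<in> Linf_space \<mu>" "G \<in> Linf_space \<mu>" "H \<in> Linf_space \<mu>"
    then show "ae_add \<mu> (ae_add \<mu> F G) H = ae_add \<mu> F (ae_add \<mu> G H)"
      by (elim Linf_spaceE) (simp add: ae_add_class add.assoc)
  next
    fix F G
    assume "F \<in> Linf_space \<mu>" "G \<in> Linf_space \<mu>"
    then show "ae_add \<mu> F G = ae_add \<mu> G F"
      by (elim Linf_spaceE) (simp add: ae_add_class add.commute)
  next
    fix F
    assume "F \<in> Linf_space \<mu>"
    then show "ae_add \<mu> (ae_const \<mu> 0) F = F"
      by (elim Linf_spaceE) (simp add: ae_add_class)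
  next
    fix F
    assume "F \<in> Linf_space \<mu>"
    then obtain f C where f: "F = ae_class \<mu> f" "f \<in> borel_measurable \<mu>" "AE x in \<mu>. \<bar>f x\<bar> \<le> C"
      by (rule Linf_spaceE)
    show "\<exists>G\<in>Linf_space \<mu>. ae_add \<mu> G F = ae_const \<mu> 0"
      by (rule bexI[of _ "ae_class \<mu> (\<lambda>x. - f x)"])
        (use f in \<open>auto simp: ae_add_class intro!: Linf_spaceI\<close>)
  qed (auto intro: Linf_add Linf_const)
next
  show "comm_monoid (Linf_ring \<mu>)"
  proof (rule comm_monoidI; (simp add: Linf_ring_def)?)
    fix F G H
    assume "F \<in> Linf_space \<mu>" "G \<in> Linf_space \<mu>" "H \<in> Linf_space \<mu>"
    then show "ae_mult \<mu> (ae_mult \<mu> F G) H = ae_mult \<mu> F (ae_mult \<mu> G H)"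
      by (elim Linf_spaceE) (simp add: ae_mult_class mult.assoc)
  next
    fix F G
    assume "F \<in> Linf_space \<mu>" "G \<in> Linf_space \<mu>"
    then show "ae_mult \<mu> F G = ae_mult \<mu> G F"
      by (elim Linf_spaceE) (simp add: ae_mult_class mult.commute)
  next
    fix F
    assume "F \<in> Linf_space \<mu>"
    then show "ae_mult \<mu> (ae_const \<mu> 1) F = F"
      by (elim Linf_spaceE) (simp add: ae_mult_class)
  qed (auto intro: Linf_mult Linf_const)
next
  fix F G H
  assume "F \<in> carrier (Linf_ring \<mu>)" "G \<in> carrier (Linf_ring \<mu>)" "H \<in> carrier (Linf_ring \<mu>)"
  then show "(F \<oplus>\<^bsub>Linf_ring \<mu>\<^esub> G) \<otimes>\<^bsub>Linf_ring \<mu>\<^esub> H =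
      F \<otimes>\<^bsub>Linf_ring \<mu>\<^esub> H \<oplus>\<^bsub>Linf_ring \<mu>\<^esub> G \<otimes>\<^bsub>Linf_ring \<mu>\<^esub> H"
    unfolding Linf_ring_def
    by (auto elim!: Linf_spaceE simp: ae_add_class ae_mult_class distrib_right)
qed

end

theory Submission
  imports Defs "HOL-Probability.Conditional_Expectation"
begin

text \<open>The idea is to compose \<open>L\<close> with conditional expectations. Let \<open>\<iota>\<close> be a measurable map of \<open>Y\<close>
into the natural numbers whose fibres have finite measure, let \<open>F\<close> be the \<open>\<sigma>\<close>-algebra generated by
\<open>(\<phi>, \<iota>)\<close>, and let \<open>T\<close> be the conditional expectation given \<open>F\<close>. For \<open>v\<close> in \<open>M\<close> the function
\<open>T (L (\<phi>\<^sup>* v))\<close> has the form \<open>k (\<phi> y, \<iota> y)\<close>, so on the fibre \<open>\<iota> = i\<close> it is the pullback of the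
function \<open>k (\<cdot>, i)\<close> on \<open>X\<close>. As \<open>T\<close> commutes with multiplication by functions of \<open>\<phi>\<close>, the map
\<open>v \<mapsto> k (\<cdot>, i)\<close> is \<open>L\<^sup>\<infinity>\<close>-linear. It becomes an element \<open>\<omega>\<^sub>i\<close> of the dual of \<open>M\<close> after restriction to a
set \<open>G\<^sub>i\<close> on which \<open>\<mu>\<^sub>X\<close> and the image of the fibre are comparable
(\<open>comparable_part_of_image\<close>). The finite sum of the \<open>\<chi>\<^bsub>{\<iota> = i}\<^esub> \<phi>\<^sup>* \<omega>\<^sub>i\<close> is then an element \<open>\<Lambda>\<close> of
the pullback of the dual with \<open>I \<Lambda> (\<phi>\<^sup>* v) = \<chi>\<^sub>H T (L (\<phi>\<^sup>* v))\<close>, where the set \<open>H\<close> fills \<open>Y\<close> up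
to a small error on a prescribed set of finite measure (\<open>dual_step\<close>).

Since \<open>Y\<close> is separable, the maps \<open>\<iota>\<close> can be refined so that the \<open>\<sigma>\<close>-algebras exhaust the measurable
sets of \<open>Y\<close> up to small sets. As conditional expectations contract \<open>L\<^sup>1\<close>, a density argument gives
\<open>\<chi>\<^sub>H T f \<longlonglongrightarrow> f\<close> in \<open>L\<^sup>1\<close> for every integrable \<open>f\<close> (\<open>truncated_cond_exp_tendsto_L1\<close>), hence
convergence on the elements \<open>\<phi>\<^sup>* v\<close>. To pass to all elements \<open>V\<close> of the pullback, the functionals must be
bounded uniformly. For \<open>V\<close> that is, on the pieces \<open>B\<^sub>k\<close> of a finite partition, equal to \<open>\<phi>\<^sup>* w\<^sub>k\<close>, the
self-adjointness of \<open>T\<close> rewrites the \<open>L\<^sup>1\<close>-norm of \<open>I \<Lambda> V\<close> as the integral of \<open>L W\<close> for a \<open>W\<close> with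
\<open>|W| \<le> T (\<chi>\<^sub>H |V|)\<close>, and Jensen's inequality bounds the norm of \<open>W\<close> by that of \<open>V\<close>
(\<open>step_bounded_piecewise\<close>). Such \<open>V\<close> are dense, so every \<open>I \<Lambda>\<close> satisfies the bound of \<open>L\<close> itself.
As \<open>M\<close> may be non-separable, it matters that one sequence of operators serves all \<open>V\<close> simultaneously.\<close>

section \<open>Conditional expectations\<close>

text \<open>This is the Doob-Dynkin lemma for real functions: the factor is the infimum of the rationals \<open>q\<close>
whose sublevel set \<open>{f < q}\<close>, which is the preimage of some measurable \<open>U q\<close>, contains the point.\<close>

lemma vimage_algebra_real_factor:
  fixes f :: "'a \<Rightarrow> real"
  assumes f: "f \<in> borel_measurable (vimage_algebra X \<psi> Z)" and \<psi>: "\<psi> \<in> X \<rightarrow> space Z"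
  obtains k where "k \<in> borel_measurable Z" "\<And>x. x \<in> X \<Longrightarrow> f x = k (\<psi> x)"
proof -
  have "\<exists>U\<in>sets Z. {x \<in> X. f x < q} = \<psi> -` U \<inter> X" for q
  proof -
    have "{x \<in> space (vimage_algebra X \<psi> Z). f x < q} \<in> sets (vimage_algebra X \<psi> Z)"
      using f by measurable
    then show ?thesis by (auto simp: sets_vimage_algebra2[OF \<psi>])
  qed
  then obtain U where U: "\<And>q. U q \<in> sets Z" "\<And>q. {x \<in> X. f x < q} = \<psi> -` U q \<inter> X"
    by metis
  define k where "k z = (INF q\<in>\<rat>. if z \<in> U q then ereal q else \<infinity>)" for z
  have "k (\<psi> x) = ereal (f x)" if x: "x \<in> X" for x
  proof -
    have iff: "\<psi> x \<in> U q \<longleftrightarrow> f x < q" for q using U(2)[of q] x by blast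
    show ?thesis
      unfolding k_def iff
    proof (rule INF_eqI)
      show "ereal (f x) \<le> (if f x < i then ereal i else \<infinity>)" for i by auto
    next
      fix y assume y: "\<And>i. i \<in> \<rat> \<Longrightarrow> y \<le> (if f x < i then ereal i else \<infinity>)"
      show "y \<le> ereal (f x)"
      proof (rule ccontr)
        assume "\<not> y \<le> ereal (f x)"
        then obtain r where r: "ereal (f x) < ereal r" "ereal r < y"
          using ereal_dense2[of "ereal (f x)" y] by (auto simp: not_le)
        then obtain q where "q \<in> \<rat>" "f x < q" "q < r" using Rats_dense_in_real[of "f x" r] by auto
        with y[of q] have "y \<le> ereal q" by simp
        with r \<open>q < r\<close> show False by (metis ereal_less_eq(3) leD less_imp_le order_trans)
      qed
    qed
  qed
  moreover have "k \<in> borel_measurable Z"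
    unfolding k_def using U(1) by (intro borel_measurable_INF) (auto simp: countable_rat)
  ultimately show thesis
    by (intro that[of "\<lambda>z. real_of_ereal (k z)"]) auto
qed

text \<open>Absolute continuity of the image measure only gives a density \<open>\<rho>\<close> that may be unbounded or
vanish. Cutting down to \<open>G = {1/(k+1) \<le> \<rho> \<le> k+1}\<close> makes both measures comparable there, and the part of
\<open>E\<close> that is lost has small measure for large \<open>k\<close>, because the image measure does not charge
\<open>{\<rho> = 0}\<close> and \<open>{\<rho> = \<infinity>}\<close>.\<close>

lemma (in sigma_finite_measure) comparable_part_of_image:
  fixes \<delta> :: ennreal
  assumes \<phi>[measurable]: "\<phi> \<in> N \<rightarrow>\<^sub>M M" and ac: "absolutely_continuous M (distr N M \<phi>)"
    and E[measurable]: "E \<in> sets N" and fin: "emeasure N E < \<infinity>" and \<delta>: "0 < \<delta>"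
  obtains G and C :: real where "G \<in> sets M" "0 \<le> C" "emeasure N {y\<in>E. \<phi> y \<notin> G} < \<delta>"
    "\<And>g. g \<in> borel_measurable M \<Longrightarrow> (\<integral>\<^sup>+x. g x * indicator G x \<partial>M)
        \<le> C * (\<integral>\<^sup>+y. g (\<phi> y) * indicator G (\<phi> y) * indicator E y \<partial>N)"
    "\<And>g. g \<in> borel_measurable M \<Longrightarrow> (\<integral>\<^sup>+y. g (\<phi> y) * indicator G (\<phi> y) * indicator E y \<partial>N)
        \<le> C * (\<integral>\<^sup>+x. g x * indicator G x \<partial>M)"
proof -
  define m where "m = distr (density N (indicator E)) M \<phi>"
  have sm[simp, measurable_cong]: "sets m = sets M" by (simp add: m_def)
  have spm: "space m = space M" by (simp add: m_def)
  have m_int: "(\<integral>\<^sup>+x. g x \<partial>m) = (\<integral>\<^sup>+y. g (\<phi> y) * indicator E y \<partial>N)"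
    if [measurable]: "g \<in> borel_measurable M" for g
    unfolding m_def by (simp add: nn_integral_distr nn_integral_density mult.commute)
  have m_em: "emeasure m A = emeasure N {y \<in> E. \<phi> y \<in> A}" if [measurable]: "A \<in> sets M" for A
  proof -
    have "emeasure m A = (\<integral>\<^sup>+x. indicator A x \<partial>m)" using that by simp
    also have "\<dots> = (\<integral>\<^sup>+y. indicator A (\<phi> y) * indicator E y \<partial>N)" by (rule m_int) measurable
    also have "\<dots> = (\<integral>\<^sup>+y. indicator {y \<in> E. \<phi> y \<in> A} y \<partial>N)"
      by (rule nn_integral_cong) (auto simp: indicator_def)
    finally show ?thesis by simp
  qed
  have acm: "absolutely_continuous M m"
    unfolding absolutely_continuous_def
  proof
    fix A assume A: "A \<in> null_sets M"
    then have [measurable]: "A \<in> sets M" by auto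
    have "A \<in> null_sets (distr N M \<phi>)" using ac A by (auto simp: absolutely_continuous_def)
    then have "emeasure N (\<phi> -` A \<inter> space N) = 0" by (simp add: null_sets_def emeasure_distr)
    moreover have "emeasure N {y \<in> E. \<phi> y \<in> A} \<le> emeasure N (\<phi> -` A \<inter> space N)"
      by (rule emeasure_mono) (use sets.sets_into_space[OF E] in auto)
    ultimately show "A \<in> null_sets m" by (auto simp: null_sets_def m_em)
  qed
  have "emeasure m (space m) \<le> emeasure N E"
    unfolding spm by (subst m_em) (auto intro!: emeasure_mono)
  then have finm: "finite_measure m" by (intro finite_measureI) (use fin in \<open>auto simp: less_top[symmetric] top_unique\<close>)
  then interpret m: finite_measure m .
  define \<rho> where "\<rho> = RN_deriv M m"
  have [measurable]: "\<rho> \<in> borel_measurable M" by (simp add: \<rho>_def)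
  have dens: "density M \<rho> = m" unfolding \<rho>_def by (rule density_RN_deriv[OF acm]) simp
  have m_int': "(\<integral>\<^sup>+x. g x \<partial>m) = (\<integral>\<^sup>+x. \<rho> x * g x \<partial>M)" if [measurable]: "g \<in> borel_measurable M" for g
    unfolding dens[symmetric] by (simp add: nn_integral_density)
  have finite_\<rho>: "AE x in M. \<rho> x \<noteq> \<infinity>"
    unfolding \<rho>_def by (rule RN_deriv_finite[OF _ acm]) (auto simp: m.sigma_finite_measure_axioms)
  define G where "G k = {x \<in> space M. 1 \<le> (of_nat (Suc k)) * \<rho> x \<and> \<rho> x \<le> of_nat (Suc k)}" for k
  have G[measurable]: "G k \<in> sets M" for k unfolding G_def by measurable
  have "(\<lambda>k. emeasure m (space M - G k)) \<longlonglongrightarrow> emeasure m (\<Inter>k. space M - G k)"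
  proof (rule Lim_emeasure_decseq)
    show "decseq (\<lambda>k. space M - G k)"
    proof (rule decseq_SucI, rule Diff_mono[OF order_refl], rule subsetI)
      fix k x assume "x \<in> G k"
      then have x: "x \<in> space M" "1 \<le> (of_nat (Suc k)) * \<rho> x" "\<rho> x \<le> of_nat (Suc k)" by (auto simp: G_def)
      have le: "(of_nat (Suc k) :: ennreal) \<le> of_nat (Suc (Suc k))" by (simp add: add_increasing)
      have "1 \<le> of_nat (Suc (Suc k)) * \<rho> x" by (rule order_trans[OF x(2) mult_right_mono[OF le]]) simp
      moreover have "\<rho> x \<le> of_nat (Suc (Suc k))" by (rule order_trans[OF x(3) le])
      ultimately show "x \<in> G (Suc k)" using x(1) by (simp add: G_def)
    qed
  qed auto
  also have "emeasure m (\<Inter>k. space M - G k) = 0"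
  proof -
    have [measurable]: "(\<Inter>k. space M - G k) \<in> sets M" by measurable
    have ex: "\<exists>k. x \<in> G k" if x: "x \<in> space M" "\<rho> x \<noteq> 0" "\<rho> x \<noteq> \<infinity>" for x
    proof -
      obtain r where r: "\<rho> x = ennreal r" "0 < r" using x by (cases "\<rho> x") auto
      obtain k where k: "max r (1 / r) \<le> real k" using real_arch_simple by blast
      have "1 \<le> real (Suc k) * r" "r \<le> real (Suc k)" using k r by (auto simp: field_simps)
      then have "1 \<le> ennreal (real (Suc k) * r)" "ennreal r \<le> ennreal (real (Suc k))"
        using ennreal_leI[of 1 "real (Suc k) * r"] by (auto intro: ennreal_leI simp del: of_nat_Suc)
      then have "1 \<le> of_nat (Suc k) * \<rho> x" "\<rho> x \<le> of_nat (Suc k)"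
        using r by (simp_all only: r(1) ennreal_mult'' ennreal_of_nat_eq_real_of_nat less_imp_le)
      then show ?thesis using x by (auto simp: G_def)
    qed
    have "emeasure m (\<Inter>k. space M - G k) = (\<integral>\<^sup>+x. indicator (\<Inter>k. space M - G k) x \<partial>m)"
      using sm by (simp add: nn_integral_indicator del: INT_simps)
    also have "\<dots> = (\<integral>\<^sup>+x. \<rho> x * indicator (\<Inter>k. space M - G k) x \<partial>M)" by (rule m_int') measurable
    also have "\<dots> = (\<integral>\<^sup>+x. 0 \<partial>M)"
    proof (rule nn_integral_cong_AE)
      show "AE x in M. \<rho> x * indicator (\<Inter>k. space M - G k) x = 0"
        using finite_\<rho> AE_space
        by eventually_elim (use ex in \<open>auto simp: indicator_def\<close>)
    qed
    finally show ?thesis by simp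
  qed
  finally have "eventually (\<lambda>k. emeasure m (space M - G k) < \<delta>) sequentially"
    using \<delta> by (rule order_tendstoD(2))
  then obtain k where k: "emeasure m (space M - G k) < \<delta>" by (auto simp: eventually_sequentially)
  show thesis
  proof (rule that[OF G, of "real (Suc k)" k])
    have "{y \<in> E. \<phi> y \<in> space M - G k} = {y \<in> E. \<phi> y \<notin> G k}"
      using sets.sets_into_space[OF E] measurable_space[OF \<phi>] by auto
    then show "emeasure N {y \<in> E. \<phi> y \<notin> G k} < \<delta>" using k m_em[of "space M - G k"] by simp
    have C: "ennreal (real (Suc k)) = of_nat (Suc k)" by (simp only: ennreal_of_nat_eq_real_of_nat)
    fix g :: "_ \<Rightarrow> ennreal" assume [measurable]: "g \<in> borel_measurable M"
    have eq: "(\<integral>\<^sup>+y. g (\<phi> y) * indicator (G k) (\<phi> y) * indicator E y \<partial>N) = (\<integral>\<^sup>+x. \<rho> x * (g x * indicator (G k) x) \<partial>M)"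
      using m_int[of "\<lambda>x. g x * indicator (G k) x"] m_int'[of "\<lambda>x. g x * indicator (G k) x"] by simp
    have "(\<integral>\<^sup>+x. g x * indicator (G k) x \<partial>M) \<le> (\<integral>\<^sup>+x. of_nat (Suc k) * (\<rho> x * (g x * indicator (G k) x)) \<partial>M)"
    proof (rule nn_integral_mono)
      fix x
      show "g x * indicator (G k) x \<le> of_nat (Suc k) * (\<rho> x * (g x * indicator (G k) x))"
      proof (cases "x \<in> G k")
        case True
        then have "1 * g x \<le> (of_nat (Suc k) * \<rho> x) * g x" by (intro mult_right_mono) (auto simp: G_def)
        then show ?thesis using True by (simp add: mult.assoc)
      qed simp
    qed
    also have "\<dots> = of_nat (Suc k) * (\<integral>\<^sup>+x. \<rho> x * (g x * indicator (G k) x) \<partial>M)"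
      by (rule nn_integral_cmult) measurable
    finally show "(\<integral>\<^sup>+x. g x * indicator (G k) x \<partial>M)
        \<le> ennreal (real (Suc k)) * (\<integral>\<^sup>+y. g (\<phi> y) * indicator (G k) (\<phi> y) * indicator E y \<partial>N)"
      by (simp only: C eq)
    have "(\<integral>\<^sup>+x. \<rho> x * (g x * indicator (G k) x) \<partial>M) \<le> (\<integral>\<^sup>+x. of_nat (Suc k) * (g x * indicator (G k) x) \<partial>M)"
    proof (rule nn_integral_mono)
      fix x
      show "\<rho> x * (g x * indicator (G k) x) \<le> of_nat (Suc k) * (g x * indicator (G k) x)"
        by (cases "x \<in> G k") (auto intro!: mult_right_mono simp: G_def)
    qed
    also have "\<dots> = of_nat (Suc k) * (\<integral>\<^sup>+x. g x * indicator (G k) x \<partial>M)"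
      by (rule nn_integral_cmult) measurable
    finally show "(\<integral>\<^sup>+y. g (\<phi> y) * indicator (G k) (\<phi> y) * indicator E y \<partial>N)
        \<le> ennreal (real (Suc k)) * (\<integral>\<^sup>+x. g x * indicator (G k) x \<partial>M)"
      by (simp only: C eq)
  qed auto
qed

text \<open>Jensen's inequality for conditional expectations asks for convexity on an open set, so the convexity of
the power function on the positive reals has to be extended across \<open>0\<close>.\<close>

lemma convex_on_abs_powr:
  assumes p: "1 \<le> p"
  shows "convex_on UNIV (\<lambda>x::real. \<bar>x\<bar> powr p)"
proof (rule convex_onI)
  fix t x y :: real assume t: "0 < t" "t < 1"
  have *: "((1 - t) * a + t * b) powr p \<le> (1 - t) * a powr p + t * b powr p"
    if ab: "0 \<le> a" "0 \<le> b" for a b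
  proof -
    have le: "s powr p \<le> s" if "0 < s" "s < 1" for s :: real
      using powr_mono'[of 1 p s] that p by simp
    consider "a = 0" | "b = 0" | "0 < a" "0 < b" using ab by linarith
    then show ?thesis
    proof cases
      case 1
      then show ?thesis using t ab p le[of t] by (auto simp: powr_mult intro!: mult_right_mono)
    next
      case 2
      then show ?thesis using t ab p le[of "1 - t"] by (auto simp: powr_mult intro!: mult_right_mono)
    next
      case 3
      then show ?thesis using convex_onD[OF powr_convex[OF p], of t a b] t by auto
    qed
  qed
  have "\<bar>(1 - t) *\<^sub>R x + t *\<^sub>R y\<bar> \<le> (1 - t) * \<bar>x\<bar> + t * \<bar>y\<bar>"
    using t abs_triangle_ineq[of "(1 - t) * x" "t * y"] by (simp add: abs_mult)
  then have "\<bar>(1 - t) *\<^sub>R x + t *\<^sub>R y\<bar> powr p \<le> ((1 - t) * \<bar>x\<bar> + t * \<bar>y\<bar>) powr p"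
    using p by (intro powr_mono2) auto
  also have "\<dots> \<le> (1 - t) * \<bar>x\<bar> powr p + t * \<bar>y\<bar> powr p" by (rule *) auto
  finally show "\<bar>(1 - t) *\<^sub>R x + t *\<^sub>R y\<bar> powr p \<le> (1 - t) * \<bar>x\<bar> powr p + t * \<bar>y\<bar> powr p" .
qed simp

context sigma_finite_subalgebra
begin

lemma real_cond_exp_abs_le:
  assumes f: "integrable M f"
  shows "AE x in M. \<bar>real_cond_exp M F f x\<bar> \<le> real_cond_exp M F (\<lambda>x. \<bar>f x\<bar>) x"
proof -
  have "AE x in M. real_cond_exp M F f x \<le> real_cond_exp M F (\<lambda>x. \<bar>f x\<bar>) x"
    by (rule real_cond_exp_mono) (use f in auto)
  moreover have "AE x in M. real_cond_exp M F (\<lambda>x. - f x) x \<le> real_cond_exp M F (\<lambda>x. \<bar>f x\<bar>) x"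
    by (rule real_cond_exp_mono) (use f in auto)
  moreover have "AE x in M. real_cond_exp M F (\<lambda>x. - f x) x = - real_cond_exp M F f x"
    using real_cond_exp_cmult[OF f, of "-1"] by simp
  ultimately show ?thesis by eventually_elim auto
qed

lemma real_cond_exp_L1_contraction:
  assumes f: "integrable M f"
  shows "(\<integral>x. \<bar>real_cond_exp M F f x\<bar> \<partial>M) \<le> (\<integral>x. \<bar>f x\<bar> \<partial>M)"
proof -
  have "(\<integral>x. \<bar>real_cond_exp M F f x\<bar> \<partial>M) \<le> (\<integral>x. real_cond_exp M F (\<lambda>x. \<bar>f x\<bar>) x \<partial>M)"
    by (rule integral_mono_AE)
      (use f real_cond_exp_abs_le[OF f] real_cond_exp_int(1)[OF f] real_cond_exp_int(1)[of "\<lambda>x. \<bar>f x\<bar>"] in auto)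
  then show ?thesis using real_cond_exp_int(2)[of "\<lambda>x. \<bar>f x\<bar>"] f by simp
qed

lemma real_cond_exp_bounded:
  assumes f: "integrable M f" and C: "AE x in M. \<bar>f x\<bar> \<le> C"
  shows "AE x in M. \<bar>real_cond_exp M F f x\<bar> \<le> C"
proof -
  have "AE x in M. real_cond_exp M F f x \<le> C" by (rule real_cond_exp_le_c[OF f]) (use C in auto)
  moreover have "AE x in M. real_cond_exp M F f x \<ge> - C" by (rule real_cond_exp_ge_c[OF f]) (use C in auto)
  ultimately show ?thesis by eventually_elim auto
qed

text \<open>Both sides equal the integral of the product of the two conditional expectations.\<close>

lemma real_cond_exp_self_adjoint:
  assumes f: "integrable M f" and C: "AE x in M. \<bar>f x\<bar> \<le> C" and h: "integrable M h"
  shows "(\<integral>x. f x * real_cond_exp M F h x \<partial>M) = (\<integral>x. real_cond_exp M F f x * h x \<partial>M)"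
proof -
  have [measurable]: "f \<in> borel_measurable M" "h \<in> borel_measurable M" using f h by auto
  have "integrable M (\<lambda>x. C * real_cond_exp M F h x)" using real_cond_exp_int(1)[OF h] by simp
  then have i1: "integrable M (\<lambda>x. real_cond_exp M F h x * f x)"
    by (rule Bochner_Integration.integrable_bound)
      (use C in \<open>auto simp: abs_mult mult.commute intro!: mult_right_mono elim!: eventually_mono\<close>)
  have "integrable M (\<lambda>x. C * h x)" using h by simp
  then have i2: "integrable M (\<lambda>x. real_cond_exp M F f x * h x)"
    by (rule Bochner_Integration.integrable_bound)
      (use real_cond_exp_bounded[OF f C] in \<open>auto simp: abs_mult intro!: mult_right_mono elim!: eventually_mono\<close>)
  have "(\<integral>x. f x * real_cond_exp M F h x \<partial>M) = (\<integral>x. real_cond_exp M F h x * real_cond_exp M F f x \<partial>M)"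
    using real_cond_exp_intg(2)[OF i1] by (simp add: mult.commute)
  also have "\<dots> = (\<integral>x. real_cond_exp M F f x * h x \<partial>M)"
    using real_cond_exp_intg(2)[OF i2] by (simp add: mult.commute)
  finally show ?thesis .
qed

lemma real_cond_exp_Lp_contraction:
  assumes p: "1 \<le> p" and f: "integrable M f" and fp: "integrable M (\<lambda>x. \<bar>f x\<bar> powr p)"
  shows "integrable M (\<lambda>x. \<bar>real_cond_exp M F f x\<bar> powr p)"
    and "(\<integral>x. \<bar>real_cond_exp M F f x\<bar> powr p \<partial>M) \<le> (\<integral>x. \<bar>f x\<bar> powr p \<partial>M)"
proof -
  show i: "integrable M (\<lambda>x. \<bar>real_cond_exp M F f x\<bar> powr p)"
    by (rule integrable_convex_cond_exp[OF f _ _ fp convex_on_abs_powr[OF p]]) auto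
  have "(\<integral>x. \<bar>real_cond_exp M F f x\<bar> powr p \<partial>M) \<le> (\<integral>x. real_cond_exp M F (\<lambda>x. \<bar>f x\<bar> powr p) x \<partial>M)"
    by (rule integral_mono_AE[OF i real_cond_exp_int(1)[OF fp]])
      (rule real_cond_exp_jensens_inequality(2)[OF f _ _ fp convex_on_abs_powr[OF p]], auto)
  then show "(\<integral>x. \<bar>real_cond_exp M F f x\<bar> powr p \<partial>M) \<le> (\<integral>x. \<bar>f x\<bar> powr p \<partial>M)"
    using real_cond_exp_int(2)[OF fp] by simp
qed

end

text \<open>The truncated conditional expectations contract
\<open>L\<^sup>1\<close>, and on the indicator of \<open>A k \<inter> D m\<close> they are the identity up to an error on \<open>D m - H n\<close> as soon as
\<open>n > k\<close>. By separability these indicators approximate those of all sets of finite measure.\<close>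

lemma truncated_cond_exp_tendsto_L1:
  fixes M :: "'a measure" and F :: "nat \<Rightarrow> 'a measure" and A D H :: "nat \<Rightarrow> 'a set"
  assumes sub: "\<And>n. sigma_finite_subalgebra M (F n)"
    and A[measurable]: "\<And>k. A k \<in> sets M"
    and sep: "\<And>B. B \<in> sets M \<Longrightarrow> emeasure M B < \<infinity> \<Longrightarrow> (INF n. emeasure M (sym_diff (A n) B)) = 0"
    and D[measurable]: "\<And>m. D m \<in> sets M" and D_mono: "incseq D" and D_UN: "(\<Union>m. D m) = space M"
    and D_fin: "\<And>m. emeasure M (D m) < \<infinity>"
    and DF: "\<And>m n. D m \<in> sets (F n)" and AF: "\<And>k n. k < n \<Longrightarrow> A k \<in> sets (F n)"
    and H[measurable]: "\<And>n. H n \<in> sets M"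
    and DH: "\<And>m. (\<lambda>n. emeasure M (D m - H n)) \<longlonglongrightarrow> 0"
    and f: "integrable M f"
  shows "(\<lambda>n. \<integral>x. \<bar>indicator (H n) x * real_cond_exp M (F n) f x - f x\<bar> \<partial>M) \<longlonglongrightarrow> 0"
proof -
  define T where "T n = real_cond_exp M (F n)" for n
  define R where "R n f x = indicator (H n) x * T n f x" for n f x
  have T_int: "integrable M (T n g)" if "integrable M g" for n g
    unfolding T_def by (rule sigma_finite_subalgebra.real_cond_exp_int(1)[OF sub that])
  have R_int: "integrable M (R n g)" if "integrable M g" for n g
    using integrable_real_mult_indicator[OF H T_int[OF that], of n n] by (simp add: R_def[abs_def] mult.commute)
  have R_add: "AE x in M. R n (\<lambda>x. g x + h x) x = R n g x + R n h x" if "integrable M g" "integrable M h" for n g h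
    using sigma_finite_subalgebra.real_cond_exp_add[OF sub that, of n]
    unfolding R_def T_def by eventually_elim (simp add: algebra_simps)
  have R_cmult: "AE x in M. R n (\<lambda>x. c * g x) x = c * R n g x" if "integrable M g" for n c g
    using sigma_finite_subalgebra.real_cond_exp_cmult[OF sub that, of n c]
    unfolding R_def T_def by eventually_elim (simp add: algebra_simps)
  have R_diff: "AE x in M. R n (\<lambda>x. g x - h x) x = R n g x - R n h x" if "integrable M g" "integrable M h" for n g h
    using sigma_finite_subalgebra.real_cond_exp_diff[OF sub that, of n]
    unfolding R_def T_def by eventually_elim (simp only: right_diff_distrib)
  have R_contr: "(\<integral>x. \<bar>R n g x\<bar> \<partial>M) \<le> (\<integral>x. \<bar>g x\<bar> \<partial>M)" if g: "integrable M g" for n g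
  proof -
    have "(\<integral>x. \<bar>R n g x\<bar> \<partial>M) \<le> (\<integral>x. \<bar>T n g x\<bar> \<partial>M)"
    proof (rule integral_mono)
      show "integrable M (\<lambda>x. \<bar>R n g x\<bar>)" "integrable M (\<lambda>x. \<bar>T n g x\<bar>)"
        by (intro integrable_abs R_int T_int g)+
    qed (auto simp: R_def indicator_def)
    also have "\<dots> \<le> (\<integral>x. \<bar>g x\<bar> \<partial>M)"
      unfolding T_def by (rule sigma_finite_subalgebra.real_cond_exp_L1_contraction[OF sub g])
    finally show ?thesis .
  qed
  define conv where "conv g \<longleftrightarrow> (\<lambda>n. \<integral>x. \<bar>R n g x - g x\<bar> \<partial>M) \<longlonglongrightarrow> 0" for g
  have approx: "conv f"
    if f: "integrable M f" and ex: "\<And>e. 0 < e \<Longrightarrow> \<exists>g. integrable M g \<and> conv g \<and> (\<integral>x. \<bar>f x - g x\<bar> \<partial>M) < e" for f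
    unfolding conv_def
  proof (rule LIMSEQ_I)
    fix e :: real assume e: "0 < e"
    obtain g where g: "integrable M g" "conv g" "(\<integral>x. \<bar>f x - g x\<bar> \<partial>M) < e / 3" using ex[of "e / 3"] e by auto
    obtain N where N: "\<And>n. N \<le> n \<Longrightarrow> \<bar>\<integral>x. \<bar>R n g x - g x\<bar> \<partial>M\<bar> < e / 3"
      using LIMSEQ_D[OF g(2)[unfolded conv_def], of "e / 3"] e by auto
    show "\<exists>no. \<forall>n\<ge>no. norm ((\<integral>x. \<bar>R n f x - f x\<bar> \<partial>M) - 0) < e"
    proof (intro exI allI impI)
      fix n assume n: "N \<le> n"
      note i = f g(1) R_int[OF f, of n] R_int[OF g(1), of n]
      have i3: "integrable M (\<lambda>x. f x - g x)" using i by auto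
      have "(\<integral>x. \<bar>R n f x - f x\<bar> \<partial>M) \<le> (\<integral>x. \<bar>R n (\<lambda>x. f x - g x) x\<bar> + \<bar>R n g x - g x\<bar> + \<bar>f x - g x\<bar> \<partial>M)"
        by (rule integral_mono_AE)
          (use i R_int[OF i3, of n] R_diff[OF f g(1), of n] in \<open>auto elim!: eventually_mono\<close>)
      also have "\<dots> = (\<integral>x. \<bar>R n (\<lambda>x. f x - g x) x\<bar> \<partial>M) + (\<integral>x. \<bar>R n g x - g x\<bar> \<partial>M) + (\<integral>x. \<bar>f x - g x\<bar> \<partial>M)"
        using i R_int[OF i3, of n] by simp
      also have "\<dots> < e" using R_contr[OF i3, of n] N[OF n] g(3) by linarith
      finally show "norm ((\<integral>x. \<bar>R n f x - f x\<bar> \<partial>M) - 0) < e" by (simp add: integral_nonneg)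
    qed
  qed
  have conv_AD: "conv (indicator (A k \<inter> D m))" for k m
    unfolding conv_def
  proof (rule tendsto_sandwich[OF _ _ tendsto_const])
    have lt: "emeasure M (D m - H n) < \<infinity>" for n
      using D_fin[of m] emeasure_mono[of "D m - H n" "D m" M] by (auto intro: le_less_trans)
    have "(\<lambda>n. enn2real (emeasure M (D m - H n))) \<longlonglongrightarrow> 0"
      using tendsto_enn2real[of "\<lambda>n. emeasure M (D m - H n)" 0 sequentially] DH[of m] by simp
    then show "(\<lambda>n. measure M (D m - H n)) \<longlonglongrightarrow> 0" by (simp add: measure_def)
    show "\<forall>\<^sub>F n in sequentially. (\<integral>x. \<bar>R n (indicator (A k \<inter> D m)) x - indicator (A k \<inter> D m) x\<bar> \<partial>M)
        \<le> measure M (D m - H n)"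
      using eventually_gt_at_top[of k]
    proof eventually_elim
      case (elim n)
      have fin: "emeasure M (A k \<inter> D m) < \<infinity>"
        using D_fin[of m] emeasure_mono[of "A k \<inter> D m" "D m" M] by (auto intro: le_less_trans)
      have int: "integrable M (indicator (A k \<inter> D m) :: 'a \<Rightarrow> real)"
        using fin by (intro integrable_real_indicator) auto
      have "AE x in M. T n (indicator (A k \<inter> D m)) x = indicator (A k \<inter> D m) x"
        unfolding T_def
        by (rule sigma_finite_subalgebra.real_cond_exp_F_meas[OF sub int])
          (use AF[OF elim] DF[of m n] in auto)
      then have "(\<integral>x. \<bar>R n (indicator (A k \<inter> D m)) x - indicator (A k \<inter> D m) x\<bar> \<partial>M)
          \<le> (\<integral>x. indicator (D m - H n) x \<partial>M)"
      proof (intro integral_mono_AE)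
        show "integrable M (\<lambda>x. \<bar>R n (indicator (A k \<inter> D m)) x - indicator (A k \<inter> D m) x\<bar>)"
          by (intro integrable_abs Bochner_Integration.integrable_diff R_int int)
        show "integrable M (indicator (D m - H n) :: 'a \<Rightarrow> real)"
          using lt[of n] by (intro integrable_real_indicator) auto
      qed (auto elim!: eventually_mono simp: R_def indicator_def)
      then show ?case by simp
    qed
  qed (simp add: integral_nonneg)
  have conv_ind: "conv (indicator B)" if B[measurable]: "B \<in> sets M" and fin: "emeasure M B < \<infinity>" for B
  proof (rule approx)
    show "integrable M (indicator B :: 'a \<Rightarrow> real)" using fin by (intro integrable_real_indicator) auto
    fix e :: real assume e: "0 < e"
    have "(\<lambda>m. emeasure M (B - D m)) \<longlonglongrightarrow> emeasure M (\<Inter>m. B - D m)"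
    proof (rule Lim_emeasure_decseq)
      show "decseq (\<lambda>m. B - D m)" using D_mono by (fastforce simp: incseq_def decseq_def)
      show "emeasure M (B - D m) \<noteq> \<infinity>" for m
        using fin emeasure_mono[of "B - D m" B M] by (auto simp: less_top[symmetric] top_unique)
    qed auto
    also have "(\<Inter>m. B - D m) = {}" using D_UN sets.sets_into_space[OF B] by auto
    finally have "eventually (\<lambda>m. emeasure M (B - D m) < ennreal (e / 2)) sequentially"
      using e by (intro order_tendstoD(2)[of _ 0]) auto
    then obtain m where m: "emeasure M (B - D m) < ennreal (e / 2)" by (auto simp: eventually_sequentially)
    have "emeasure M (B \<inter> D m) < \<infinity>"
      using fin emeasure_mono[of "B \<inter> D m" B M] by (auto intro: le_less_trans)
    then have "(INF n. emeasure M (sym_diff (A n) (B \<inter> D m))) < ennreal (e / 2)"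
      using e by (subst sep) auto
    then obtain k where k: "emeasure M (sym_diff (A k) (B \<inter> D m)) < ennreal (e / 2)"
      by (auto simp: INF_less_iff)
    have fin2: "emeasure M (A k \<inter> D m) < \<infinity>"
      using D_fin[of m] emeasure_mono[of "A k \<inter> D m" "D m" M] by (auto intro: le_less_trans)
    have i: "integrable M (indicator B :: 'a \<Rightarrow> real)" "integrable M (indicator (A k \<inter> D m) :: 'a \<Rightarrow> real)"
      "integrable M (indicator (B - D m) :: 'a \<Rightarrow> real)"
      "integrable M (indicator (sym_diff (A k) (B \<inter> D m)) :: 'a \<Rightarrow> real)"
      using fin fin2 order.strict_trans[OF m] order.strict_trans[OF k]
      by (auto intro!: integrable_real_indicator)
    have "(\<integral>x. \<bar>indicator B x - indicator (A k \<inter> D m) x\<bar> \<partial>M)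
        \<le> (\<integral>x. indicator (B - D m) x + indicator (sym_diff (A k) (B \<inter> D m)) x \<partial>M :: real)"
    proof (rule integral_mono)
      show "integrable M (\<lambda>x. \<bar>indicator B x - indicator (A k \<inter> D m) x\<bar> :: real)"
        by (intro integrable_abs Bochner_Integration.integrable_diff i)
      show "integrable M (\<lambda>x. indicator (B - D m) x + indicator (sym_diff (A k) (B \<inter> D m)) x :: real)"
        by (intro Bochner_Integration.integrable_add i)
    qed (auto simp: indicator_def)
    also have "\<dots> = measure M (B - D m) + measure M (sym_diff (A k) (B \<inter> D m))"
      using i by (subst Bochner_Integration.integral_add) auto
    also have "\<dots> < e / 2 + e / 2"
    proof (rule add_strict_mono)
      have "measure M S < e / 2" if "emeasure M S < ennreal (e / 2)" for S
        using that order.strict_trans[OF that ennreal_less_top]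
        by (simp add: emeasure_eq_ennreal_measure ennreal_less_iff)
      then show "measure M (B - D m) < e / 2" "measure M (sym_diff (A k) (B \<inter> D m)) < e / 2"
        using m k by blast+
    qed
    finally show "\<exists>g. integrable M g \<and> conv g \<and> (\<integral>x. \<bar>indicator B x - g x\<bar> \<partial>M) < e"
      using i(2) conv_AD[of k m] by (intro exI[of _ "indicator (A k \<inter> D m)"]) auto
  qed
  have "conv f" using f
  proof (induct rule: integrable_induct)
    case (base B c)
    have i: "integrable M (indicator B :: 'a \<Rightarrow> real)" using base by (intro integrable_real_indicator) auto
    have ci: "integrable M (\<lambda>x. c * indicator B x)" using i by simp
    have "(\<integral>x. \<bar>R n (\<lambda>x. c * indicator B x) x - c * indicator B x\<bar> \<partial>M)
        = (\<integral>x. \<bar>c\<bar> * \<bar>R n (indicator B) x - indicator B x\<bar> \<partial>M)" for n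
    proof (rule integral_cong_AE)
      show "AE x in M. \<bar>R n (\<lambda>x. c * indicator B x) x - c * indicator B x\<bar> = \<bar>c\<bar> * \<bar>R n (indicator B) x - indicator B x\<bar>"
        using R_cmult[OF i, of n c] by eventually_elim (simp flip: abs_mult add: algebra_simps)
    qed (use R_int[OF i, of n] R_int[OF ci, of n] i in auto)
    then have "conv (\<lambda>x. c * indicator B x)"
      using tendsto_mult_left[OF conv_ind[OF base, unfolded conv_def], of "\<bar>c\<bar>"] by (simp add: conv_def)
    then show ?case by (simp add: mult.commute)
  next
    case (add g h)
    show ?case
      unfolding conv_def
    proof (rule tendsto_sandwich[OF _ _ tendsto_const])
      show "(\<lambda>n. (\<integral>x. \<bar>R n g x - g x\<bar> \<partial>M) + (\<integral>x. \<bar>R n h x - h x\<bar> \<partial>M)) \<longlonglongrightarrow> 0"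
        using tendsto_add[OF add(2,4)[unfolded conv_def]] by simp
      show "\<forall>\<^sub>F n in sequentially. (\<integral>x. \<bar>R n (\<lambda>x. g x + h x) x - (g x + h x)\<bar> \<partial>M)
          \<le> (\<integral>x. \<bar>R n g x - g x\<bar> \<partial>M) + (\<integral>x. \<bar>R n h x - h x\<bar> \<partial>M)"
      proof (rule always_eventually, rule allI)
        fix n
        have gh: "integrable M (\<lambda>x. g x + h x)" using add by simp
        note i = add(1,3) R_int[OF add(1), of n] R_int[OF add(3), of n] R_int[OF gh, of n]
        have "(\<integral>x. \<bar>R n (\<lambda>x. g x + h x) x - (g x + h x)\<bar> \<partial>M)
          \<le> (\<integral>x. \<bar>R n g x - g x\<bar> + \<bar>R n h x - h x\<bar> \<partial>M)"
          by (rule integral_mono_AE) (use i R_add[OF add(1,3), of n] in \<open>auto elim!: eventually_mono\<close>)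
        then show "(\<integral>x. \<bar>R n (\<lambda>x. g x + h x) x - (g x + h x)\<bar> \<partial>M)
          \<le> (\<integral>x. \<bar>R n g x - g x\<bar> \<partial>M) + (\<integral>x. \<bar>R n h x - h x\<bar> \<partial>M)"
          using i by simp
      qed
    qed (simp add: integral_nonneg)
  next
    case (lim f s)
    show ?case
    proof (rule approx[OF lim(5)])
      fix e :: real assume e: "0 < e"
      have "(\<lambda>i. \<integral>x. \<bar>f x - s i x\<bar> \<partial>M) \<longlonglongrightarrow> (\<integral>x. 0 \<partial>M)"
      proof (rule integral_dominated_convergence[where w = "\<lambda>x. 3 * \<bar>f x\<bar>"])
        show "AE x in M. (\<lambda>i. \<bar>f x - s i x\<bar>) \<longlonglongrightarrow> 0"
        proof (rule AE_I2)
          fix x assume "x \<in> space M"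
          from tendsto_rabs[OF tendsto_diff[OF tendsto_const lim(3)[OF this], of "f x"]]
          show "(\<lambda>i. \<bar>f x - s i x\<bar>) \<longlonglongrightarrow> 0" by simp
        qed
        show "AE x in M. norm \<bar>f x - s i x\<bar> \<le> 3 * \<bar>f x\<bar>" for i
        proof (rule AE_I2)
          fix x assume "x \<in> space M"
          from lim(4)[OF this, of i] show "norm \<bar>f x - s i x\<bar> \<le> 3 * \<bar>f x\<bar>" by auto
        qed
      qed (use lim in auto)
      then have "eventually (\<lambda>i. (\<integral>x. \<bar>f x - s i x\<bar> \<partial>M) < e) sequentially"
        using e by (intro order_tendstoD(2)[of _ 0]) auto
      then obtain i where "(\<integral>x. \<bar>f x - s i x\<bar> \<partial>M) < e" by (auto simp: eventually_sequentially)
      then show "\<exists>g. integrable M g \<and> conv g \<and> (\<integral>x. \<bar>f x - g x\<bar> \<partial>M) < e" using lim by blast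
    qed
  qed
  then show ?thesis by (simp add: conv_def R_def T_def)
qed

section \<open>Classes of functions and the space of integrable classes\<close>

lemma ae_class_eq_iff:
  assumes "f \<in> borel_measurable \<mu>" "g \<in> borel_measurable \<mu>"
  shows "ae_class \<mu> f = ae_class \<mu> g \<longleftrightarrow> (AE x in \<mu>. f x = g x)"
proof
  assume "ae_class \<mu> f = ae_class \<mu> g"
  moreover have "f \<in> ae_class \<mu> f" using assms by (simp add: ae_class_def)
  ultimately have "f \<in> ae_class \<mu> g" by simp
  then show "AE x in \<mu>. f x = g x" by (simp add: ae_class_def)
qed (rule ae_class_eqI)

lemma L0_rep:
  assumes "F \<in> L0_space \<mu>"
  shows "ae_rep F \<in> borel_measurable \<mu>" "ae_class \<mu> (ae_rep F) = F"
  using assms ae_rep_class by (auto simp: L0_space_def intro!: ae_class_eqI)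

lemma Lp_space_iff:
  assumes "f \<in> borel_measurable \<mu>"
  shows "ae_class \<mu> f \<in> Lp_space \<mu> p \<longleftrightarrow> integrable \<mu> (\<lambda>x. \<bar>f x\<bar> powr p)"
proof
  assume "ae_class \<mu> f \<in> Lp_space \<mu> p"
  then obtain g where g: "g \<in> borel_measurable \<mu>" "integrable \<mu> (\<lambda>x. \<bar>g x\<bar> powr p)"
    "ae_class \<mu> f = ae_class \<mu> g" by (auto simp: Lp_space_def)
  have "AE x in \<mu>. f x = g x" using g assms by (simp add: ae_class_eq_iff)
  then show "integrable \<mu> (\<lambda>x. \<bar>f x\<bar> powr p)"
    by (intro integrable_cong_AE_imp[OF g(2)]) (use assms in auto)
qed (use assms in \<open>auto simp: Lp_space_def\<close>)

lemma Lp_rep: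
  assumes "F \<in> Lp_space \<mu> p"
  shows "ae_rep F \<in> borel_measurable \<mu>" "ae_class \<mu> (ae_rep F) = F"
    "integrable \<mu> (\<lambda>x. \<bar>ae_rep F x\<bar> powr p)"
proof -
  have *: "F \<in> L0_space \<mu>" using assms by (auto simp: Lp_space_def L0_space_def)
  show "ae_rep F \<in> borel_measurable \<mu>" "ae_class \<mu> (ae_rep F) = F" using L0_rep[OF *] .
  then show "integrable \<mu> (\<lambda>x. \<bar>ae_rep F x\<bar> powr p)"
    using assms Lp_space_iff by metis
qed

lemma L1_rep:
  assumes "F \<in> Lp_space \<mu> 1"
  shows "ae_rep F \<in> borel_measurable \<mu>" "ae_class \<mu> (ae_rep F) = F" "integrable \<mu> (ae_rep F)"
  using Lp_rep[OF assms] by (auto simp: integrable_abs_iff)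

lemma L1_space_iff:
  assumes "f \<in> borel_measurable \<mu>"
  shows "ae_class \<mu> f \<in> Lp_space \<mu> 1 \<longleftrightarrow> integrable \<mu> f"
  using Lp_space_iff[OF assms, of 1] assms by (simp add: integrable_abs_iff)

lemma Lp_norm_class:
  assumes "f \<in> borel_measurable \<mu>"
  shows "Lp_norm \<mu> p (ae_class \<mu> f) = (\<integral>x. \<bar>f x\<bar> powr p \<partial>\<mu>) powr (1 / p)"
proof -
  have "(\<integral>x. \<bar>ae_rep (ae_class \<mu> f) x\<bar> powr p \<partial>\<mu>) = (\<integral>x. \<bar>f x\<bar> powr p \<partial>\<mu>)"
    by (rule integral_cong_AE) (use assms ae_rep_class[OF assms] in auto)
  then show ?thesis by (simp add: Lp_norm_def)
qed

lemma L1_norm_class: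
  assumes "f \<in> borel_measurable \<mu>"
  shows "Lp_norm \<mu> 1 (ae_class \<mu> f) = (\<integral>x. \<bar>f x\<bar> \<partial>\<mu>)"
  using Lp_norm_class[OF assms, of 1] by simp

lemma abelian_group_L1: "abelian_group (L1 \<mu>)"
proof (rule abelian_groupI)
  fix F G H
  assume "F \<in> carrier (L1 \<mu>)" "G \<in> carrier (L1 \<mu>)" "H \<in> carrier (L1 \<mu>)"
  then show "F \<oplus>\<^bsub>L1 \<mu>\<^esub> G \<oplus>\<^bsub>L1 \<mu>\<^esub> H = F \<oplus>\<^bsub>L1 \<mu>\<^esub> (G \<oplus>\<^bsub>L1 \<mu>\<^esub> H)"
    by (auto simp: L1_def Lp_space_def ae_add_class add.assoc)
next
  fix F G
  assume "F \<in> carrier (L1 \<mu>)" "G \<in> carrier (L1 \<mu>)"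
  then show "F \<oplus>\<^bsub>L1 \<mu>\<^esub> G = G \<oplus>\<^bsub>L1 \<mu>\<^esub> F" "F \<oplus>\<^bsub>L1 \<mu>\<^esub> G \<in> carrier (L1 \<mu>)"
    by (auto simp: L1_def Lp_space_def ae_add_class add.commute integrable_abs_iff)
next
  fix F
  assume F: "F \<in> carrier (L1 \<mu>)"
  then show "\<zero>\<^bsub>L1 \<mu>\<^esub> \<oplus>\<^bsub>L1 \<mu>\<^esub> F = F"
    by (auto simp: L1_def Lp_space_def ae_add_class)
  have "ae_class \<mu> (\<lambda>x. - ae_rep F x) \<in> Lp_space \<mu> 1"
    using F L1_rep[of F] by (simp add: L1_def L1_space_iff)
  moreover have "ae_add \<mu> (ae_class \<mu> (\<lambda>x. - ae_rep F x)) (ae_class \<mu> (ae_rep F)) = ae_const \<mu> 0"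
    using F L1_rep[of F \<mu>] by (subst ae_add_class) (auto simp: L1_def)
  ultimately show "\<exists>G\<in>carrier (L1 \<mu>). G \<oplus>\<^bsub>L1 \<mu>\<^esub> F = \<zero>\<^bsub>L1 \<mu>\<^esub>"
    using F L1_rep[of F \<mu>] by (auto simp: L1_def)
qed (auto simp: L1_def L1_space_iff)

lemma L1_minus_class:
  assumes "integrable \<mu> f" "integrable \<mu> g"
  shows "ae_class \<mu> f \<ominus>\<^bsub>L1 \<mu>\<^esub> ae_class \<mu> g = ae_class \<mu> (\<lambda>x. f x - g x)"
proof -
  interpret L: abelian_group "L1 \<mu>" by (rule abelian_group_L1)
  have [measurable]: "f \<in> borel_measurable \<mu>" "g \<in> borel_measurable \<mu>" using assms by auto
  have "\<ominus>\<^bsub>L1 \<mu>\<^esub> ae_class \<mu> g = ae_class \<mu> (\<lambda>x. - g x)"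
    by (rule L.minus_equality)
      (use assms in \<open>auto simp: L1_def L1_space_iff ae_add_class\<close>)
  then show ?thesis
    by (simp add: a_minus_def) (simp add: L1_def ae_add_class)
qed

lemma mnorm_L1_minus:
  assumes "integrable \<mu> f" "integrable \<mu> g"
  shows "mnorm (L1 \<mu>) (ae_class \<mu> f \<ominus>\<^bsub>L1 \<mu>\<^esub> ae_class \<mu> g) = (\<integral>x. \<bar>f x - g x\<bar> \<partial>\<mu>)"
  using assms by (simp add: L1_minus_class) (simp add: L1_def L1_norm_class)

lemma mdist_L1:
  assumes "F \<in> Lp_space \<mu> 1" "G \<in> Lp_space \<mu> 1"
  shows "mdist (L1 \<mu>) F G = (\<integral>x. \<bar>ae_rep F x - ae_rep G x\<bar> \<partial>\<mu>)"
proof -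
  have "mdist (L1 \<mu>) F G = mnorm (L1 \<mu>) (F \<ominus>\<^bsub>L1 \<mu>\<^esub> G)" using assms by (simp add: mdist_def) (simp add: L1_def)
  also have "\<dots> = (\<integral>x. \<bar>ae_rep F x - ae_rep G x\<bar> \<partial>\<mu>)"
    using mnorm_L1_minus[OF L1_rep(3)[OF assms(1)] L1_rep(3)[OF assms(2)]] by (simp add: L1_rep(2)[OF assms(1)] L1_rep(2)[OF assms(2)])
  finally show ?thesis .
qed

lemma Metric_space_L1: "Metric_space (Lp_space \<mu> 1) (mdist (L1 \<mu>))"
proof
  show nonneg: "0 \<le> mdist (L1 \<mu>) F G" for F G
    by (cases "F \<in> Lp_space \<mu> 1 \<and> G \<in> Lp_space \<mu> 1")
      (auto simp: mdist_L1, auto simp: mdist_def L1_def)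
  show "mdist (L1 \<mu>) F G = mdist (L1 \<mu>) G F" for F G
    by (cases "F \<in> Lp_space \<mu> 1 \<and> G \<in> Lp_space \<mu> 1")
      (auto simp: mdist_L1 abs_minus_commute, auto simp: mdist_def L1_def)
next
  fix F G assume FG: "F \<in> Lp_space \<mu> 1" "G \<in> Lp_space \<mu> 1"
  note r = L1_rep[OF FG(1)] L1_rep[OF FG(2)]
  have "mdist (L1 \<mu>) F G = 0 \<longleftrightarrow> (AE x in \<mu>. \<bar>ae_rep F x - ae_rep G x\<bar> = 0)"
    unfolding mdist_L1[OF FG] by (rule integral_nonneg_eq_0_iff_AE) (use r in auto)
  also have "\<dots> \<longleftrightarrow> F = G"
    using ae_class_eq_iff[OF r(1) r(4)] r by simp
  finally show "mdist (L1 \<mu>) F G = 0 \<longleftrightarrow> F = G" .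
next
  fix F G H assume FG: "F \<in> Lp_space \<mu> 1" "G \<in> Lp_space \<mu> 1" "H \<in> Lp_space \<mu> 1"
  note r = L1_rep[OF FG(1)] L1_rep[OF FG(2)] L1_rep[OF FG(3)]
  have "(\<integral>x. \<bar>ae_rep F x - ae_rep H x\<bar> \<partial>\<mu>)
      \<le> (\<integral>x. \<bar>ae_rep F x - ae_rep G x\<bar> + \<bar>ae_rep G x - ae_rep H x\<bar> \<partial>\<mu>)"
    by (rule integral_mono) (use r in auto)
  also have "\<dots> = (\<integral>x. \<bar>ae_rep F x - ae_rep G x\<bar> \<partial>\<mu>) + (\<integral>x. \<bar>ae_rep G x - ae_rep H x\<bar> \<partial>\<mu>)"
    by (rule Bochner_Integration.integral_add) (use r in auto)
  finally show "mdist (L1 \<mu>) F H \<le> mdist (L1 \<mu>) F G + mdist (L1 \<mu>) G H"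
    using FG by (simp add: mdist_L1)
qed

section \<open>Pointwise norm and action of functions in a normed module\<close>

text \<open>Calculations are done with functions instead of classes, so the counterpart of \<open>Linf_space\<close> for functions
is needed.\<close>

definition ess_bdd :: "'x measure \<Rightarrow> ('x \<Rightarrow> real) \<Rightarrow> bool" where
  "ess_bdd \<mu> f \<longleftrightarrow> f \<in> borel_measurable \<mu> \<and> (\<exists>C. AE x in \<mu>. \<bar>f x\<bar> \<le> C)"

lemma ess_bddI: "f \<in> borel_measurable \<mu> \<Longrightarrow> (\<And>x. \<bar>f x\<bar> \<le> C) \<Longrightarrow> ess_bdd \<mu> f"
  by (auto simp: ess_bdd_def)

lemma ess_bdd_meas: "ess_bdd \<mu> f \<Longrightarrow> f \<in> borel_measurable \<mu>"
  by (simp add: ess_bdd_def)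

lemma ess_bdd_Linf: "ess_bdd \<mu> f \<Longrightarrow> ae_class \<mu> f \<in> Linf_space \<mu>"
  by (auto simp: ess_bdd_def Linf_space_def)

lemma ess_bdd_const: "ess_bdd \<mu> (\<lambda>_. c)"
  by (rule ess_bddI[of _ _ "\<bar>c\<bar>"]) auto

lemma ess_bdd_indicator: "A \<in> sets \<mu> \<Longrightarrow> ess_bdd \<mu> (indicator A)"
  by (rule ess_bddI[of _ _ 1]) (auto simp: indicator_def)

lemma ess_bdd_add: "ess_bdd \<mu> f \<Longrightarrow> ess_bdd \<mu> g \<Longrightarrow> ess_bdd \<mu> (\<lambda>x. f x + g x)"
proof -
  assume fg: "ess_bdd \<mu> f" "ess_bdd \<mu> g"
  obtain C D where "AE x in \<mu>. \<bar>f x\<bar> \<le> C" "AE x in \<mu>. \<bar>g x\<bar> \<le> D" using fg by (auto simp: ess_bdd_def)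
  then have "AE x in \<mu>. \<bar>f x + g x\<bar> \<le> C + D" by eventually_elim linarith
  then show ?thesis using fg by (auto simp: ess_bdd_def)
qed

lemma ess_bdd_mult: "ess_bdd \<mu> f \<Longrightarrow> ess_bdd \<mu> g \<Longrightarrow> ess_bdd \<mu> (\<lambda>x. f x * g x)"
proof -
  assume fg: "ess_bdd \<mu> f" "ess_bdd \<mu> g"
  obtain C D where "AE x in \<mu>. \<bar>f x\<bar> \<le> C" "AE x in \<mu>. \<bar>g x\<bar> \<le> D" using fg by (auto simp: ess_bdd_def)
  then have "AE x in \<mu>. \<bar>f x * g x\<bar> \<le> C * D"
    by eventually_elim (auto simp: abs_mult intro!: mult_mono)
  then show ?thesis using fg by (auto simp: ess_bdd_def)
qed

lemma Linf_space_ess_bddE: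
  assumes "F \<in> Linf_space \<mu>"
  obtains f where "F = ae_class \<mu> f" "ess_bdd \<mu> f"
  using assms by (auto simp: Linf_space_def ess_bdd_def)

definition pnorm_rep :: "('x, 'm) normed_module \<Rightarrow> 'm \<Rightarrow> 'x \<Rightarrow> real" where
  "pnorm_rep M v = ae_rep (pnorm M v)"

definition act :: "'x measure \<Rightarrow> ('x, 'm) normed_module \<Rightarrow> ('x \<Rightarrow> real) \<Rightarrow> 'm \<Rightarrow> 'm" where
  "act \<mu> M f v = ae_class \<mu> f \<odot>\<^bsub>M\<^esub> v"

context Lp_normed_module
begin

lemma pnorm_rep_meas: "v \<in> carrier M \<Longrightarrow> pnorm_rep M v \<in> borel_measurable \<mu>"
  using Lp_rep(1)[OF pnorm_closed] by (simp add: pnorm_rep_def)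

lemma pnorm_class: "v \<in> carrier M \<Longrightarrow> ae_class \<mu> (pnorm_rep M v) = pnorm M v"
  using Lp_rep(2)[OF pnorm_closed] by (simp add: pnorm_rep_def)

lemma pnorm_rep_nonneg: "v \<in> carrier M \<Longrightarrow> AE x in \<mu>. 0 \<le> pnorm_rep M v x"
  using pnorm_nonneg[of v] ae_rep_class(2)[of "\<lambda>_. 0" \<mu>]
  by (auto simp: pnorm_rep_def ae_le_def)

lemma pnorm_rep_integrable: "v \<in> carrier M \<Longrightarrow> integrable \<mu> (\<lambda>x. \<bar>pnorm_rep M v x\<bar> powr p)"
  using Lp_rep(3)[OF pnorm_closed] by (simp add: pnorm_rep_def)

lemma mnorm_eq: "v \<in> carrier M \<Longrightarrow> mnorm M v = (\<integral>x. \<bar>pnorm_rep M v x\<bar> powr p \<partial>\<mu>) powr (1 / p)"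
  by (simp add: norm_eq Lp_norm_def pnorm_rep_def)

lemma act_closed: "ess_bdd \<mu> f \<Longrightarrow> v \<in> carrier M \<Longrightarrow> act \<mu> M f v \<in> carrier M"
  unfolding act_def by (rule smult_closed) (auto simp: Linf_ring_def ess_bdd_Linf)

lemma act_add: "ess_bdd \<mu> f \<Longrightarrow> v \<in> carrier M \<Longrightarrow> w \<in> carrier M \<Longrightarrow>
    act \<mu> M f (v \<oplus> w) = act \<mu> M f v \<oplus> act \<mu> M f w"
  unfolding act_def by (rule smult_r_distr) (auto simp: Linf_ring_def ess_bdd_Linf)

lemma act_plus: "ess_bdd \<mu> f \<Longrightarrow> ess_bdd \<mu> g \<Longrightarrow> v \<in> carrier M \<Longrightarrow>
    act \<mu> M (\<lambda>x. f x + g x) v = act \<mu> M f v \<oplus> act \<mu> M g v"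
  unfolding act_def using smult_l_distr[of "ae_class \<mu> f" "ae_class \<mu> g" v]
  by (auto simp: Linf_ring_def ess_bdd_Linf ae_add_class ess_bdd_meas)

lemma act_act: "ess_bdd \<mu> f \<Longrightarrow> ess_bdd \<mu> g \<Longrightarrow> v \<in> carrier M \<Longrightarrow>
    act \<mu> M f (act \<mu> M g v) = act \<mu> M (\<lambda>x. f x * g x) v"
  unfolding act_def using smult_assoc1[of "ae_class \<mu> f" "ae_class \<mu> g" v]
  by (auto simp: Linf_ring_def ess_bdd_Linf ae_mult_class ess_bdd_meas)

lemma act_one: "v \<in> carrier M \<Longrightarrow> act \<mu> M (\<lambda>_. 1) v = v"
  unfolding act_def using smult_one by (auto simp: Linf_ring_def)

lemma act_zero: "v \<in> carrier M \<Longrightarrow> act \<mu> M (\<lambda>_. 0) v = \<zero>"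
  unfolding act_def using smult_l_null by (auto simp: Linf_ring_def)

lemma minus_act: "v \<in> carrier M \<Longrightarrow> \<ominus> v = act \<mu> M (\<lambda>_. -1) v"
proof (rule minus_equality)
  assume v: "v \<in> carrier M"
  show "act \<mu> M (\<lambda>_. -1) v \<oplus> v = \<zero>"
    using act_plus[of "\<lambda>_. -1" "\<lambda>_. 1" v] v by (simp add: ess_bdd_const act_one act_zero)
qed (auto simp: act_closed ess_bdd_const)

lemma pnorm_rep_act:
  assumes f: "ess_bdd \<mu> f" and v: "v \<in> carrier M"
  shows "AE x in \<mu>. pnorm_rep M (act \<mu> M f v) x = \<bar>f x\<bar> * pnorm_rep M v x"
proof -
  have [measurable]: "f \<in> borel_measurable \<mu>" "pnorm_rep M v \<in> borel_measurable \<mu>"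
    using f v by (auto simp: ess_bdd_meas pnorm_rep_meas)
  have "pnorm M (act \<mu> M f v) = ae_mult \<mu> (ae_abs \<mu> (ae_class \<mu> f)) (pnorm M v)"
    unfolding act_def by (rule pnorm_smult) (use f v in \<open>auto simp: ess_bdd_Linf\<close>)
  also have "ae_abs \<mu> (ae_class \<mu> f) = ae_class \<mu> (\<lambda>x. \<bar>f x\<bar>)"
    unfolding ae_abs_def by (rule ae_class_eqI) (use ae_rep_class[of f \<mu>] in auto)
  also have "ae_mult \<mu> \<dots> (pnorm M v) = ae_class \<mu> (\<lambda>x. \<bar>f x\<bar> * pnorm_rep M v x)"
    using v by (simp add: pnorm_class[symmetric] ae_mult_class)
  finally show ?thesis
    unfolding pnorm_rep_def[of M "act \<mu> M f v"] using ae_rep_class(2)[of "\<lambda>x. \<bar>f x\<bar> * pnorm_rep M v x" \<mu>] by simp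
qed

lemma pnorm_rep_minus: "v \<in> carrier M \<Longrightarrow> AE x in \<mu>. pnorm_rep M (\<ominus> v) x = pnorm_rep M v x"
  using pnorm_rep_act[OF ess_bdd_const, of v "-1"] by (simp add: minus_act)

lemma pnorm_rep_zero: "AE x in \<mu>. pnorm_rep M \<zero> x = 0"
  using pnorm_rep_act[OF ess_bdd_const, of \<zero> 0] by (simp add: act_zero)

lemma mnorm_nonneg: "v \<in> carrier M \<Longrightarrow> 0 \<le> mnorm M v"
  by (simp add: mnorm_eq)

lemma mnorm_minus: "v \<in> carrier M \<Longrightarrow> mnorm M (\<ominus> v) = mnorm M v"
  using norm_scale[of v "-1"] by (simp add: minus_act act_def)

lemma eq_zero_if_pn:
  assumes "v \<in> carrier M" "AE x in \<mu>. pnorm_rep M v x = 0"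
  shows "v = \<zero>"
proof -
  have "(\<integral>x. \<bar>pnorm_rep M v x\<bar> powr p \<partial>\<mu>) = (\<integral>x. 0 \<partial>\<mu>)"
    by (rule integral_cong_AE) (use assms pnorm_rep_meas in auto)
  then have "mnorm M v = 0" using assms(1) by (simp add: mnorm_eq)
  then show ?thesis using norm_eq_0_iff assms by simp
qed

lemma diff_closed: "v \<in> carrier M \<Longrightarrow> w \<in> carrier M \<Longrightarrow> v \<ominus> w \<in> carrier M"
  by simp

lemma mnorm_diff_commute:
  assumes "v \<in> carrier M" "w \<in> carrier M"
  shows "mnorm M (v \<ominus> w) = mnorm M (w \<ominus> v)"
proof -
  have "\<ominus> (v \<ominus> w) = w \<ominus> v"
    using assms by (simp add: a_minus_def minus_add a_comm)
  then show ?thesis using mnorm_minus[of "v \<ominus> w"] assms by simp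
qed

lemma diff_eq_zero: "v \<in> carrier M \<Longrightarrow> w \<in> carrier M \<Longrightarrow> v \<ominus> w = \<zero> \<longleftrightarrow> v = w"
  by (metis a_minus_def minus_equality minus_minus r_neg a_inv_closed)

lemma diff_trans: "u \<in> carrier M \<Longrightarrow> v \<in> carrier M \<Longrightarrow> w \<in> carrier M \<Longrightarrow>
    (u \<ominus> v) \<oplus> (v \<ominus> w) = u \<ominus> w"
  by (simp add: a_minus_def a_assoc r_neg1)

lemma Metric_space_module: "Metric_space (carrier M) (mdist M)"
proof
  show "0 \<le> mdist M v w" for v w by (simp add: mdist_def mnorm_nonneg)
  show "mdist M v w = mdist M w v" for v w by (simp add: mdist_def mnorm_diff_commute)
  show "mdist M v w = 0 \<longleftrightarrow> v = w" if "v \<in> carrier M" "w \<in> carrier M" for v w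
    using that by (simp add: mdist_def norm_eq_0_iff diff_eq_zero)
  show "mdist M u w \<le> mdist M u v + mdist M v w"
    if "u \<in> carrier M" "v \<in> carrier M" "w \<in> carrier M" for u v w
    using that norm_triangle[of "u \<ominus> v" "v \<ominus> w"] by (simp add: mdist_def diff_trans)
qed

end

locale Lp_normed_module_pos = Lp_normed_module +
  assumes p_pos: "0 < p"
begin

lemma mnorm_le_mono:
  assumes v: "v \<in> carrier M" and f: "integrable \<mu> (\<lambda>x. \<bar>f x\<bar> powr p)"
    and le: "AE x in \<mu>. pnorm_rep M v x \<le> f x"
  shows "mnorm M v \<le> (\<integral>x. \<bar>f x\<bar> powr p \<partial>\<mu>) powr (1 / p)"
proof -
  have "(\<integral>x. \<bar>pnorm_rep M v x\<bar> powr p \<partial>\<mu>) \<le> (\<integral>x. \<bar>f x\<bar> powr p \<partial>\<mu>)"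
  proof (rule integral_mono_AE[OF pnorm_rep_integrable[OF v] f])
    show "AE x in \<mu>. \<bar>pnorm_rep M v x\<bar> powr p \<le> \<bar>f x\<bar> powr p"
      using le pnorm_rep_nonneg[OF v] by eventually_elim (use p_pos in \<open>auto intro!: powr_mono2\<close>)
  qed
  then show ?thesis unfolding mnorm_eq[OF v] using p_pos by (intro powr_mono2) auto
qed

lemma mnorm_indicator:
  assumes v: "v \<in> carrier M" and S: "S \<in> sets \<mu>"
  shows "mnorm M (act \<mu> M (indicator S) v) = (\<integral>x. indicator S x * \<bar>pnorm_rep M v x\<bar> powr p \<partial>\<mu>) powr (1 / p)"
proof -
  have c: "act \<mu> M (indicator S) v \<in> carrier M" by (simp add: act_closed ess_bdd_indicator S v)
  have "(\<integral>x. \<bar>pnorm_rep M (act \<mu> M (indicator S) v) x\<bar> powr p \<partial>\<mu>)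
      = (\<integral>x. indicator S x * \<bar>pnorm_rep M v x\<bar> powr p \<partial>\<mu>)"
  proof (rule integral_cong_AE)
    show "AE x in \<mu>. \<bar>pnorm_rep M (act \<mu> M (indicator S) v) x\<bar> powr p = indicator S x * \<bar>pnorm_rep M v x\<bar> powr p"
      using pnorm_rep_act[OF ess_bdd_indicator[OF S] v]
      by eventually_elim (auto simp: indicator_def)
  qed (use pnorm_rep_meas[OF c] pnorm_rep_meas[OF v] S in auto)
  then show ?thesis by (simp add: mnorm_eq[OF c])
qed

text \<open>The axioms contain the triangle inequality only for the norm. Applied to \<open>\<chi>\<^sub>S v\<close> and \<open>\<chi>\<^sub>S w\<close>, where
\<open>S = {|v| < a, |w| < b, |v + w| > c}\<close> with \<open>a + b < c\<close>, it shows that \<open>S\<close> is a null set. The set on which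
the pointwise inequality fails is the union of these sets over rational \<open>a\<close>, \<open>b\<close>, \<open>c\<close>.\<close>

lemma pnorm_rep_triangle:
  assumes v: "v \<in> carrier M" and w: "w \<in> carrier M"
  shows "AE x in \<mu>. pnorm_rep M (v \<oplus> w) x \<le> pnorm_rep M v x + pnorm_rep M w x"
proof -
  note [measurable] = pnorm_rep_meas[OF v] pnorm_rep_meas[OF w] pnorm_rep_meas[OF a_closed[OF v w]]
  have vw: "v \<oplus> w \<in> carrier M" using v w by simp
  have null: "AE x in \<mu>. \<not> (pnorm_rep M v x < a \<and> pnorm_rep M w x < b \<and> c < pnorm_rep M (v \<oplus> w) x)"
    if abc: "a + b < c" for a b c
  proof (cases "0 < a \<and> 0 < b")
    case False
    then show ?thesis using pnorm_rep_nonneg[OF v] pnorm_rep_nonneg[OF w] by auto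
  next
    case True
    define S where "S = {x \<in> space \<mu>. pnorm_rep M v x < a \<and> pnorm_rep M w x < b \<and> c < pnorm_rep M (v \<oplus> w) x}"
    have S[measurable]: "S \<in> sets \<mu>" unfolding S_def by measurable
    have cp: "0 < c" using True abc by auto
    have fin: "emeasure \<mu> S < \<infinity>"
    proof -
      have "(\<integral>\<^sup>+x. ennreal (c powr p) * indicator S x \<partial>\<mu>) \<le> (\<integral>\<^sup>+x. ennreal (\<bar>pnorm_rep M (v \<oplus> w) x\<bar> powr p) \<partial>\<mu>)"
        by (rule nn_integral_mono)
          (use cp p_pos in \<open>auto simp: S_def indicator_def intro!: powr_mono2\<close>)
      also have "\<dots> < \<infinity>"
        using pnorm_rep_integrable[OF vw] by (simp add: integrable_iff_bounded)
      finally have "ennreal (c powr p) * emeasure \<mu> S < \<infinity>" by (simp add: nn_integral_cmult_indicator)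
      then show ?thesis using cp by (auto simp: ennreal_mult_less_top ennreal_zero_less_mult_iff less_top[symmetric])
    qed
    have intS: "integrable \<mu> (\<lambda>x. indicator S x * r)" for r :: real
      using fin by (intro integrable_mult_left integrable_real_indicator) auto
    define m where "m = measure \<mu> S powr (1 / p)"
    have upper: "mnorm M (act \<mu> M (indicator S) u) \<le> r * m"
      if u: "u \<in> carrier M" and r: "0 \<le> r" and le: "\<And>x. x \<in> S \<Longrightarrow> pnorm_rep M u x \<le> r" for u r
    proof -
      have "(\<integral>x. indicator S x * \<bar>pnorm_rep M u x\<bar> powr p \<partial>\<mu>) \<le> (\<integral>x. indicator S x * r powr p \<partial>\<mu>)"
      proof (rule integral_mono_AE[OF _ intS])
        show "integrable \<mu> (\<lambda>x. indicator S x * \<bar>pnorm_rep M u x\<bar> powr p)"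
          by (rule integrable_real_mult_indicator[OF S pnorm_rep_integrable[OF u], simplified mult.commute])
        show "AE x in \<mu>. indicator S x * \<bar>pnorm_rep M u x\<bar> powr p \<le> indicator S x * r powr p"
          using pnorm_rep_nonneg[OF u]
          by eventually_elim (use p_pos le in \<open>auto simp: indicator_def intro!: powr_mono2\<close>)
      qed
      also have "\<dots> = measure \<mu> S * r powr p" using fin by simp
      finally have "mnorm M (act \<mu> M (indicator S) u) \<le> (measure \<mu> S * r powr p) powr (1 / p)"
        unfolding mnorm_indicator[OF u S] by (intro powr_mono2) (use p_pos in auto)
      also have "\<dots> = r * m" using p_pos r by (simp add: powr_mult powr_powr m_def)
      finally show ?thesis .
    qed
    have "c * m = (\<integral>x. indicator S x * c powr p \<partial>\<mu>) powr (1 / p)"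
      using p_pos cp fin by (simp add: powr_mult powr_powr m_def)
    also have "\<dots> \<le> mnorm M (act \<mu> M (indicator S) (v \<oplus> w))"
      unfolding mnorm_indicator[OF vw S]
    proof (intro powr_mono2 integral_mono[OF intS])
      show "integrable \<mu> (\<lambda>x. indicator S x * \<bar>pnorm_rep M (v \<oplus> w) x\<bar> powr p)"
        by (rule integrable_real_mult_indicator[OF S pnorm_rep_integrable[OF vw], simplified mult.commute])
      show "indicator S x * c powr p \<le> indicator S x * \<bar>pnorm_rep M (v \<oplus> w) x\<bar> powr p" for x
        using p_pos cp by (auto simp: indicator_def S_def intro!: powr_mono2)
    qed (use p_pos in auto)
    also have "\<dots> \<le> mnorm M (act \<mu> M (indicator S) v) + mnorm M (act \<mu> M (indicator S) w)"
      using norm_triangle[of "act \<mu> M (indicator S) v" "act \<mu> M (indicator S) w"] v w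
      by (simp add: act_add act_closed ess_bdd_indicator)
    also have "\<dots> \<le> a * m + b * m"
      by (intro add_mono upper v w) (use True in \<open>auto simp: S_def\<close>)
    finally have "(c - (a + b)) * m \<le> 0" by (simp add: algebra_simps)
    then have "m \<le> 0" using abc by (simp add: mult_le_0_iff)
    then have "measure \<mu> S = 0" by (auto simp: m_def)
    then have "emeasure \<mu> S = 0" using fin by (simp add: emeasure_eq_ennreal_measure)
    then have "AE x in \<mu>. x \<notin> S" using S by (simp add: AE_iff_null[symmetric] AE_not_in null_setsI)
    then show ?thesis by (rule AE_mp) (auto simp: S_def)
  qed
  have "AE x in \<mu>. \<forall>a\<in>\<rat>. \<forall>b\<in>\<rat>. \<forall>c\<in>\<rat>. a + b < c \<longrightarrow>
      \<not> (pnorm_rep M v x < a \<and> pnorm_rep M w x < b \<and> c < pnorm_rep M (v \<oplus> w) x)"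
    using null by (auto simp: AE_ball_countable countable_rat)
  then show ?thesis
  proof eventually_elim
    case (elim x)
    show ?case
    proof (rule ccontr)
      assume "\<not> ?case"
      define e where "e = (pnorm_rep M (v \<oplus> w) x - pnorm_rep M v x - pnorm_rep M w x) / 3"
      have e: "0 < e" using \<open>\<not> ?case\<close> by (simp add: e_def)
      obtain a where a: "a \<in> \<rat>" "pnorm_rep M v x < a" "a < pnorm_rep M v x + e" using Rats_dense_in_real[of "pnorm_rep M v x" "pnorm_rep M v x + e"] e by auto
      obtain b where b: "b \<in> \<rat>" "pnorm_rep M w x < b" "b < pnorm_rep M w x + e" using Rats_dense_in_real[of "pnorm_rep M w x" "pnorm_rep M w x + e"] e by auto
      have "pnorm_rep M v x + e + (pnorm_rep M w x + e) < pnorm_rep M (v \<oplus> w) x" using e by (simp add: e_def field_simps)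
      then have "a + b < pnorm_rep M (v \<oplus> w) x" using a b by linarith
      then obtain c where "c \<in> \<rat>" "a + b < c" "c < pnorm_rep M (v \<oplus> w) x" using Rats_dense_in_real by blast
      then show False using elim a b by blast
    qed
  qed
qed

end

section \<open>Elements of the dual as bounded functionals\<close>

context Lp_normed_module_pos
begin

context
  fixes L assumes L: "L \<in> dual_carrier \<mu> M"
begin

lemma dual_L1: "v \<in> carrier M \<Longrightarrow> L v \<in> Lp_space \<mu> 1"
  using L by (auto simp: dual_carrier_def Linf_linear_def L1_def)

lemmas dual_rep = L1_rep[OF dual_L1]

lemma dual_add:
  assumes "v \<in> carrier M" "w \<in> carrier M"
  shows "AE x in \<mu>. ae_rep (L (v \<oplus> w)) x = ae_rep (L v) x + ae_rep (L w) x"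
proof -
  have "L (v \<oplus> w) = ae_add \<mu> (L v) (L w)"
    using L assms by (auto simp: dual_carrier_def Linf_linear_def L1_def)
  then show ?thesis
    using ae_rep_class(2)[of "\<lambda>x. ae_rep (L v) x + ae_rep (L w) x" \<mu>] dual_rep assms
    by (simp add: ae_add_def)
qed

lemma dual_act:
  assumes f: "ess_bdd \<mu> f" and v: "v \<in> carrier M"
  shows "AE x in \<mu>. ae_rep (L (act \<mu> M f v)) x = f x * ae_rep (L v) x"
proof -
  have "L (act \<mu> M f v) = ae_mult \<mu> (ae_class \<mu> f) (L v)"
    using L assms ess_bdd_Linf[OF f] by (auto simp: dual_carrier_def Linf_linear_def L1_def act_def)
  also have "\<dots> = ae_class \<mu> (\<lambda>x. f x * ae_rep (L v) x)"
    using ae_mult_class[OF ess_bdd_meas[OF f] dual_rep(1)[OF v]] dual_rep(2)[OF v] by simp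
  finally show ?thesis
    using ae_rep_class(2)[of "\<lambda>x. f x * ae_rep (L v) x" \<mu>] dual_rep(1)[OF v] ess_bdd_meas[OF f] by simp
qed

lemma dual_zero: "AE x in \<mu>. ae_rep (L \<zero>) x = 0"
  using dual_act[OF ess_bdd_const, of \<zero> 0] by (simp add: act_zero)

lemma dual_diff:
  assumes "v \<in> carrier M" "w \<in> carrier M"
  shows "AE x in \<mu>. ae_rep (L (v \<ominus> w)) x = ae_rep (L v) x - ae_rep (L w) x"
  using dual_add[of v "\<ominus> w"] dual_act[OF ess_bdd_const, of w "-1"] assms
  by (auto simp: a_minus_def minus_act act_closed ess_bdd_const)

text \<open>Elements of the dual are required to be continuous; as they are homogeneous over the constants,
continuity at \<open>0\<close> gives a bound.\<close>

lemma dual_bounded: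
  obtains C where "0 \<le> C" "\<And>v. v \<in> carrier M \<Longrightarrow> (\<integral>x. \<bar>ae_rep (L v) x\<bar> \<partial>\<mu>) \<le> C * mnorm M v"
proof -
  interpret MS: Metric_space "carrier M" "mdist M" by (rule Metric_space_module)
  have car: "carrier (L1 \<mu>) = Lp_space \<mu> 1" by (simp add: L1_def)
  have "continuous_map (mtop M) (mtop (L1 \<mu>)) L" using L by (simp add: dual_carrier_def)
  then have "\<forall>a\<in>carrier M. \<forall>\<epsilon>>0. \<exists>\<delta>>0. \<forall>x. x \<in> carrier M \<and> mdist M a x < \<delta> \<longrightarrow>
      mdist (L1 \<mu>) (L a) (L x) < \<epsilon>"
    using MS.metric_continuous_map[OF Metric_space_L1, of \<mu> L] by (simp add: mtop_def car)
  then obtain \<delta> where \<delta>: "0 < \<delta>"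
    "\<And>x. x \<in> carrier M \<Longrightarrow> mdist M \<zero> x < \<delta> \<Longrightarrow> mdist (L1 \<mu>) (L \<zero>) (L x) < 1"
    by (metis zero_closed zero_less_one)
  have small: "(\<integral>y. \<bar>ae_rep (L x) y\<bar> \<partial>\<mu>) < 1" if x: "x \<in> carrier M" "mnorm M x < \<delta>" for x
  proof -
    have "mdist M \<zero> x = mnorm M x"
      using x mnorm_minus[of x] by (simp add: mdist_def a_minus_def)
    then have "mdist (L1 \<mu>) (L \<zero>) (L x) < 1" using \<delta> x by simp
    moreover have "mdist (L1 \<mu>) (L \<zero>) (L x) = (\<integral>y. \<bar>ae_rep (L \<zero>) y - ae_rep (L x) y\<bar> \<partial>\<mu>)"
      using x by (simp add: mdist_L1 dual_L1)
    moreover have "\<dots> = (\<integral>y. \<bar>ae_rep (L x) y\<bar> \<partial>\<mu>)"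
      by (rule integral_cong_AE) (use dual_zero dual_rep(1)[OF x(1)] dual_rep(1)[OF zero_closed] in auto)
    ultimately show ?thesis by simp
  qed
  show thesis
  proof (rule that[of "2 / \<delta>"])
    fix v assume v: "v \<in> carrier M"
    show "(\<integral>x. \<bar>ae_rep (L v) x\<bar> \<partial>\<mu>) \<le> 2 / \<delta> * mnorm M v"
    proof (cases "mnorm M v = 0")
      case True
      then have "v = \<zero>" using norm_eq_0_iff v by simp
      then have "(\<integral>x. \<bar>ae_rep (L v) x\<bar> \<partial>\<mu>) = (\<integral>x. 0 \<partial>\<mu>)"
        using dual_zero dual_rep(1)[OF zero_closed] by (intro integral_cong_AE) auto
      then show ?thesis using True by simp
    next
      case False
      then have n: "0 < mnorm M v" using mnorm_nonneg[OF v] by linarith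
      define t where "t = \<delta> / (2 * mnorm M v)"
      have t: "0 < t" using n \<delta> by (simp add: t_def)
      have "mnorm M (act \<mu> M (\<lambda>_. t) v) = \<delta> / 2"
        using norm_scale[OF v, of t] t n \<delta>(1) by (simp add: act_def t_def)
      then have "(\<integral>y. \<bar>ae_rep (L (act \<mu> M (\<lambda>_. t) v)) y\<bar> \<partial>\<mu>) < 1"
        using \<delta> v by (intro small) (auto simp: act_closed ess_bdd_const)
      also have "(\<integral>y. \<bar>ae_rep (L (act \<mu> M (\<lambda>_. t) v)) y\<bar> \<partial>\<mu>) = (\<integral>y. t * \<bar>ae_rep (L v) y\<bar> \<partial>\<mu>)"
        by (rule integral_cong_AE)
          (use dual_act[OF ess_bdd_const v, of t] dual_rep(1) v t in
            \<open>auto simp: act_closed ess_bdd_const abs_mult\<close>)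
      finally show ?thesis using t n \<delta> by (simp add: t_def field_simps)
    qed
  qed (use \<delta> in auto)
qed

end

lemma dual_carrierI:
  assumes int: "\<And>v. v \<in> carrier M \<Longrightarrow> integrable \<mu> (k v)"
    and add: "\<And>v w. v \<in> carrier M \<Longrightarrow> w \<in> carrier M \<Longrightarrow> AE x in \<mu>. k (v \<oplus> w) x = k v x + k w x"
    and act: "\<And>f v. ess_bdd \<mu> f \<Longrightarrow> v \<in> carrier M \<Longrightarrow> AE x in \<mu>. k (act \<mu> M f v) x = f x * k v x"
    and C: "0 \<le> C" "\<And>v. v \<in> carrier M \<Longrightarrow> (\<integral>x. \<bar>k v x\<bar> \<partial>\<mu>) \<le> C * mnorm M v"
  shows "(\<lambda>v\<in>carrier M. ae_class \<mu> (k v)) \<in> dual_carrier \<mu> M"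
proof -
  define L where "L = (\<lambda>v\<in>carrier M. ae_class \<mu> (k v))"
  have L: "L v = ae_class \<mu> (k v)" if "v \<in> carrier M" for v using that by (simp add: L_def)
  have car: "carrier (L1 \<mu>) = Lp_space \<mu> 1" by (simp add: L1_def)
  have km: "k v \<in> borel_measurable \<mu>" if "v \<in> carrier M" for v using int[OF that] by auto
  have cl: "L v \<in> Lp_space \<mu> 1" if "v \<in> carrier M" for v
    using that int[OF that] by (simp add: L L1_space_iff)
  have lin: "Linf_linear \<mu> M (L1 \<mu>) L"
    unfolding Linf_linear_def
  proof (intro conjI ballI)
    show "L \<in> carrier M \<rightarrow> carrier (L1 \<mu>)" using cl by (auto simp: car)
    fix v w assume v: "v \<in> carrier M" and w: "w \<in> carrier M"
    show "L (v \<oplus> w) = L v \<oplus>\<^bsub>L1 \<mu>\<^esub> L w"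
      using add[OF v w] v w by (simp add: L1_def L ae_add_class km) (rule ae_class_eqI)
  next
    fix F v assume F: "F \<in> Linf_space \<mu>" and v: "v \<in> carrier M"
    obtain f where f: "F = ae_class \<mu> f" "ess_bdd \<mu> f" using F by (rule Linf_space_ess_bddE)
    show "L (F \<odot> v) = F \<odot>\<^bsub>L1 \<mu>\<^esub> L v"
      using act[OF f(2) v] act_closed[OF f(2) v] v f
      by (simp add: L1_def L ae_mult_class km ess_bdd_meas act_def) (rule ae_class_eqI)
  qed
  interpret MS: Metric_space "carrier M" "mdist M" by (rule Metric_space_module)
  have dist: "mdist (L1 \<mu>) (L a) (L x) \<le> C * mdist M a x" if a: "a \<in> carrier M" and x: "x \<in> carrier M" for a x
  proof -
    have "mdist (L1 \<mu>) (L a) (L x) = (\<integral>y. \<bar>k a y - k x y\<bar> \<partial>\<mu>)"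
      using mnorm_L1_minus[OF int[OF a] int[OF x]] cl[OF a] cl[OF x] by (simp add: mdist_def L a x car)
    also have "\<dots> = (\<integral>y. \<bar>k (a \<ominus> x) y\<bar> \<partial>\<mu>)"
    proof (rule integral_cong_AE)
      show "AE y in \<mu>. \<bar>k a y - k x y\<bar> = \<bar>k (a \<ominus> x) y\<bar>"
        using add[of a "\<ominus> x"] act[OF ess_bdd_const x, of "-1"] a x
        by (auto simp: a_minus_def minus_act act_closed ess_bdd_const)
    qed (use km a x in auto)
    also have "\<dots> \<le> C * mdist M a x" using C(2)[of "a \<ominus> x"] a x by (simp add: mdist_def)
    finally show ?thesis .
  qed
  have "continuous_map (mtop M) (mtop (L1 \<mu>)) L"
    unfolding mtop_def car MS.metric_continuous_map[OF Metric_space_L1]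
  proof (intro conjI ballI allI impI)
    show "L ` carrier M \<subseteq> Lp_space \<mu> 1" using cl by auto
    fix a \<epsilon> assume a: "a \<in> carrier M" and e: "0 < (\<epsilon>::real)"
    show "\<exists>\<delta>>0. \<forall>x. x \<in> carrier M \<and> mdist M a x < \<delta> \<longrightarrow> mdist (L1 \<mu>) (L a) (L x) < \<epsilon>"
    proof (intro exI[of _ "\<epsilon> / (C + 1)"] conjI allI impI)
      show "0 < \<epsilon> / (C + 1)" using e C by simp
      fix x assume x: "x \<in> carrier M \<and> mdist M a x < \<epsilon> / (C + 1)"
      have "mdist (L1 \<mu>) (L a) (L x) \<le> C * mdist M a x" using dist a x by auto
      also have "\<dots> \<le> (C + 1) * mdist M a x" by (intro mult_right_mono) (auto simp: MS.nonneg)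
      also have "\<dots> < \<epsilon>" using x C by (simp add: field_simps)
      finally show "mdist (L1 \<mu>) (L a) (L x) < \<epsilon>" .
    qed
  qed
  then show ?thesis using lin unfolding dual_carrier_def L_def[symmetric] by (auto simp: L_def)
qed

end

section \<open>Pullbacks and the pairing\<close>

locale dual_of_pullback =
  X: sigma_finite_measure \<mu>X + Y: sigma_finite_measure \<mu>Y +
  M: Lp_normed_module_pos \<mu>X p M + PM: Lp_normed_module_pos \<mu>Y p PM +
  PD: Lp_normed_module \<mu>Y q PD
  for \<mu>X :: "'x measure" and \<mu>Y :: "'y measure" and p q :: real
    and M :: "('x, 'm) normed_module" and PM :: "('y, 'n) normed_module"
    and PD :: "('y, 'k) normed_module" +
  fixes \<phi> :: "'y \<Rightarrow> 'x" and pbM :: "'m \<Rightarrow> 'n" and pbD :: "('m \<Rightarrow> 'x fclass) \<Rightarrow> 'k"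
    and I :: "'k \<Rightarrow> 'n \<Rightarrow> 'y fclass"
  assumes phi[measurable]: "\<phi> \<in> \<mu>Y \<rightarrow>\<^sub>M \<mu>X" and ac: "absolutely_continuous \<mu>X (distr \<mu>Y \<mu>X \<phi>)"
    and p: "1 < p"
    and pbM: "is_pullback \<mu>X \<mu>Y \<phi> p M PM pbM"
    and pbD: "is_pullback \<mu>X \<mu>Y \<phi> q (dual \<mu>X M) PD pbD"
    and I_linear: "Linf_linear \<mu>Y PD (dual \<mu>Y PM) I"
    and I_pb: "\<And>\<omega> v. \<omega> \<in> carrier (dual \<mu>X M) \<Longrightarrow> v \<in> carrier M \<Longrightarrow>
      I (pbD \<omega>) (pbM v) = ae_comp \<mu>Y (\<omega> v) \<phi>"
begin

lemma AE_comp: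
  assumes "AE x in \<mu>X. P x"
  shows "AE y in \<mu>Y. P (\<phi> y)"
proof -
  have "AE x in distr \<mu>Y \<mu>X \<phi>. P x"
    by (rule absolutely_continuous_AE[OF _ ac assms]) simp
  then show ?thesis by (rule AE_distrD[OF phi])
qed

lemma pbM_closed: "v \<in> carrier M \<Longrightarrow> pbM v \<in> carrier PM"
  using pbM by (auto simp: is_pullback_def)

lemma pbM_add: "v \<in> carrier M \<Longrightarrow> w \<in> carrier M \<Longrightarrow> pbM (v \<oplus>\<^bsub>M\<^esub> w) = pbM v \<oplus>\<^bsub>PM\<^esub> pbM w"
  using pbM by (auto simp: is_pullback_def)

lemma pbM_const: "v \<in> carrier M \<Longrightarrow> pbM (act \<mu>X M (\<lambda>_. c) v) = act \<mu>Y PM (\<lambda>_. c) (pbM v)"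
  using pbM by (auto simp: is_pullback_def act_def)

lemma pnorm_rep_pbM:
  assumes v: "v \<in> carrier M"
  shows "AE y in \<mu>Y. pnorm_rep PM (pbM v) y = pnorm_rep M v (\<phi> y)"
proof -
  have "pnorm PM (pbM v) = ae_class \<mu>Y (\<lambda>y. pnorm_rep M v (\<phi> y))"
    using pbM v by (auto simp: is_pullback_def ae_comp_def pnorm_rep_def)
  moreover have "(\<lambda>y. pnorm_rep M v (\<phi> y)) \<in> borel_measurable \<mu>Y"
    using M.pnorm_rep_meas[OF v] by measurable
  ultimately show ?thesis by (simp add: pnorm_rep_def ae_rep_class(2))
qed

lemma ess_bdd_comp:
  assumes "ess_bdd \<mu>X f"
  shows "ess_bdd \<mu>Y (\<lambda>y. f (\<phi> y))"
proof -
  obtain C where "AE x in \<mu>X. \<bar>f x\<bar> \<le> C" and [measurable]: "f \<in> borel_measurable \<mu>X"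
    using assms by (auto simp: ess_bdd_def)
  then show ?thesis using AE_comp[of "\<lambda>x. \<bar>f x\<bar> \<le> C"] by (auto simp: ess_bdd_def)
qed

text \<open>By definition the pullback map only commutes with constants. For a constant \<open>c\<close> close to \<open>f (\<phi> y)\<close>
both sides are close to \<open>c \<phi>\<^sup>* v\<close>: the pointwise norm of their difference is at most
\<open>2 |f \<circ> \<phi> - c| |v| \<circ> \<phi>\<close>. Letting \<open>c\<close> run through the rationals shows that it vanishes almost everywhere.\<close>

lemma pbM_act:
  assumes f: "ess_bdd \<mu>X f" and v: "v \<in> carrier M"
  shows "pbM (act \<mu>X M f v) = act \<mu>Y PM (\<lambda>y. f (\<phi> y)) (pbM v)"
proof -
  define a where "a = pbM (act \<mu>X M f v)"
  define b where "b = act \<mu>Y PM (\<lambda>y. f (\<phi> y)) (pbM v)"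
  have a: "a \<in> carrier PM" unfolding a_def by (simp add: pbM_closed M.act_closed f v)
  have b: "b \<in> carrier PM" unfolding b_def by (simp add: PM.act_closed ess_bdd_comp f pbM_closed v)
  have bound: "AE y in \<mu>Y. pnorm_rep PM (a \<ominus>\<^bsub>PM\<^esub> b) y \<le> 2 * \<bar>f (\<phi> y) - c\<bar> * pnorm_rep M v (\<phi> y)" for c
  proof -
    have fc: "ess_bdd \<mu>X (\<lambda>x. f x - c)" using ess_bdd_add[OF f ess_bdd_const[of _ "-c"]] by simp
    define a' where "a' = pbM (act \<mu>X M (\<lambda>x. f x - c) v)"
    define b' where "b' = act \<mu>Y PM (\<lambda>y. f (\<phi> y) - c) (pbM v)"
    define k where "k = act \<mu>Y PM (\<lambda>_. c) (pbM v)"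
    have a': "a' \<in> carrier PM" unfolding a'_def by (simp add: pbM_closed M.act_closed fc v)
    have b': "b' \<in> carrier PM" unfolding b'_def using ess_bdd_comp[OF fc] by (simp add: PM.act_closed pbM_closed v)
    have k: "k \<in> carrier PM" unfolding k_def by (simp add: PM.act_closed ess_bdd_const pbM_closed v)
    have "a = pbM (act \<mu>X M (\<lambda>x. f x - c) v \<oplus>\<^bsub>M\<^esub> act \<mu>X M (\<lambda>_. c) v)"
      using M.act_plus[OF fc ess_bdd_const[of _ c] v] by (simp add: a_def)
    also have "\<dots> = a' \<oplus>\<^bsub>PM\<^esub> k"
      by (simp add: pbM_add M.act_closed fc ess_bdd_const v pbM_const a'_def k_def)
    finally have ak: "a = a' \<oplus>\<^bsub>PM\<^esub> k" .
    have bk: "b = b' \<oplus>\<^bsub>PM\<^esub> k"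
      using PM.act_plus[OF ess_bdd_comp[OF fc] ess_bdd_const[of _ c] pbM_closed[OF v]]
      by (simp add: b_def b'_def k_def)
    have "a \<ominus>\<^bsub>PM\<^esub> b = a' \<oplus>\<^bsub>PM\<^esub> \<ominus>\<^bsub>PM\<^esub> b'"
      unfolding ak bk using a' b' k
      by (simp add: a_minus_def PM.minus_add PM.a_assoc PM.a_lcomm[of k] PM.r_neg)
    then have "AE y in \<mu>Y. pnorm_rep PM (a \<ominus>\<^bsub>PM\<^esub> b) y \<le> pnorm_rep PM a' y + pnorm_rep PM b' y"
      using PM.pnorm_rep_triangle[of a' "\<ominus>\<^bsub>PM\<^esub> b'"] PM.pnorm_rep_minus[OF b'] a' b' by auto
    moreover have "AE y in \<mu>Y. pnorm_rep PM a' y = \<bar>f (\<phi> y) - c\<bar> * pnorm_rep M v (\<phi> y)"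
      using pnorm_rep_pbM[OF M.act_closed[OF fc v]] AE_comp[OF M.pnorm_rep_act[OF fc v]] by (auto simp: a'_def)
    moreover have "AE y in \<mu>Y. pnorm_rep PM b' y = \<bar>f (\<phi> y) - c\<bar> * pnorm_rep M v (\<phi> y)"
      using PM.pnorm_rep_act[OF ess_bdd_comp[OF fc] pbM_closed[OF v]] pnorm_rep_pbM[OF v] by (auto simp: b'_def)
    ultimately show ?thesis by eventually_elim (simp add: mult_ac)
  qed
  have "AE y in \<mu>Y. \<forall>c\<in>\<rat>. pnorm_rep PM (a \<ominus>\<^bsub>PM\<^esub> b) y \<le> 2 * \<bar>f (\<phi> y) - c\<bar> * pnorm_rep M v (\<phi> y)"
    using bound by (auto simp: AE_ball_countable countable_rat)
  then have "AE y in \<mu>Y. pnorm_rep PM (a \<ominus>\<^bsub>PM\<^esub> b) y = 0"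
    using PM.pnorm_rep_nonneg[OF PM.diff_closed[OF a b]] AE_comp[OF M.pnorm_rep_nonneg[OF v]]
  proof eventually_elim
    case (elim y)
    show ?case
    proof (rule ccontr)
      assume "pnorm_rep PM (a \<ominus>\<^bsub>PM\<^esub> b) y \<noteq> 0"
      then have pos: "0 < pnorm_rep PM (a \<ominus>\<^bsub>PM\<^esub> b) y" using elim by simp
      define e where "e = pnorm_rep PM (a \<ominus>\<^bsub>PM\<^esub> b) y / (2 * (pnorm_rep M v (\<phi> y) + 1))"
      have e: "0 < e" using pos elim by (simp add: e_def)
      obtain c where c: "c \<in> \<rat>" "f (\<phi> y) - e < c" "c < f (\<phi> y)"
        using Rats_dense_in_real[of "f (\<phi> y) - e" "f (\<phi> y)"] e by auto
      have "pnorm_rep PM (a \<ominus>\<^bsub>PM\<^esub> b) y \<le> 2 * \<bar>f (\<phi> y) - c\<bar> * pnorm_rep M v (\<phi> y)" using elim c by blast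
      also have "\<dots> \<le> 2 * e * pnorm_rep M v (\<phi> y)" using c elim by (intro mult_right_mono) auto
      also have "\<dots> < 2 * e * (pnorm_rep M v (\<phi> y) + 1)" using e by simp
      also have "\<dots> = pnorm_rep PM (a \<ominus>\<^bsub>PM\<^esub> b) y" using elim by (simp add: e_def field_simps)
      finally show False by simp
    qed
  qed
  then have "a \<ominus>\<^bsub>PM\<^esub> b = \<zero>\<^bsub>PM\<^esub>" by (intro PM.eq_zero_if_pn PM.diff_closed a b)
  then show ?thesis using PM.diff_eq_zero[OF a b] by (simp add: a_def b_def)
qed

lemma I_closed: "\<Lambda> \<in> carrier PD \<Longrightarrow> I \<Lambda> \<in> dual_carrier \<mu>Y PM"
  using I_linear by (auto simp: Linf_linear_def dual_def)

lemma pbD_closed: "\<omega> \<in> dual_carrier \<mu>X M \<Longrightarrow> pbD \<omega> \<in> carrier PD"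
  using pbD by (auto simp: is_pullback_def dual_def)

lemma I_add:
  assumes "\<Lambda> \<in> carrier PD" "\<Lambda>' \<in> carrier PD" "V \<in> carrier PM"
  shows "AE y in \<mu>Y. ae_rep (I (\<Lambda> \<oplus>\<^bsub>PD\<^esub> \<Lambda>') V) y = ae_rep (I \<Lambda> V) y + ae_rep (I \<Lambda>' V) y"
proof -
  have "I (\<Lambda> \<oplus>\<^bsub>PD\<^esub> \<Lambda>') V = ae_class \<mu>Y (\<lambda>y. ae_rep (I \<Lambda> V) y + ae_rep (I \<Lambda>' V) y)"
    using I_linear assms by (auto simp: Linf_linear_def dual_def ae_add_def)
  then show ?thesis
    using PM.dual_rep(1)[OF I_closed assms(3)] assms(1,2) by (simp add: ae_rep_class(2))
qed

lemma I_act: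
  assumes f: "ess_bdd \<mu>Y f" and "\<Lambda> \<in> carrier PD" "V \<in> carrier PM"
  shows "AE y in \<mu>Y. ae_rep (I (act \<mu>Y PD f \<Lambda>) V) y = f y * ae_rep (I \<Lambda> V) y"
proof -
  have r: "ae_rep (I \<Lambda> V) \<in> borel_measurable \<mu>Y" "ae_class \<mu>Y (ae_rep (I \<Lambda> V)) = I \<Lambda> V"
    using PM.dual_rep[OF I_closed assms(3)] assms(2) by auto
  have "I (act \<mu>Y PD f \<Lambda>) V = ae_mult \<mu>Y (ae_class \<mu>Y f) (I \<Lambda> V)"
    using I_linear assms ess_bdd_Linf[OF f] by (auto simp: Linf_linear_def dual_def act_def)
  also have "\<dots> = ae_class \<mu>Y (\<lambda>y. f y * ae_rep (I \<Lambda> V) y)"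
    using ae_mult_class[OF ess_bdd_meas[OF f] r(1)] r(2) by simp
  finally show ?thesis
    using ae_rep_class(2)[of "\<lambda>y. f y * ae_rep (I \<Lambda> V) y" \<mu>Y] r(1) ess_bdd_meas[OF f] by simp
qed

lemma I_sum:
  fixes n :: nat
  assumes "\<And>i. i < n \<Longrightarrow> E i \<in> sets \<mu>Y" "\<And>i. i < n \<Longrightarrow> \<omega> i \<in> dual_carrier \<mu>X M"
  obtains \<Lambda> where "\<Lambda> \<in> carrier PD"
    "\<And>v. v \<in> carrier M \<Longrightarrow> AE y in \<mu>Y. ae_rep (I \<Lambda> (pbM v)) y =
      (\<Sum>i<n. indicator (E i) y * ae_rep (\<omega> i v) (\<phi> y))"
proof -
  have "\<exists>\<Lambda>\<in>carrier PD. \<forall>v\<in>carrier M. AE y in \<mu>Y. ae_rep (I \<Lambda> (pbM v)) y =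
      (\<Sum>i<n. indicator (E i) y * ae_rep (\<omega> i v) (\<phi> y))"
    using assms
  proof (induction n)
    case 0
    have "AE y in \<mu>Y. ae_rep (I \<zero>\<^bsub>PD\<^esub> (pbM v)) y = 0" if v: "v \<in> carrier M" for v
      using I_act[OF ess_bdd_const PD.zero_closed pbM_closed[OF v], of 0]
      by (simp add: PD.act_zero)
    then show ?case by (intro bexI[of _ "\<zero>\<^bsub>PD\<^esub>"]) auto
  next
    case (Suc n)
    then obtain \<Lambda> where \<Lambda>: "\<Lambda> \<in> carrier PD" "\<And>v. v \<in> carrier M \<Longrightarrow> AE y in \<mu>Y. ae_rep (I \<Lambda> (pbM v)) y =
      (\<Sum>i<n. indicator (E i) y * ae_rep (\<omega> i v) (\<phi> y))" by auto
    have E: "ess_bdd \<mu>Y (indicator (E n))" using Suc.prems by (intro ess_bdd_indicator) simp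
    have \<omega>: "\<omega> n \<in> dual_carrier \<mu>X M" using Suc.prems by simp
    have c: "act \<mu>Y PD (indicator (E n)) (pbD (\<omega> n)) \<in> carrier PD"
      by (intro PD.act_closed E pbD_closed \<omega>)
    show ?case
    proof (intro bexI ballI)
      show "\<Lambda> \<oplus>\<^bsub>PD\<^esub> act \<mu>Y PD (indicator (E n)) (pbD (\<omega> n)) \<in> carrier PD" using \<Lambda> c by simp
      fix v assume v: "v \<in> carrier M"
      have "I (pbD (\<omega> n)) (pbM v) = ae_class \<mu>Y (\<lambda>y. ae_rep (\<omega> n v) (\<phi> y))"
        using I_pb[of "\<omega> n" v] v \<omega> by (simp add: dual_def ae_comp_def)
      moreover have "(\<lambda>y. ae_rep (\<omega> n v) (\<phi> y)) \<in> borel_measurable \<mu>Y"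
        using M.dual_rep(1)[OF \<omega> v] by measurable
      ultimately have "AE y in \<mu>Y. ae_rep (I (pbD (\<omega> n)) (pbM v)) y = ae_rep (\<omega> n v) (\<phi> y)"
        by (simp add: ae_rep_class(2))
      with I_add[OF \<Lambda>(1) c pbM_closed[OF v]] I_act[OF E pbD_closed[OF \<omega>] pbM_closed[OF v]] \<Lambda>(2)[OF v]
      show "AE y in \<mu>Y. ae_rep (I (\<Lambda> \<oplus>\<^bsub>PD\<^esub> act \<mu>Y PD (indicator (E n)) (pbD (\<omega> n))) (pbM v)) y =
        (\<Sum>i<Suc n. indicator (E i) y * ae_rep (\<omega> i v) (\<phi> y))"
        by eventually_elim simp
    qed
  qed
  then show thesis using that by blast
qed

end

section \<open>Approximation by a single conditional expectation\<close>

context dual_of_pullback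
begin

definition gen_algebra :: "('y \<Rightarrow> nat) \<Rightarrow> 'y measure" where
  "gen_algebra \<iota> = vimage_algebra (space \<mu>Y) (\<lambda>y. (\<phi> y, \<iota> y)) (\<mu>X \<Otimes>\<^sub>M count_space UNIV)"

lemma gen_algebra_pair: "(\<lambda>y. (\<phi> y, \<iota> y)) \<in> space \<mu>Y \<rightarrow> space (\<mu>X \<Otimes>\<^sub>M count_space (UNIV :: nat set))"
  using measurable_space[OF phi] by (auto simp: space_pair_measure)

lemma space_gen_algebra: "space (gen_algebra \<iota>) = space \<mu>Y"
  by (simp add: gen_algebra_def)

lemma gen_algebra_phi: "\<phi> \<in> gen_algebra \<iota> \<rightarrow>\<^sub>M \<mu>X"
proof -
  have "fst \<circ> (\<lambda>y. (\<phi> y, \<iota> y)) \<in> gen_algebra \<iota> \<rightarrow>\<^sub>M \<mu>X"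
    unfolding gen_algebra_def by (rule measurable_comp[OF measurable_vimage_algebra1[OF gen_algebra_pair] measurable_fst])
  then show ?thesis by (simp add: comp_def)
qed

lemma gen_algebra_iota: "\<iota> \<in> gen_algebra \<iota> \<rightarrow>\<^sub>M count_space UNIV"
proof -
  have "snd \<circ> (\<lambda>y. (\<phi> y, \<iota> y)) \<in> gen_algebra \<iota> \<rightarrow>\<^sub>M count_space UNIV"
    unfolding gen_algebra_def by (rule measurable_comp[OF measurable_vimage_algebra1[OF gen_algebra_pair] measurable_snd])
  then show ?thesis by (simp add: comp_def)
qed

lemma sigma_finite_subalgebra_gen_algebra:
  assumes \<iota>[measurable]: "\<iota> \<in> \<mu>Y \<rightarrow>\<^sub>M count_space UNIV"
    and fin: "\<And>i. emeasure \<mu>Y {y \<in> space \<mu>Y. \<iota> y = i} < \<infinity>"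
  shows "sigma_finite_subalgebra \<mu>Y (gen_algebra \<iota>)"
proof (rule sigma_finite_subalgebra.intro)
  show sub: "subalgebra \<mu>Y (gen_algebra \<iota>)"
    unfolding subalgebra_def
  proof
    have m: "(\<lambda>y. (\<phi> y, \<iota> y)) \<in> \<mu>Y \<rightarrow>\<^sub>M (\<mu>X \<Otimes>\<^sub>M count_space UNIV)" by measurable
    show "sets (gen_algebra \<iota>) \<subseteq> sets \<mu>Y"
      using measurable_sets[OF m] by (auto simp: gen_algebra_def sets_vimage_algebra2[OF gen_algebra_pair])
  qed (rule space_gen_algebra)
  have E: "{y \<in> space \<mu>Y. \<iota> y = i} \<in> sets (gen_algebra \<iota>)" for i
    using measurable_sets[OF gen_algebra_iota, of "{i}" \<iota>] by (simp add: space_gen_algebra vimage_def Int_def conj_commute)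
  show "sigma_finite_measure (restr_to_subalg \<mu>Y (gen_algebra \<iota>))"
  proof
    show "\<exists>A. countable A \<and> A \<subseteq> sets (restr_to_subalg \<mu>Y (gen_algebra \<iota>)) \<and>
        \<Union>A = space (restr_to_subalg \<mu>Y (gen_algebra \<iota>)) \<and>
        (\<forall>a\<in>A. emeasure (restr_to_subalg \<mu>Y (gen_algebra \<iota>)) a \<noteq> \<infinity>)"
      by (rule exI[of _ "range (\<lambda>i. {y \<in> space \<mu>Y. \<iota> y = i})"])
        (use E fin in \<open>auto simp: sets_restr_to_subalg[OF sub] space_restr_to_subalg
          emeasure_restr_to_subalg[OF sub] less_top\<close>)
  qed
qed

text \<open>One approximation step. The restriction of \<open>\<omega>\<^sub>i\<close> to \<open>G\<^sub>i\<close> serves three purposes: the function \<open>k (\<cdot>, i)\<close>, which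
is only determined almost everywhere for the image of the fibre, becomes determined
\<open>\<mu>\<^sub>X\<close>-almost everywhere; it becomes integrable for \<open>\<mu>\<^sub>X\<close>; and its norm is controlled by that of \<open>v\<close>. The
last point holds although \<open>|v| \<circ> \<phi>\<close> may be large in \<open>L\<^sup>p\<close>, because only its restriction to
\<open>{\<iota> = i, \<phi> \<in> G\<^sub>i}\<close> enters.\<close>

lemma dual_step:
  fixes \<delta> :: real
  assumes L: "L \<in> dual_carrier \<mu>Y PM"
    and \<iota>[measurable]: "\<iota> \<in> \<mu>Y \<rightarrow>\<^sub>M count_space UNIV"
    and fin: "\<And>i. emeasure \<mu>Y {y \<in> space \<mu>Y. \<iota> y = i} < \<infinity>"
    and D[measurable]: "D \<in> sets \<mu>Y" and D_fin: "emeasure \<mu>Y D < \<infinity>" and \<delta>: "0 < \<delta>"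
  obtains \<Lambda> H where "\<Lambda> \<in> carrier PD" "H \<in> sets (gen_algebra \<iota>)" "emeasure \<mu>Y H < \<infinity>"
    "emeasure \<mu>Y (D - H) \<le> ennreal \<delta>"
    "\<And>v. v \<in> carrier M \<Longrightarrow> AE y in \<mu>Y. ae_rep (I \<Lambda> (pbM v)) y =
      indicator H y * real_cond_exp \<mu>Y (gen_algebra \<iota>) (ae_rep (L (pbM v))) y"
proof -
  interpret S: sigma_finite_subalgebra \<mu>Y "gen_algebra \<iota>" by (rule sigma_finite_subalgebra_gen_algebra[OF \<iota> fin])
  have from_sig: "A \<in> sets \<mu>Y" if "A \<in> sets (gen_algebra \<iota>)" for A
    using S.subalg that by (auto simp: subalgebra_def)
  define T where "T = real_cond_exp \<mu>Y (gen_algebra \<iota>)"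
  define l where "l v = ae_rep (L (pbM v))" for v
  have l_int: "integrable \<mu>Y (l v)" if "v \<in> carrier M" for v
    unfolding l_def by (rule PM.dual_rep(3)[OF L pbM_closed[OF that]])
  have T_int: "integrable \<mu>Y (T f)" if "integrable \<mu>Y f" for f
    unfolding T_def by (rule S.real_cond_exp_int(1)[OF that])
  have "\<exists>k. k \<in> borel_measurable (\<mu>X \<Otimes>\<^sub>M count_space UNIV) \<and> (\<forall>y\<in>space \<mu>Y. T f y = k (\<phi> y, \<iota> y))" for f
  proof -
    have "T f \<in> borel_measurable (vimage_algebra (space \<mu>Y) (\<lambda>y. (\<phi> y, \<iota> y)) (\<mu>X \<Otimes>\<^sub>M count_space UNIV))"
      unfolding T_def by (fold gen_algebra_def) simp
    from vimage_algebra_real_factor[OF this gen_algebra_pair] show ?thesis by metis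
  qed
  then obtain K where K[measurable]: "\<And>f. K f \<in> borel_measurable (\<mu>X \<Otimes>\<^sub>M count_space UNIV)"
    and TK: "\<And>f y. y \<in> space \<mu>Y \<Longrightarrow> T f y = K f (\<phi> y, \<iota> y)" by metis
  define E where "E i = {y \<in> space \<mu>Y. \<iota> y = i}" for i
  have E[measurable]: "E i \<in> sets \<mu>Y" for i unfolding E_def by measurable
  have E_sig: "E i \<in> sets (gen_algebra \<iota>)" for i
    using measurable_sets[OF gen_algebra_iota, of "{i}" \<iota>] by (simp add: E_def space_gen_algebra vimage_def Int_def conj_commute)
  have E_fin: "emeasure \<mu>Y (E i) < \<infinity>" for i using fin by (simp add: E_def)
  have "(\<lambda>n. emeasure \<mu>Y {y \<in> D. n \<le> \<iota> y}) \<longlonglongrightarrow> emeasure \<mu>Y (\<Inter>n. {y \<in> D. n \<le> \<iota> y})"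
  proof (rule Lim_emeasure_decseq)
    show "emeasure \<mu>Y {y \<in> D. n \<le> \<iota> y} \<noteq> \<infinity>" for n
      using D_fin emeasure_mono[of "{y \<in> D. n \<le> \<iota> y}" D \<mu>Y] by (auto simp: less_top[symmetric] top_unique)
  qed (auto simp: decseq_def)
  also have "(\<Inter>n. {y \<in> D. n \<le> \<iota> y}) = {}" by auto (metis not_less_eq_eq order_refl)
  finally have "eventually (\<lambda>n. emeasure \<mu>Y {y \<in> D. n \<le> \<iota> y} < ennreal (\<delta> / 2)) sequentially"
    using \<delta> by (intro order_tendstoD(2)[of _ 0]) auto
  then obtain N where N: "emeasure \<mu>Y {y \<in> D. N \<le> \<iota> y} < ennreal (\<delta> / 2)"
    by (auto simp: eventually_sequentially)
  \<comment> \<open>Half of \<open>\<delta>\<close> is spent on the fibres from \<open>N\<close> on, the other half on the cuts in the first \<open>N\<close> fibres; the summand \<open>1\<close> covers \<open>N = 0\<close>.\<close>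
  define \<eta> where "\<eta> = \<delta> / (2 * (real N + 1))"
  have \<eta>: "0 < ennreal \<eta>" using \<delta> by (simp add: \<eta>_def)
  define good where "good i G C \<longleftrightarrow>
      G \<in> sets \<mu>X \<and> 0 \<le> C \<and> emeasure \<mu>Y {y \<in> E i. \<phi> y \<notin> G} < ennreal \<eta> \<and>
      (\<forall>g\<in>borel_measurable \<mu>X. (\<integral>\<^sup>+x. g x * indicator G x \<partial>\<mu>X)
        \<le> ennreal C * (\<integral>\<^sup>+y. g (\<phi> y) * indicator G (\<phi> y) * indicator (E i) y \<partial>\<mu>Y)) \<and>
      (\<forall>g\<in>borel_measurable \<mu>X. (\<integral>\<^sup>+y. g (\<phi> y) * indicator G (\<phi> y) * indicator (E i) y \<partial>\<mu>Y)
        \<le> ennreal C * (\<integral>\<^sup>+x. g x * indicator G x \<partial>\<mu>X))" for i G C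
  have "\<exists>G C. good i G C" for i
  proof -
    obtain G C where "G \<in> sets \<mu>X" "0 \<le> C" "emeasure \<mu>Y {y\<in>E i. \<phi> y \<notin> G} < ennreal \<eta>"
      "\<And>g. g \<in> borel_measurable \<mu>X \<Longrightarrow> (\<integral>\<^sup>+x. g x * indicator G x \<partial>\<mu>X)
        \<le> ennreal C * (\<integral>\<^sup>+y. g (\<phi> y) * indicator G (\<phi> y) * indicator (E i) y \<partial>\<mu>Y)"
      "\<And>g. g \<in> borel_measurable \<mu>X \<Longrightarrow> (\<integral>\<^sup>+y. g (\<phi> y) * indicator G (\<phi> y) * indicator (E i) y \<partial>\<mu>Y)
        \<le> ennreal C * (\<integral>\<^sup>+x. g x * indicator G x \<partial>\<mu>X)"
      by (rule X.comparable_part_of_image[OF phi ac E E_fin \<eta>, of i]) (rule that)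
    then show ?thesis unfolding good_def by (intro exI[of _ G] exI[of _ C] conjI ballI)
  qed
  then obtain G C where good: "\<And>i. good i (G i) (C i)" by metis
  have G[measurable]: "G i \<in> sets \<mu>X" and C: "0 \<le> C i"
    and G_small: "emeasure \<mu>Y {y \<in> E i. \<phi> y \<notin> G i} < ennreal \<eta>" for i
    using good[of i] unfolding good_def by blast+
  have G_up: "(\<integral>\<^sup>+x. g x * indicator (G i) x \<partial>\<mu>X)
        \<le> ennreal (C i) * (\<integral>\<^sup>+y. g (\<phi> y) * indicator (G i) (\<phi> y) * indicator (E i) y \<partial>\<mu>Y)"
    and G_down: "(\<integral>\<^sup>+y. g (\<phi> y) * indicator (G i) (\<phi> y) * indicator (E i) y \<partial>\<mu>Y)
        \<le> ennreal (C i) * (\<integral>\<^sup>+x. g x * indicator (G i) x \<partial>\<mu>X)"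
    if "g \<in> borel_measurable \<mu>X" for i g
    using good[of i] that unfolding good_def by blast+
  define B where "B i = {y \<in> E i. \<phi> y \<in> G i}" for i
  have B_sig: "B i \<in> sets (gen_algebra \<iota>)" for i
  proof -
    have "B i = E i \<inter> (\<phi> -` G i \<inter> space (gen_algebra \<iota>))" by (auto simp: B_def E_def space_gen_algebra)
    then show ?thesis using E_sig measurable_sets[OF gen_algebra_phi G] by simp
  qed
  have B[measurable]: "B i \<in> sets \<mu>Y" for i using B_sig by (rule from_sig)
  have B_ind: "indicator (G i) (\<phi> y) * indicator (E i) y = (indicator (B i) y :: 'z :: semiring_1)" for i y
    by (simp add: B_def indicator_def)
  \<comment> \<open>Properties that hold almost everywhere on \<open>B i\<close> descend to \<open>G i\<close>; this makes \<open>\<omega> i\<close> well defined and linear.\<close>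
  have AE_up: "AE x in \<mu>X. x \<in> G i \<longrightarrow> P x"
    if AEy: "AE y in \<mu>Y. y \<in> B i \<longrightarrow> P (\<phi> y)" and [measurable]: "Measurable.pred \<mu>X P" for i P
  proof -
    have "(\<integral>\<^sup>+x. indicator {x \<in> space \<mu>X. \<not> P x} x * indicator (G i) x \<partial>\<mu>X)
        \<le> ennreal (C i) * (\<integral>\<^sup>+y. indicator {x \<in> space \<mu>X. \<not> P x} (\<phi> y) * indicator (G i) (\<phi> y) * indicator (E i) y \<partial>\<mu>Y)"
      by (rule G_up) measurable
    also have "(\<integral>\<^sup>+y. indicator {x \<in> space \<mu>X. \<not> P x} (\<phi> y) * indicator (G i) (\<phi> y) * indicator (E i) y \<partial>\<mu>Y)
        = (\<integral>\<^sup>+y. 0 \<partial>\<mu>Y)"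
      by (rule nn_integral_cong_AE) (use AEy in \<open>auto elim!: eventually_mono simp: B_def indicator_def\<close>)
    finally have "(\<integral>\<^sup>+x. indicator {x \<in> space \<mu>X. \<not> P x} x * indicator (G i) x \<partial>\<mu>X) = 0" by simp
    then have "AE x in \<mu>X. (indicator {x \<in> space \<mu>X. \<not> P x} x * indicator (G i) x :: ennreal) = 0"
      by (subst (asm) nn_integral_0_iff_AE) measurable
    then show ?thesis using AE_space by eventually_elim (auto simp: indicator_def split: if_splits)
  qed
  define k where "k i v x = indicator (G i) x * K (l v) (x, i)" for i v x
  have k_meas[measurable]: "k i v \<in> borel_measurable \<mu>X" for i v unfolding k_def by measurable
  have kT: "k i v (\<phi> y) = T (l v) y" if "y \<in> B i" for i v y
    using that TK[of y "l v"] by (auto simp: k_def B_def E_def)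
  obtain CL where CL: "0 \<le> CL" "\<And>V. V \<in> carrier PM \<Longrightarrow> (\<integral>y. \<bar>ae_rep (L V) y\<bar> \<partial>\<mu>Y) \<le> CL * mnorm PM V"
    by (rule PM.dual_bounded[OF L]) auto
  have k_bound: "(\<integral>\<^sup>+x. ennreal \<bar>k i v x\<bar> \<partial>\<mu>X) \<le> ennreal (C i * (CL * (C i powr (1 / p) * mnorm M v)))"
    if v: "v \<in> carrier M" for i v
  proof -
    define V where "V = act \<mu>Y PM (indicator (B i)) (pbM v)"
    have V: "V \<in> carrier PM" unfolding V_def by (simp add: PM.act_closed ess_bdd_indicator pbM_closed v)
    have Bl: "integrable \<mu>Y (\<lambda>y. indicator (B i) y * l v y)"
      using integrable_real_mult_indicator[OF B l_int[OF v], of i] by (simp add: mult.commute)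
    have "(\<integral>\<^sup>+x. ennreal \<bar>k i v x\<bar> \<partial>\<mu>X) = (\<integral>\<^sup>+x. ennreal \<bar>K (l v) (x, i)\<bar> * indicator (G i) x \<partial>\<mu>X)"
      by (rule nn_integral_cong) (simp add: k_def indicator_def)
    also have "\<dots> \<le> ennreal (C i) * (\<integral>\<^sup>+y. ennreal \<bar>K (l v) (\<phi> y, i)\<bar> * indicator (G i) (\<phi> y) * indicator (E i) y \<partial>\<mu>Y)"
      by (rule G_up) measurable
    also have "(\<integral>\<^sup>+y. ennreal \<bar>K (l v) (\<phi> y, i)\<bar> * indicator (G i) (\<phi> y) * indicator (E i) y \<partial>\<mu>Y)
        = (\<integral>\<^sup>+y. ennreal \<bar>T (\<lambda>y. indicator (B i) y * l v y) y\<bar> \<partial>\<mu>Y)"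
    proof (rule nn_integral_cong_AE)
      have "AE y in \<mu>Y. T (\<lambda>y. indicator (B i) y * l v y) y = indicator (B i) y * T (l v) y"
        unfolding T_def by (rule S.real_cond_exp_mult) (use Bl B_sig l_int[OF v] in auto)
      then show "AE y in \<mu>Y. ennreal \<bar>K (l v) (\<phi> y, i)\<bar> * indicator (G i) (\<phi> y) * indicator (E i) y
          = ennreal \<bar>T (\<lambda>y. indicator (B i) y * l v y) y\<bar>"
        using AE_space by eventually_elim (auto simp: TK B_def E_def indicator_def)
    qed
    also have "\<dots> = ennreal (\<integral>y. \<bar>T (\<lambda>y. indicator (B i) y * l v y) y\<bar> \<partial>\<mu>Y)"
      by (rule nn_integral_eq_integral) (use T_int[OF Bl] in auto)
    also have "\<dots> \<le> ennreal (\<integral>y. \<bar>indicator (B i) y * l v y\<bar> \<partial>\<mu>Y)"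
      unfolding T_def by (intro ennreal_leI S.real_cond_exp_L1_contraction Bl)
    also have "(\<integral>y. \<bar>indicator (B i) y * l v y\<bar> \<partial>\<mu>Y) = (\<integral>y. \<bar>ae_rep (L V) y\<bar> \<partial>\<mu>Y)"
    proof (rule integral_cong_AE)
      show "AE y in \<mu>Y. \<bar>indicator (B i) y * l v y\<bar> = \<bar>ae_rep (L V) y\<bar>"
        using PM.dual_act[OF L ess_bdd_indicator[OF B] pbM_closed[OF v], of i]
        by eventually_elim (simp add: V_def l_def)
    qed (use Bl PM.dual_rep(1)[OF L V] in auto)
    also have "\<dots> \<le> CL * mnorm PM V" by (rule CL(2)[OF V])
    also have "mnorm PM V \<le> C i powr (1 / p) * mnorm M v"
    proof -
      have pnorm_rep[measurable]: "pnorm_rep M v \<in> borel_measurable \<mu>X" by (rule M.pnorm_rep_meas[OF v])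
      have "ennreal (\<integral>y. indicator (B i) y * \<bar>pnorm_rep PM (pbM v) y\<bar> powr p \<partial>\<mu>Y)
          = (\<integral>\<^sup>+y. ennreal (indicator (B i) y * \<bar>pnorm_rep PM (pbM v) y\<bar> powr p) \<partial>\<mu>Y)"
        by (rule nn_integral_eq_integral[symmetric])
          (use integrable_real_mult_indicator[OF B PM.pnorm_rep_integrable[OF pbM_closed[OF v]], of i] in
            \<open>auto simp: mult.commute\<close>)
      also have "\<dots> = (\<integral>\<^sup>+y. ennreal (\<bar>pnorm_rep M v (\<phi> y)\<bar> powr p) * indicator (G i) (\<phi> y) * indicator (E i) y \<partial>\<mu>Y)"
      proof (rule nn_integral_cong_AE)
        show "AE y in \<mu>Y. ennreal (indicator (B i) y * \<bar>pnorm_rep PM (pbM v) y\<bar> powr p)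
            = ennreal (\<bar>pnorm_rep M v (\<phi> y)\<bar> powr p) * indicator (G i) (\<phi> y) * indicator (E i) y"
          using pnorm_rep_pbM[OF v] by eventually_elim (auto simp: B_def indicator_def)
      qed
      also have "\<dots> \<le> ennreal (C i) * (\<integral>\<^sup>+x. ennreal (\<bar>pnorm_rep M v x\<bar> powr p) * indicator (G i) x \<partial>\<mu>X)"
        by (rule G_down) measurable
      also have "\<dots> \<le> ennreal (C i) * (\<integral>\<^sup>+x. ennreal (\<bar>pnorm_rep M v x\<bar> powr p) \<partial>\<mu>X)"
        by (intro mult_left_mono nn_integral_mono) (auto simp: indicator_def)
      also have "(\<integral>\<^sup>+x. ennreal (\<bar>pnorm_rep M v x\<bar> powr p) \<partial>\<mu>X) = ennreal (\<integral>x. \<bar>pnorm_rep M v x\<bar> powr p \<partial>\<mu>X)"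
        by (rule nn_integral_eq_integral[OF M.pnorm_rep_integrable[OF v]]) auto
      finally have "(\<integral>y. indicator (B i) y * \<bar>pnorm_rep PM (pbM v) y\<bar> powr p \<partial>\<mu>Y) \<le> C i * (\<integral>x. \<bar>pnorm_rep M v x\<bar> powr p \<partial>\<mu>X)"
        using C[of i] by (simp add: ennreal_mult[symmetric] ennreal_le_iff)
      then have "mnorm PM V \<le> (C i * (\<integral>x. \<bar>pnorm_rep M v x\<bar> powr p \<partial>\<mu>X)) powr (1 / p)"
        unfolding V_def PM.mnorm_indicator[OF pbM_closed[OF v] B] using p
        by (intro powr_mono2) auto
      then show ?thesis using C[of i] by (simp add: M.mnorm_eq[OF v] powr_mult)
    qed
    finally show ?thesis
      using C[of i] CL(1) by (simp add: ennreal_mult[symmetric] mult_left_mono ennreal_leI M.mnorm_nonneg[OF v])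
  qed
  have k_int: "integrable \<mu>X (k i v)" if v: "v \<in> carrier M" for i v
    by (rule integrableI_bounded) (use k_bound[OF v, of i] in \<open>auto intro: le_less_trans\<close>)
  define \<omega> where "\<omega> i = (\<lambda>v\<in>carrier M. ae_class \<mu>X (k i v))" for i
  have \<omega>: "\<omega> i \<in> dual_carrier \<mu>X M" for i
    unfolding \<omega>_def
  proof (rule M.dual_carrierI)
    show "integrable \<mu>X (k i v)" if "v \<in> carrier M" for v by (rule k_int[OF that])
    show "0 \<le> C i * (CL * C i powr (1 / p))" using C CL by simp
    show "(\<integral>x. \<bar>k i v x\<bar> \<partial>\<mu>X) \<le> C i * (CL * C i powr (1 / p)) * mnorm M v" if v: "v \<in> carrier M" for v
    proof -
      have "ennreal (\<integral>x. \<bar>k i v x\<bar> \<partial>\<mu>X) = (\<integral>\<^sup>+x. ennreal \<bar>k i v x\<bar> \<partial>\<mu>X)"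
        by (rule nn_integral_eq_integral[symmetric]) (use k_int[OF v] in auto)
      also note k_bound[OF v, of i]
      finally show ?thesis
        using C[of i] CL(1) M.mnorm_nonneg[OF v] by (subst (asm) ennreal_le_iff) (auto simp: mult.assoc)
    qed
  next
    fix v w assume v: "v \<in> carrier M" and w: "w \<in> carrier M"
    have "AE y in \<mu>Y. T (l (v \<oplus>\<^bsub>M\<^esub> w)) y = T (\<lambda>y. l v y + l w y) y"
      unfolding T_def
    proof (rule S.real_cond_exp_cong)
      show "AE y in \<mu>Y. l (v \<oplus>\<^bsub>M\<^esub> w) y = l v y + l w y"
        using PM.dual_add[OF L pbM_closed[OF v] pbM_closed[OF w]] by (simp add: l_def pbM_add v w)
    qed (use l_int[OF v] l_int[OF w] l_int[of "v \<oplus>\<^bsub>M\<^esub> w"] v w in auto)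
    moreover have "AE y in \<mu>Y. T (\<lambda>y. l v y + l w y) y = T (l v) y + T (l w) y"
      unfolding T_def by (rule S.real_cond_exp_add[OF l_int[OF v] l_int[OF w]])
    ultimately have "AE y in \<mu>Y. y \<in> B i \<longrightarrow> k i (v \<oplus>\<^bsub>M\<^esub> w) (\<phi> y) = k i v (\<phi> y) + k i w (\<phi> y)"
      by eventually_elim (auto simp: kT)
    then have "AE x in \<mu>X. x \<in> G i \<longrightarrow> k i (v \<oplus>\<^bsub>M\<^esub> w) x = k i v x + k i w x"
      by (rule AE_up) measurable
    then show "AE x in \<mu>X. k i (v \<oplus>\<^bsub>M\<^esub> w) x = k i v x + k i w x"
      by eventually_elim (auto simp: k_def indicator_def)
  next
    fix f v assume f: "ess_bdd \<mu>X f" and v: "v \<in> carrier M"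
    have [measurable]: "f \<in> borel_measurable \<mu>X" using f by (rule ess_bdd_meas)
    have fv: "act \<mu>X M f v \<in> carrier M" by (rule M.act_closed[OF f v])
    have eq: "AE y in \<mu>Y. l (act \<mu>X M f v) y = f (\<phi> y) * l v y"
      using PM.dual_act[OF L ess_bdd_comp[OF f] pbM_closed[OF v]] by (simp add: l_def pbM_act f v)
    have m1: "(\<lambda>y. f (\<phi> y)) \<in> borel_measurable (gen_algebra \<iota>)"
      using measurable_comp[OF gen_algebra_phi, of f borel \<iota>] by (simp add: comp_def)
    have fl: "integrable \<mu>Y (\<lambda>y. f (\<phi> y) * l v y)"
      by (rule integrable_cong_AE_imp[OF l_int[OF fv]]) (use eq l_int[OF v] in auto)
    have "AE y in \<mu>Y. T (l (act \<mu>X M f v)) y = T (\<lambda>y. f (\<phi> y) * l v y) y"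
      unfolding T_def by (rule S.real_cond_exp_cong[OF eq]) (use l_int[OF fv] fl in auto)
    moreover have "AE y in \<mu>Y. T (\<lambda>y. f (\<phi> y) * l v y) y = f (\<phi> y) * T (l v) y"
      unfolding T_def by (rule S.real_cond_exp_mult[OF m1 _ fl]) (use l_int[OF v] in auto)
    ultimately have "AE y in \<mu>Y. y \<in> B i \<longrightarrow> k i (act \<mu>X M f v) (\<phi> y) = f (\<phi> y) * k i v (\<phi> y)"
      by eventually_elim (auto simp: kT)
    then have "AE x in \<mu>X. x \<in> G i \<longrightarrow> k i (act \<mu>X M f v) x = f x * k i v x"
      by (rule AE_up) measurable
    then show "AE x in \<mu>X. k i (act \<mu>X M f v) x = f x * k i v x"
      by eventually_elim (auto simp: k_def indicator_def)
  qed
  obtain \<Lambda> where \<Lambda>: "\<Lambda> \<in> carrier PD" "\<And>v. v \<in> carrier M \<Longrightarrow> AE y in \<mu>Y. ae_rep (I \<Lambda> (pbM v)) y =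
      (\<Sum>i<N. indicator (E i) y * ae_rep (\<omega> i v) (\<phi> y))"
    by (rule I_sum[of N E \<omega>]) (auto simp: \<omega>)
  define H where "H = (\<Union>i<N. B i)"
  have H: "H \<in> sets (gen_algebra \<iota>)" unfolding H_def using B_sig by (intro sets.finite_UN) auto
  show thesis
  proof (rule that[OF \<Lambda>(1) H])
    have "emeasure \<mu>Y H \<le> (\<Sum>i<N. emeasure \<mu>Y (B i))"
      unfolding H_def by (rule emeasure_subadditive_finite) auto
    also have "\<dots> \<le> (\<Sum>i<N. emeasure \<mu>Y (E i))"
      by (intro sum_mono emeasure_mono) (auto simp: B_def)
    also have "\<dots> < \<infinity>" using E_fin by (simp add: less_top)
    finally show "emeasure \<mu>Y H < \<infinity>" .
    have "emeasure \<mu>Y (D - H) \<le> emeasure \<mu>Y ({y \<in> D. N \<le> \<iota> y} \<union> (\<Union>i<N. {y \<in> E i. \<phi> y \<notin> G i}))"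
      by (rule emeasure_mono)
        (use sets.sets_into_space[OF D] in \<open>auto simp: H_def B_def E_def not_le\<close>)
    also have "\<dots> \<le> emeasure \<mu>Y {y \<in> D. N \<le> \<iota> y} + emeasure \<mu>Y (\<Union>i<N. {y \<in> E i. \<phi> y \<notin> G i})"
      by (rule emeasure_subadditive) auto
    also have "emeasure \<mu>Y (\<Union>i<N. {y \<in> E i. \<phi> y \<notin> G i}) \<le> (\<Sum>i<N. emeasure \<mu>Y {y \<in> E i. \<phi> y \<notin> G i})"
      by (rule emeasure_subadditive_finite) auto
    also have "\<dots> \<le> (\<Sum>i<N. ennreal \<eta>)"
      by (intro sum_mono less_imp_le G_small)
    also have "\<dots> = ennreal (real N * \<eta>)"
      using \<eta> by (simp add: ennreal_mult ennreal_of_nat_eq_real_of_nat)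
    also have "\<dots> \<le> ennreal (\<delta> / 2)"
      using \<delta> by (intro ennreal_leI) (simp add: \<eta>_def field_simps)
    also have "emeasure \<mu>Y {y \<in> D. N \<le> \<iota> y} \<le> ennreal (\<delta> / 2)" using N by simp
    also have "ennreal (\<delta> / 2) + ennreal (\<delta> / 2) = ennreal \<delta>"
      using \<delta> by (simp flip: ennreal_plus)
    finally show "emeasure \<mu>Y (D - H) \<le> ennreal \<delta>" by (simp add: add_left_mono add_right_mono)
    fix v assume v: "v \<in> carrier M"
    have "AE y in \<mu>Y. \<forall>i\<in>{..<N}. ae_rep (\<omega> i v) (\<phi> y) = k i v (\<phi> y)"
    proof (rule AE_finite_allI)
      show "AE y in \<mu>Y. ae_rep (\<omega> i v) (\<phi> y) = k i v (\<phi> y)" for i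
        using AE_comp[OF ae_rep_class(2)[OF k_meas[of i v]]] v by (simp add: \<omega>_def)
    qed simp
    with \<Lambda>(2)[OF v] AE_space
    show "AE y in \<mu>Y. ae_rep (I \<Lambda> (pbM v)) y =
      indicator H y * real_cond_exp \<mu>Y (gen_algebra \<iota>) (ae_rep (L (pbM v))) y"
    proof eventually_elim
      case (elim y)
      have "(\<Sum>i<N. indicator (E i) y * ae_rep (\<omega> i v) (\<phi> y)) = (\<Sum>i<N. if i = \<iota> y then k i v (\<phi> y) else 0)"
        using elim by (intro sum.cong) (auto simp: E_def indicator_def)
      also have "\<dots> = (if \<iota> y < N then k (\<iota> y) v (\<phi> y) else 0)" by simp
      also have "\<dots> = indicator H y * T (l v) y"
        using elim by (auto simp: H_def B_def E_def k_def indicator_def TK)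
      finally show ?case using elim by (simp add: T_def l_def[abs_def])
    qed
  qed
qed

end

section \<open>Piecewise pulled back elements\<close>

lemma (in Lp_normed_module_pos) mnorm_mono:
  assumes "v \<in> carrier M" "w \<in> carrier M" "AE x in \<mu>. pnorm_rep M v x \<le> pnorm_rep M w x"
  shows "mnorm M v \<le> mnorm M w"
  using mnorm_le_mono[OF assms(1) pnorm_rep_integrable[OF assms(2)] assms(3)] by (simp add: mnorm_eq assms(2))

lemma integrable_indicator_powr:
  fixes f :: "'a \<Rightarrow> real"
  assumes p: "1 \<le> p" and f[measurable]: "f \<in> borel_measurable M"
    and fp: "integrable M (\<lambda>x. \<bar>f x\<bar> powr p)"
    and A[measurable]: "A \<in> sets M" and fin: "emeasure M A < \<infinity>"
  shows "integrable M (\<lambda>x. indicator A x * f x)"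
proof (rule Bochner_Integration.integrable_bound)
  show "integrable M (\<lambda>x. indicator A x + \<bar>f x\<bar> powr p)"
    using fp fin by (intro Bochner_Integration.integrable_add integrable_real_indicator) auto
  show "AE x in M. norm (indicator A x * f x) \<le> norm (indicator A x + \<bar>f x\<bar> powr p)"
  proof (rule AE_I2)
    fix x
    have "\<bar>f x\<bar> \<le> 1 + \<bar>f x\<bar> powr p"
    proof (cases "\<bar>f x\<bar> \<le> 1")
      case False
      then have "\<bar>f x\<bar> powr 1 \<le> \<bar>f x\<bar> powr p" using p by (intro powr_mono) auto
      then show ?thesis using False by simp
    qed (simp add: add_increasing2)
    then show "norm (indicator A x * f x) \<le> norm (indicator A x + \<bar>f x\<bar> powr p)"
      by (simp add: indicator_def)
  qed
qed measurable

context dual_of_pullback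
begin

text \<open>These elements play the role of simple functions. The pieces are given as level sets of an index
function and are therefore disjoint, so that the pointwise norm is \<open>|w\<^sub>k| \<circ> \<phi>\<close> on the \<open>k\<close>-th piece.\<close>

definition piecewise :: "'n \<Rightarrow> bool" where
  "piecewise V \<longleftrightarrow> V \<in> carrier PM \<and> (\<exists>\<kappa> K w. \<kappa> \<in> \<mu>Y \<rightarrow>\<^sub>M count_space (UNIV :: nat set) \<and> finite K \<and>
     (\<forall>y\<in>space \<mu>Y. \<kappa> y \<in> K) \<and> (\<forall>k. w k \<in> carrier M \<and>
       act \<mu>Y PM (indicator {y \<in> space \<mu>Y. \<kappa> y = k}) V
         = act \<mu>Y PM (indicator {y \<in> space \<mu>Y. \<kappa> y = k}) (pbM (w k))))"

lemma piecewise_add: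
  assumes "piecewise V" "piecewise V'"
  shows "piecewise (V \<oplus>\<^bsub>PM\<^esub> V')"
proof -
  obtain \<kappa> K w where V: "V \<in> carrier PM" and \<kappa>[measurable]: "\<kappa> \<in> \<mu>Y \<rightarrow>\<^sub>M count_space (UNIV :: nat set)"
    and K: "finite K" "\<And>y. y \<in> space \<mu>Y \<Longrightarrow> \<kappa> y \<in> K" and w: "\<And>k. w k \<in> carrier M"
    and eq: "\<And>k. act \<mu>Y PM (indicator {y \<in> space \<mu>Y. \<kappa> y = k}) V
         = act \<mu>Y PM (indicator {y \<in> space \<mu>Y. \<kappa> y = k}) (pbM (w k))"
    using assms(1) unfolding piecewise_def by blast
  obtain \<kappa>' K' w' where V': "V' \<in> carrier PM" and \<kappa>'[measurable]: "\<kappa>' \<in> \<mu>Y \<rightarrow>\<^sub>M count_space (UNIV :: nat set)"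
    and K': "finite K'" "\<And>y. y \<in> space \<mu>Y \<Longrightarrow> \<kappa>' y \<in> K'" and w': "\<And>k. w' k \<in> carrier M"
    and eq': "\<And>k. act \<mu>Y PM (indicator {y \<in> space \<mu>Y. \<kappa>' y = k}) V'
         = act \<mu>Y PM (indicator {y \<in> space \<mu>Y. \<kappa>' y = k}) (pbM (w' k))"
    using assms(2) unfolding piecewise_def by blast
  have *: "act \<mu>Y PM (indicator (A \<inter> B)) U = act \<mu>Y PM (indicator (A \<inter> B)) U'"
    if [measurable]: "A \<in> sets \<mu>Y" "B \<in> sets \<mu>Y" and U: "U \<in> carrier PM" "U' \<in> carrier PM"
      and UU: "act \<mu>Y PM (indicator A) U = act \<mu>Y PM (indicator A) U'" for A B U U'
  proof -
    have "(\<lambda>y. indicator B y * indicator A y :: real) = indicator (A \<inter> B)" by (auto simp: indicator_def)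
    then show ?thesis
      using PM.act_act[of "indicator B" "indicator A" U] PM.act_act[of "indicator B" "indicator A" U'] U UU that(1,2)
      by (simp add: ess_bdd_indicator)
  qed
  show ?thesis
    unfolding piecewise_def
  proof (intro conjI exI allI ballI)
    show "V \<oplus>\<^bsub>PM\<^esub> V' \<in> carrier PM" using V V' by simp
    show "(\<lambda>y. prod_encode (\<kappa> y, \<kappa>' y)) \<in> \<mu>Y \<rightarrow>\<^sub>M count_space UNIV" by measurable
    show "finite (prod_encode ` (K \<times> K'))" using K K' by simp
    show "prod_encode (\<kappa> y, \<kappa>' y) \<in> prod_encode ` (K \<times> K')" if "y \<in> space \<mu>Y" for y
      using K(2)[OF that] K'(2)[OF that] by simp
    fix k
    obtain i j where k: "k = prod_encode (i, j)" by (metis prod_decode_inverse surj_pair)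
    show "w (fst (prod_decode k)) \<oplus>\<^bsub>M\<^esub> w' (snd (prod_decode k)) \<in> carrier M" using w w' by simp
    let ?A = "{y \<in> space \<mu>Y. \<kappa> y = i}" and ?B = "{y \<in> space \<mu>Y. \<kappa>' y = j}"
    have AB: "{y \<in> space \<mu>Y. prod_encode (\<kappa> y, \<kappa>' y) = k} = ?A \<inter> ?B" by (auto simp: k)
    have b: "ess_bdd \<mu>Y (indicator (?A \<inter> ?B))" by (rule ess_bdd_indicator) measurable
    have 1: "act \<mu>Y PM (indicator (?A \<inter> ?B)) V = act \<mu>Y PM (indicator (?A \<inter> ?B)) (pbM (w i))"
      by (rule *) (use V pbM_closed w eq in auto)
    have 2: "act \<mu>Y PM (indicator (?A \<inter> ?B)) V' = act \<mu>Y PM (indicator (?A \<inter> ?B)) (pbM (w' j))"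
      using *[of ?B ?A V' "pbM (w' j)"] V' pbM_closed w' eq' by (simp add: Int_commute)
    show "act \<mu>Y PM (indicator {y \<in> space \<mu>Y. prod_encode (\<kappa> y, \<kappa>' y) = k}) (V \<oplus>\<^bsub>PM\<^esub> V') =
      act \<mu>Y PM (indicator {y \<in> space \<mu>Y. prod_encode (\<kappa> y, \<kappa>' y) = k})
        (pbM (w (fst (prod_decode k)) \<oplus>\<^bsub>M\<^esub> w' (snd (prod_decode k))))"
      unfolding AB using 1 2 w w' V V' b by (simp add: PM.act_add pbM_add pbM_closed k)
  qed
qed

text \<open>Round \<open>f\<close> down to a multiple of \<open>\<eta>\<close>; on the level sets of the rounded function the coefficient is
constant and can be moved through the pullback map.\<close>

lemma act_pbM_approx:
  assumes f: "ess_bdd \<mu>Y f" and v: "v \<in> carrier M" and e: "0 < e"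
  obtains G where "piecewise G" "mnorm PM (act \<mu>Y PM f (pbM v) \<ominus>\<^bsub>PM\<^esub> G) < e"
proof -
  obtain C where C: "AE y in \<mu>Y. \<bar>f y\<bar> \<le> C" and [measurable]: "f \<in> borel_measurable \<mu>Y"
    using f by (auto simp: ess_bdd_def)
  have pv: "pbM v \<in> carrier PM" by (rule pbM_closed[OF v])
  define \<eta> where "\<eta> = e / (1 + mnorm PM (pbM v))"
  have \<eta>: "0 < \<eta>" using e PM.mnorm_nonneg[OF pv] by (simp add: \<eta>_def)
  \<comment> \<open>The bound of \<open>f\<close> holds almost everywhere only; clipping makes the rounded function take finitely many values everywhere.\<close>
  define g where "g y = max (- \<bar>C\<bar>) (min \<bar>C\<bar> (f y))" for y
  have [measurable]: "g \<in> borel_measurable \<mu>Y" unfolding g_def by measurable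
  \<comment> \<open>The shift by \<open>n\<close> makes the integer index of the level sets nonnegative.\<close>
  define n where "n = nat \<lceil>\<bar>C\<bar> / \<eta>\<rceil>"
  have n: "\<bar>C\<bar> / \<eta> \<le> real n" unfolding n_def by linarith
  have g_le: "\<bar>g y / \<eta>\<bar> \<le> real n" for y
    using n \<eta> by (auto simp: g_def abs_le_iff field_simps max_def min_def)
  define \<kappa> where "\<kappa> y = nat (\<lfloor>g y / \<eta>\<rfloor> + int n)" for y
  have [measurable]: "\<kappa> \<in> \<mu>Y \<rightarrow>\<^sub>M count_space UNIV" unfolding \<kappa>_def by measurable
  have fl: "- int n \<le> \<lfloor>g y / \<eta>\<rfloor> \<and> \<lfloor>g y / \<eta>\<rfloor> \<le> int n" for y
  proof -
    have "- real n \<le> g y / \<eta>" "g y / \<eta> \<le> real n" using abs_le_D1[OF g_le[of y]] abs_le_D2[OF g_le[of y]] by linarith+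
    then show ?thesis by linarith
  qed
  have \<kappa>_int: "int (\<kappa> y) = \<lfloor>g y / \<eta>\<rfloor> + int n" for y using fl[of y] by (simp add: \<kappa>_def)
  have \<kappa>_le: "\<kappa> y \<le> 2 * n" for y using \<kappa>_int[of y] fl[of y] by linarith
  define c where "c k = \<eta> * (real k - real n)" for k
  have close: "\<bar>g y - c (\<kappa> y)\<bar> \<le> \<eta>" for y
  proof -
    have r: "real (\<kappa> y) - real n = of_int \<lfloor>g y / \<eta>\<rfloor>"
      using arg_cong[OF \<kappa>_int[of y], of real_of_int] by simp
    have "\<bar>g y / \<eta> - of_int \<lfloor>g y / \<eta>\<rfloor>\<bar> \<le> 1" by linarith
    then have "\<eta> * \<bar>g y / \<eta> - of_int \<lfloor>g y / \<eta>\<rfloor>\<bar> \<le> \<eta> * 1" using \<eta> by (intro mult_left_mono) auto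
    moreover have "\<eta> * \<bar>g y / \<eta> - of_int \<lfloor>g y / \<eta>\<rfloor>\<bar> = \<bar>g y - \<eta> * of_int \<lfloor>g y / \<eta>\<rfloor>\<bar>"
    proof -
      have "\<eta> * (g y / \<eta> - of_int \<lfloor>g y / \<eta>\<rfloor>) = g y - \<eta> * of_int \<lfloor>g y / \<eta>\<rfloor>"
        using \<eta> by (simp add: right_diff_distrib)
      then show ?thesis using \<eta> by (metis abs_mult abs_of_pos)
    qed
    ultimately show ?thesis by (simp add: c_def r)
  qed
  have s: "ess_bdd \<mu>Y (\<lambda>y. c (\<kappa> y))"
  proof (rule ess_bddI[of _ _ "\<bar>C\<bar> + \<eta>"])
    show "\<bar>c (\<kappa> y)\<bar> \<le> \<bar>C\<bar> + \<eta>" for y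
    proof -
      have "\<bar>g y\<bar> \<le> \<bar>C\<bar>" by (auto simp: g_def max_def min_def)
      then show ?thesis using close[of y] by linarith
    qed
  qed measurable
  define G where "G = act \<mu>Y PM (\<lambda>y. c (\<kappa> y)) (pbM v)"
  show thesis
  proof (rule that[of G])
    show "piecewise G"
      unfolding piecewise_def
    proof (intro conjI exI allI ballI)
      show "G \<in> carrier PM" unfolding G_def by (rule PM.act_closed[OF s pv])
      show "\<kappa> \<in> \<mu>Y \<rightarrow>\<^sub>M count_space UNIV" by measurable
      show "finite {..2 * n}" "\<And>y. \<kappa> y \<in> {..2 * n}" using \<kappa>_le by auto
      fix k
      show "act \<mu>X M (\<lambda>_. c k) v \<in> carrier M" by (rule M.act_closed[OF ess_bdd_const v])
      have b: "ess_bdd \<mu>Y (indicator {y \<in> space \<mu>Y. \<kappa> y = k})" by (rule ess_bdd_indicator) measurable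
      have "(\<lambda>y. indicator {y \<in> space \<mu>Y. \<kappa> y = k} y * c (\<kappa> y)) = (\<lambda>y. indicator {y \<in> space \<mu>Y. \<kappa> y = k} y * c k)"
        by (auto simp: indicator_def)
      then show "act \<mu>Y PM (indicator {y \<in> space \<mu>Y. \<kappa> y = k}) G =
          act \<mu>Y PM (indicator {y \<in> space \<mu>Y. \<kappa> y = k}) (pbM (act \<mu>X M (\<lambda>_. c k) v))"
        unfolding G_def pbM_const[OF v] by (simp add: PM.act_act b s pv ess_bdd_const)
    qed
    have d: "ess_bdd \<mu>Y (\<lambda>y. f y + -1 * c (\<kappa> y))"
      by (rule ess_bdd_add[OF f ess_bdd_mult[OF ess_bdd_const s]])
    have "act \<mu>Y PM f (pbM v) \<ominus>\<^bsub>PM\<^esub> G = act \<mu>Y PM (\<lambda>y. f y + -1 * c (\<kappa> y)) (pbM v)"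
      using PM.act_plus[OF f ess_bdd_mult[OF ess_bdd_const[of _ "-1"] s] pv]
      by (simp add: G_def a_minus_def PM.minus_act PM.act_closed s pv PM.act_act ess_bdd_const)
    moreover have "mnorm PM (act \<mu>Y PM (\<lambda>y. f y + -1 * c (\<kappa> y)) (pbM v)) \<le> mnorm PM (act \<mu>Y PM (\<lambda>_. \<eta>) (pbM v))"
    proof (rule PM.mnorm_mono)
      show "AE y in \<mu>Y. pnorm_rep PM (act \<mu>Y PM (\<lambda>y. f y + -1 * c (\<kappa> y)) (pbM v)) y \<le> pnorm_rep PM (act \<mu>Y PM (\<lambda>_. \<eta>) (pbM v)) y"
        using PM.pnorm_rep_act[OF d pv] PM.pnorm_rep_act[OF ess_bdd_const[of _ \<eta>] pv] C PM.pnorm_rep_nonneg[OF pv]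
      proof eventually_elim
        case (elim y)
        have "g y = f y" using elim(3) by (auto simp: g_def)
        then have "\<bar>f y + -1 * c (\<kappa> y)\<bar> \<le> \<bar>\<eta>\<bar>" using close[of y] \<eta> by simp
        then show ?case using elim(1,2,4) by (simp add: mult_right_mono)
      qed
    qed (use d in \<open>auto intro!: PM.act_closed ess_bdd_const pv\<close>)
    moreover have "mnorm PM (act \<mu>Y PM (\<lambda>_. \<eta>) (pbM v)) = \<eta> * mnorm PM (pbM v)"
      using PM.norm_scale[OF pv, of \<eta>] \<eta> by (simp add: act_def)
    moreover have "\<eta> * mnorm PM (pbM v) < e"
    proof -
      have "\<eta> * mnorm PM (pbM v) < \<eta> * (1 + mnorm PM (pbM v))" using \<eta> by simp
      also have "\<dots> = e" using PM.mnorm_nonneg[OF pv] by (simp add: \<eta>_def)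
      finally show ?thesis .
    qed
    ultimately show "mnorm PM (act \<mu>Y PM f (pbM v) \<ominus>\<^bsub>PM\<^esub> G) < e" by simp
  qed
qed

lemma piecewise_dense:
  assumes V: "V \<in> carrier PM" and e: "0 < e"
  obtains G where "piecewise G" "mnorm PM (V \<ominus>\<^bsub>PM\<^esub> G) < e"
proof -
  interpret MS: Metric_space "carrier PM" "mdist PM" by (rule PM.Metric_space_module)
  define S where "S = {V \<in> carrier PM. \<forall>e>0. \<exists>G. piecewise G \<and> mnorm PM (V \<ominus>\<^bsub>PM\<^esub> G) < e}"
  have S_add: "V \<oplus>\<^bsub>PM\<^esub> V' \<in> S" if VV: "V \<in> S" "V' \<in> S" for V V'
    unfolding S_def
  proof (intro CollectI conjI allI impI)
    have c: "V \<in> carrier PM" "V' \<in> carrier PM" using VV by (auto simp: S_def)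
    then show "V \<oplus>\<^bsub>PM\<^esub> V' \<in> carrier PM" by simp
    fix e :: real assume e: "0 < e"
    obtain G where G: "piecewise G" "mnorm PM (V \<ominus>\<^bsub>PM\<^esub> G) < e / 2" using VV(1) half_gt_zero[OF e] unfolding S_def by blast
    obtain G' where G': "piecewise G'" "mnorm PM (V' \<ominus>\<^bsub>PM\<^esub> G') < e / 2" using VV(2) half_gt_zero[OF e] unfolding S_def by blast
    have g: "G \<in> carrier PM" "G' \<in> carrier PM" using G G' by (auto simp: piecewise_def)
    have "(V \<oplus>\<^bsub>PM\<^esub> V') \<ominus>\<^bsub>PM\<^esub> (G \<oplus>\<^bsub>PM\<^esub> G') = (V \<ominus>\<^bsub>PM\<^esub> G) \<oplus>\<^bsub>PM\<^esub> (V' \<ominus>\<^bsub>PM\<^esub> G')"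
      using c g by (simp add: a_minus_def PM.minus_add PM.a_ac)
    then have "mnorm PM ((V \<oplus>\<^bsub>PM\<^esub> V') \<ominus>\<^bsub>PM\<^esub> (G \<oplus>\<^bsub>PM\<^esub> G')) < e"
      using PM.norm_triangle[of "V \<ominus>\<^bsub>PM\<^esub> G" "V' \<ominus>\<^bsub>PM\<^esub> G'"] G(2) G'(2) c g by simp
    then show "\<exists>G. piecewise G \<and> mnorm PM ((V \<oplus>\<^bsub>PM\<^esub> V') \<ominus>\<^bsub>PM\<^esub> G) < e"
      using piecewise_add[OF G(1) G'(1)] by blast
  qed
  have S_act: "act \<mu>Y PM f (pbM v) \<in> S" if f: "ess_bdd \<mu>Y f" and v: "v \<in> carrier M" for f v
    unfolding S_def
  proof (intro CollectI conjI allI impI)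
    show "act \<mu>Y PM f (pbM v) \<in> carrier PM" by (rule PM.act_closed[OF f pbM_closed[OF v]])
    fix e :: real assume "0 < e"
    from act_pbM_approx[OF f v this]
    show "\<exists>G. piecewise G \<and> mnorm PM (act \<mu>Y PM f (pbM v) \<ominus>\<^bsub>PM\<^esub> G) < e" by metis
  qed
  have S_zero: "\<zero>\<^bsub>PM\<^esub> \<in> S"
    using S_act[OF ess_bdd_const M.zero_closed, of 0] by (simp add: PM.act_zero pbM_closed)
  have S_sum: "finsum PM (\<lambda>u. a u \<odot>\<^bsub>PM\<^esub> u) A \<in> S"
    if "finite A" "A \<subseteq> pbM ` carrier M" "a \<in> A \<rightarrow> Linf_space \<mu>Y" for a A
    using that
  proof (induction A rule: finite_induct)
    case empty
    then show ?case by (simp add: S_zero)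
  next
    case (insert u A)
    have *: "a x \<odot>\<^bsub>PM\<^esub> x \<in> S" if x: "x \<in> insert u A" for x
    proof -
      obtain v where v: "x = pbM v" "v \<in> carrier M" using insert.prems x by auto
      obtain f where f: "a x = ae_class \<mu>Y f" "ess_bdd \<mu>Y f"
        using insert.prems x by (metis Linf_space_ess_bddE Pi_mem)
      show ?thesis using S_act[OF f(2) v(2)] f(1) v(1) by (simp add: act_def)
    qed
    then have "a x \<odot>\<^bsub>PM\<^esub> x \<in> carrier PM" if "x \<in> insert u A" for x using that by (auto simp: S_def)
    then have "finsum PM (\<lambda>u. a u \<odot>\<^bsub>PM\<^esub> u) (insert u A) = a u \<odot>\<^bsub>PM\<^esub> u \<oplus>\<^bsub>PM\<^esub> finsum PM (\<lambda>u. a u \<odot>\<^bsub>PM\<^esub> u) A"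
      using insert.hyps by (intro PM.finsum_insert) auto
    then show ?case using S_add[OF *[of u] insert.IH] insert.prems by auto
  qed
  have "mtop PM closure_of linear_combinations \<mu>Y PM (pbM ` carrier M) = carrier PM"
    using pbM by (auto simp: is_pullback_def generates_def)
  then have "V \<in> MS.mtopology closure_of linear_combinations \<mu>Y PM (pbM ` carrier M)"
    using V by (simp add: mtop_def)
  then have "\<forall>r>0. \<exists>W\<in>linear_combinations \<mu>Y PM (pbM ` carrier M). W \<in> MS.mball V r"
    unfolding MS.metric_closure_of by simp
  then obtain W where W: "W \<in> linear_combinations \<mu>Y PM (pbM ` carrier M)" "W \<in> MS.mball V (e / 2)"
    using half_gt_zero[OF e] by blast
  have "W \<in> S" using W(1) S_sum unfolding linear_combinations_def by blast
  then obtain G where G: "piecewise G" "mnorm PM (W \<ominus>\<^bsub>PM\<^esub> G) < e / 2" and Wc: "W \<in> carrier PM"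
    using half_gt_zero[OF e] unfolding S_def by blast
  have g: "G \<in> carrier PM" using G by (simp add: piecewise_def)
  have "mnorm PM (V \<ominus>\<^bsub>PM\<^esub> W) < e / 2" using W(2) V Wc by (simp add: mdist_def)
  then have "mnorm PM (V \<ominus>\<^bsub>PM\<^esub> G) < e"
    using PM.norm_triangle[of "V \<ominus>\<^bsub>PM\<^esub> W" "W \<ominus>\<^bsub>PM\<^esub> G"] PM.diff_trans[OF V Wc g] V Wc g G(2) by simp
  then show thesis using G(1) that by blast
qed

end

section \<open>The uniform bound\<close>

lemma (in Lp_normed_module_pos) linear_combination:
  assumes L: "L \<in> dual_carrier \<mu> M" and "finite K"
    and "\<And>k. k \<in> K \<Longrightarrow> ess_bdd \<mu> (c k)" "\<And>k. k \<in> K \<Longrightarrow> u k \<in> carrier M"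
  obtains W where "W \<in> carrier M"
    "AE x in \<mu>. ae_rep (L W) x = (\<Sum>k\<in>K. c k x * ae_rep (L (u k)) x)"
    "AE x in \<mu>. pnorm_rep M W x \<le> (\<Sum>k\<in>K. \<bar>c k x\<bar> * pnorm_rep M (u k) x)"
proof -
  have "\<exists>W\<in>carrier M. (AE x in \<mu>. ae_rep (L W) x = (\<Sum>k\<in>K. c k x * ae_rep (L (u k)) x)) \<and>
    (AE x in \<mu>. pnorm_rep M W x \<le> (\<Sum>k\<in>K. \<bar>c k x\<bar> * pnorm_rep M (u k) x))"
    using assms(2-4)
  proof (induction K rule: finite_induct)
    case empty
    then show ?case using dual_zero[OF L] pnorm_rep_zero by (intro bexI[of _ \<zero>]) auto
  next
    case (insert k K)
    then obtain W where W: "W \<in> carrier M"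
      "AE x in \<mu>. ae_rep (L W) x = (\<Sum>k\<in>K. c k x * ae_rep (L (u k)) x)"
      "AE x in \<mu>. pnorm_rep M W x \<le> (\<Sum>k\<in>K. \<bar>c k x\<bar> * pnorm_rep M (u k) x)" by auto
    have ck: "ess_bdd \<mu> (c k)" and uk: "u k \<in> carrier M" using insert.prems by auto
    have a: "act \<mu> M (c k) (u k) \<in> carrier M" by (rule act_closed[OF ck uk])
    show ?case
    proof (intro bexI conjI)
      show "act \<mu> M (c k) (u k) \<oplus> W \<in> carrier M" using a W by simp
      show "AE x in \<mu>. ae_rep (L (act \<mu> M (c k) (u k) \<oplus> W)) x = (\<Sum>k\<in>insert k K. c k x * ae_rep (L (u k)) x)"
        using dual_add[OF L a W(1)] dual_act[OF L ck uk] W(2)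
        by eventually_elim (simp add: insert.hyps)
      show "AE x in \<mu>. pnorm_rep M (act \<mu> M (c k) (u k) \<oplus> W) x \<le> (\<Sum>k\<in>insert k K. \<bar>c k x\<bar> * pnorm_rep M (u k) x)"
        using pnorm_rep_triangle[OF a W(1)] pnorm_rep_act[OF ck uk] W(3)
        by eventually_elim (simp add: insert.hyps)
    qed
  qed
  then show thesis using that by blast
qed

context dual_of_pullback
begin

text \<open>The crucial point is that the bound \<open>C\<close> of \<open>L\<close> is kept. With \<open>f\<^sub>k = sgn (I \<Lambda> V) \<chi>\<^bsub>B\<^sub>k \<inter> H\<^esub>\<close>, self-adjointness turns
the \<open>L\<^sup>1\<close>-norm of \<open>I \<Lambda> V\<close> into the integral of \<open>L W\<close> for \<open>W = \<Sum>\<^sub>k T (f\<^sub>k) \<phi>\<^sup>* w\<^sub>k\<close>. As \<open>|w\<^sub>k| \<circ> \<phi>\<close> is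
measurable for the \<open>\<sigma>\<close>-algebra of \<open>T\<close>, it can be taken inside \<open>T\<close>, and
\<open>|W| \<le> \<Sum>\<^sub>k T (\<chi>\<^bsub>B\<^sub>k \<inter> H\<^esub>) |w\<^sub>k| \<circ> \<phi> = T (\<chi>\<^sub>H |V|)\<close>.\<close>

lemma step_bounded_piecewise:
  assumes L: "L \<in> dual_carrier \<mu>Y PM" and C0: "0 \<le> C"
    and C: "\<And>V. V \<in> carrier PM \<Longrightarrow> (\<integral>y. \<bar>ae_rep (L V) y\<bar> \<partial>\<mu>Y) \<le> C * mnorm PM V"
    and \<iota>[measurable]: "\<iota> \<in> \<mu>Y \<rightarrow>\<^sub>M count_space UNIV"
    and fin: "\<And>i. emeasure \<mu>Y {y \<in> space \<mu>Y. \<iota> y = i} < \<infinity>"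
    and \<Lambda>: "\<Lambda> \<in> carrier PD" and H_sig: "H \<in> sets (gen_algebra \<iota>)" and H_fin: "emeasure \<mu>Y H < \<infinity>"
    and I\<Lambda>: "\<And>v. v \<in> carrier M \<Longrightarrow> AE y in \<mu>Y. ae_rep (I \<Lambda> (pbM v)) y =
      indicator H y * real_cond_exp \<mu>Y (gen_algebra \<iota>) (ae_rep (L (pbM v))) y"
    and pw: "piecewise V"
  shows "(\<integral>y. \<bar>ae_rep (I \<Lambda> V) y\<bar> \<partial>\<mu>Y) \<le> C * mnorm PM V"
proof -
  interpret S: sigma_finite_subalgebra \<mu>Y "gen_algebra \<iota>" by (rule sigma_finite_subalgebra_gen_algebra[OF \<iota> fin])
  define T where "T = real_cond_exp \<mu>Y (gen_algebra \<iota>)"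
  have T_int: "integrable \<mu>Y (T f)" if "integrable \<mu>Y f" for f
    unfolding T_def by (rule S.real_cond_exp_int(1)[OF that])
  have H[measurable]: "H \<in> sets \<mu>Y" using S.subalg H_sig by (auto simp: subalgebra_def)
  obtain \<kappa> K w where V: "V \<in> carrier PM" and \<kappa>[measurable]: "\<kappa> \<in> \<mu>Y \<rightarrow>\<^sub>M count_space (UNIV :: nat set)"
    and K: "finite K" "\<And>y. y \<in> space \<mu>Y \<Longrightarrow> \<kappa> y \<in> K" and w: "\<And>k. w k \<in> carrier M"
    and eq: "\<And>k. act \<mu>Y PM (indicator {y \<in> space \<mu>Y. \<kappa> y = k}) V
         = act \<mu>Y PM (indicator {y \<in> space \<mu>Y. \<kappa> y = k}) (pbM (w k))"
    using pw unfolding piecewise_def by blast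
  define B where "B k = {y \<in> space \<mu>Y. \<kappa> y = k}" for k
  have B[measurable]: "B k \<in> sets \<mu>Y" for k unfolding B_def by measurable
  have Bb: "ess_bdd \<mu>Y (indicator (B k))" for k by (rule ess_bdd_indicator[OF B])
  have pw_closed: "pbM (w k) \<in> carrier PM" for k by (rule pbM_closed[OF w])
  note dI = I_closed[OF \<Lambda>]
  define R where "R = ae_rep (I \<Lambda> V)"
  have R[measurable]: "R \<in> borel_measurable \<mu>Y" and R_int: "integrable \<mu>Y R"
    unfolding R_def using PM.dual_rep[OF dI V] by auto
  define l where "l k = ae_rep (L (pbM (w k)))" for k
  have l_int: "integrable \<mu>Y (l k)" for k unfolding l_def by (rule PM.dual_rep(3)[OF L pw_closed])
  have R_on: "AE y in \<mu>Y. indicator (B k) y * R y = indicator (B k) y * (indicator H y * T (l k) y)" for k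
  proof -
    have "AE y in \<mu>Y. ae_rep (I \<Lambda> (act \<mu>Y PM (indicator (B k)) V)) y = indicator (B k) y * R y"
      unfolding R_def by (rule PM.dual_act[OF dI Bb V])
    moreover have "AE y in \<mu>Y. ae_rep (I \<Lambda> (act \<mu>Y PM (indicator (B k)) V)) y
        = indicator (B k) y * ae_rep (I \<Lambda> (pbM (w k))) y"
      using PM.dual_act[OF dI Bb pw_closed, of k k] eq[of k] by (simp add: B_def)
    ultimately show ?thesis
      using I\<Lambda>[OF w, of k] by eventually_elim (auto simp: T_def l_def[abs_def])
  qed
  define f where "f k y = sgn (R y) * indicator (B k \<inter> H) y" for k y
  have f_meas[measurable]: "f k \<in> borel_measurable \<mu>Y" for k unfolding f_def by measurable
  have BH_int: "integrable \<mu>Y (indicator (B k \<inter> H) :: 'y \<Rightarrow> real)" for k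
    using H_fin emeasure_mono[of "B k \<inter> H" H \<mu>Y]
    by (intro integrable_real_indicator) (auto intro: le_less_trans)
  have f_le: "\<bar>f k y\<bar> \<le> indicator (B k \<inter> H) y" for k y
    by (auto simp: f_def indicator_def sgn_real_def)
  have f_le1: "\<bar>f k y\<bar> \<le> 1" for k y
    by (rule order_trans[OF f_le]) (simp add: indicator_def)
  have f_int: "integrable \<mu>Y (f k)" for k
    by (rule Bochner_Integration.integrable_bound[OF BH_int[of k]]) (use f_le in \<open>auto simp: f_def indicator_def sgn_real_def\<close>)
  have Tf_le1: "AE y in \<mu>Y. \<bar>T (f k) y\<bar> \<le> 1" for k
    unfolding T_def by (rule S.real_cond_exp_bounded[OF f_int]) (simp add: f_le1)
  have Tf_bdd: "ess_bdd \<mu>Y (T (f k))" for k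
    unfolding ess_bdd_def using Tf_le1[of k] T_int[OF f_int] by auto
  have mult_int: "integrable \<mu>Y (\<lambda>y. a y * b y)"
    if [measurable]: "a \<in> borel_measurable \<mu>Y" and a: "AE y in \<mu>Y. \<bar>a y\<bar> \<le> 1" and b: "integrable \<mu>Y b"
    for a b :: "'y \<Rightarrow> real"
    by (rule Bochner_Integration.integrable_bound[OF b])
      (use a b in \<open>auto simp: abs_mult intro!: mult_left_le_one_le elim!: eventually_mono\<close>)
  have fT_int: "integrable \<mu>Y (\<lambda>y. f k y * T (l k) y)" for k
    by (rule mult_int) (auto simp: f_le1 T_int l_int)
  have Tfl_int: "integrable \<mu>Y (\<lambda>y. T (f k) y * l k y)" for k
    by (rule mult_int) (use Tf_le1 l_int T_int[OF f_int] in auto)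
  have single: "(\<Sum>k\<in>K. F k * indicator (B k) y) = F (\<kappa> y)" if y: "y \<in> space \<mu>Y" for F :: "nat \<Rightarrow> real" and y
  proof -
    have "(\<Sum>k\<in>K. F k * indicator (B k) y) = (\<Sum>k\<in>K. if k = \<kappa> y then F k else 0)"
      using y by (intro sum.cong) (auto simp: B_def indicator_def)
    then show ?thesis using K y by simp
  qed
  have R_all: "AE y in \<mu>Y. \<forall>k\<in>K. indicator (B k) y * R y = indicator (B k) y * (indicator H y * T (l k) y)"
    by (rule AE_finite_allI[OF K(1) R_on])
  have "(\<integral>y. \<bar>R y\<bar> \<partial>\<mu>Y) = (\<integral>y. (\<Sum>k\<in>K. f k y * T (l k) y) \<partial>\<mu>Y)"
  proof (rule integral_cong_AE)
    show "AE y in \<mu>Y. \<bar>R y\<bar> = (\<Sum>k\<in>K. f k y * T (l k) y)"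
      using R_all AE_space
    proof eventually_elim
      case (elim y)
      have "(\<Sum>k\<in>K. f k y * T (l k) y) = (\<Sum>k\<in>K. sgn (R y) * indicator H y * T (l k) y * indicator (B k) y)"
        by (intro sum.cong) (auto simp: f_def indicator_def)
      also have "\<dots> = sgn (R y) * (indicator H y * T (l (\<kappa> y)) y)"
        using single[OF elim(2), of "\<lambda>k. sgn (R y) * indicator H y * T (l k) y"] by simp
      also have "indicator H y * T (l (\<kappa> y)) y = R y"
        using bspec[OF elim(1) K(2)[OF elim(2)]] elim(2) by (simp add: B_def)
      finally show ?case by (simp add: abs_sgn mult.commute)
    qed
  qed (use fT_int in auto)
  also have "\<dots> = (\<Sum>k\<in>K. \<integral>y. f k y * T (l k) y \<partial>\<mu>Y)"
    by (rule Bochner_Integration.integral_sum) (rule fT_int)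
  also have "\<dots> = (\<Sum>k\<in>K. \<integral>y. T (f k) y * l k y \<partial>\<mu>Y)"
    unfolding T_def by (intro sum.cong refl S.real_cond_exp_self_adjoint[OF f_int _ l_int, of _ 1]) (simp add: f_le1)
  also have "\<dots> = (\<integral>y. (\<Sum>k\<in>K. T (f k) y * l k y) \<partial>\<mu>Y)"
    by (rule Bochner_Integration.integral_sum[symmetric]) (rule Tfl_int)
  finally have R_eq: "(\<integral>y. \<bar>R y\<bar> \<partial>\<mu>Y) = (\<integral>y. (\<Sum>k\<in>K. T (f k) y * l k y) \<partial>\<mu>Y)" .
  obtain W where W: "W \<in> carrier PM"
    and LW: "AE y in \<mu>Y. ae_rep (L W) y = (\<Sum>k\<in>K. T (f k) y * l k y)"
    and pnW: "AE y in \<mu>Y. pnorm_rep PM W y \<le> (\<Sum>k\<in>K. \<bar>T (f k) y\<bar> * pnorm_rep PM (pbM (w k)) y)"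
    by (rule PM.linear_combination[OF L K(1), of "\<lambda>k. T (f k)" "\<lambda>k. pbM (w k)"])
      (auto simp: Tf_bdd pw_closed l_def)
  have "(\<integral>y. \<bar>R y\<bar> \<partial>\<mu>Y) = (\<integral>y. ae_rep (L W) y \<partial>\<mu>Y)"
    unfolding R_eq by (rule integral_cong_AE) (use LW PM.dual_rep(1)[OF L W] Tfl_int in auto)
  also have "\<dots> \<le> (\<integral>y. \<bar>ae_rep (L W) y\<bar> \<partial>\<mu>Y)"
    by (rule integral_mono) (use PM.dual_rep(3)[OF L W] in auto)
  also have "\<dots> \<le> C * mnorm PM W" by (rule C[OF W])
  also have "mnorm PM W \<le> mnorm PM V"
  proof -
    define u where "u k y = pnorm_rep M (w k) (\<phi> y)" for k y
    have u_sig: "u k \<in> borel_measurable (gen_algebra \<iota>)" for k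
      using measurable_comp[OF gen_algebra_phi M.pnorm_rep_meas[OF w[of k]], of \<iota>] by (simp add: u_def[abs_def] comp_def)
    have u_meas[measurable]: "u k \<in> borel_measurable \<mu>Y" for k
      using u_sig by (rule measurable_from_subalg[OF S.subalg])
    have u_pn: "AE y in \<mu>Y. pnorm_rep PM (pbM (w k)) y = u k y" for k unfolding u_def by (rule pnorm_rep_pbM[OF w])
    have u_nonneg: "AE y in \<mu>Y. 0 \<le> u k y" for k unfolding u_def by (rule AE_comp[OF M.pnorm_rep_nonneg[OF w]])
    have u_p: "integrable \<mu>Y (\<lambda>y. \<bar>u k y\<bar> powr p)" for k
      by (rule integrable_cong_AE_imp[OF PM.pnorm_rep_integrable[OF pw_closed, of k]])
        (use u_pn[of k] in \<open>auto elim!: eventually_mono\<close>)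
    define g where "g k y = u k y * indicator (B k \<inter> H) y" for k y
    have g_int: "integrable \<mu>Y (g k)" for k
    proof -
      have "integrable \<mu>Y (\<lambda>y. indicator (B k \<inter> H) y * u k y)"
        by (rule integrable_indicator_powr[OF _ u_meas u_p])
          (use p H_fin emeasure_mono[of "B k \<inter> H" H \<mu>Y] in \<open>auto intro: le_less_trans\<close>)
      then show ?thesis by (simp add: g_def[abs_def] mult.commute)
    qed
    have Tg: "AE y in \<mu>Y. \<bar>T (f k) y\<bar> * pnorm_rep PM (pbM (w k)) y \<le> T (g k) y" for k
    proof -
      have "AE y in \<mu>Y. \<bar>T (f k) y\<bar> \<le> T (\<lambda>y. \<bar>f k y\<bar>) y"
        unfolding T_def by (rule S.real_cond_exp_abs_le[OF f_int])
      moreover have "AE y in \<mu>Y. T (\<lambda>y. \<bar>f k y\<bar>) y \<le> T (indicator (B k \<inter> H)) y"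
        unfolding T_def by (rule S.real_cond_exp_mono) (use f_le f_int BH_int in auto)
      moreover have "AE y in \<mu>Y. T (g k) y = u k y * T (indicator (B k \<inter> H)) y"
        unfolding T_def g_def[abs_def]
        by (rule S.real_cond_exp_mult[OF u_sig]) (use g_int[of k] in \<open>auto simp: g_def[abs_def]\<close>)
      ultimately show ?thesis using u_pn[of k] u_nonneg[of k]
      proof eventually_elim
        case (elim y)
        then have "\<bar>T (f k) y\<bar> * u k y \<le> T (indicator (B k \<inter> H)) y * u k y"
          by (intro mult_right_mono) auto
        then show ?case using elim by (simp add: mult.commute)
      qed
    qed
    define h where "h y = indicator H y * pnorm_rep PM V y" for y
    have pnV[measurable]: "pnorm_rep PM V \<in> borel_measurable \<mu>Y" by (rule PM.pnorm_rep_meas[OF V])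
    have h_int: "integrable \<mu>Y h"
      unfolding h_def by (rule integrable_indicator_powr[OF _ pnV PM.pnorm_rep_integrable[OF V] H H_fin]) (use p in simp)
    have h_pow: "\<bar>h y\<bar> powr p = indicator H y * \<bar>pnorm_rep PM V y\<bar> powr p" for y by (simp add: h_def indicator_def)
    have h_p: "integrable \<mu>Y (\<lambda>y. \<bar>h y\<bar> powr p)"
      using integrable_real_mult_indicator[OF H PM.pnorm_rep_integrable[OF V]] by (simp add: h_pow mult.commute)
    have pnV_on: "AE y in \<mu>Y. indicator (B k) y * pnorm_rep PM V y = indicator (B k) y * u k y" for k
      using PM.pnorm_rep_act[OF Bb V, of k] PM.pnorm_rep_act[OF Bb pw_closed, of k k] u_pn[of k]
      unfolding B_def by eventually_elim (auto simp: eq)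
    have "AE y in \<mu>Y. \<forall>k\<in>K. indicator (B k) y * pnorm_rep PM V y = indicator (B k) y * u k y"
      by (rule AE_finite_allI[OF K(1) pnV_on])
    then have sum_g: "AE y in \<mu>Y. (\<Sum>k\<in>K. g k y) = h y"
      using AE_space
    proof eventually_elim
      case (elim y)
      have "(\<Sum>k\<in>K. g k y) = (\<Sum>k\<in>K. u k y * indicator H y * indicator (B k) y)"
        by (intro sum.cong) (auto simp: g_def indicator_def)
      also have "\<dots> = u (\<kappa> y) y * indicator H y" by (rule single[OF elim(2)])
      also have "u (\<kappa> y) y = pnorm_rep PM V y"
        using bspec[OF elim(1) K(2)[OF elim(2)]] elim(2) by (simp add: B_def)
      finally show ?case by (simp add: h_def mult.commute)
    qed
    have "AE y in \<mu>Y. T (\<lambda>y. \<Sum>k\<in>K. g k y) y = T h y"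
      unfolding T_def by (rule S.real_cond_exp_cong[OF sum_g]) (use g_int h_int in auto)
    moreover have "AE y in \<mu>Y. T (\<lambda>y. \<Sum>k\<in>K. g k y) y = (\<Sum>k\<in>K. T (g k) y)"
      unfolding T_def by (rule S.real_cond_exp_sum[OF g_int])
    moreover have "AE y in \<mu>Y. \<forall>k\<in>K. \<bar>T (f k) y\<bar> * pnorm_rep PM (pbM (w k)) y \<le> T (g k) y"
      by (rule AE_finite_allI[OF K(1) Tg])
    ultimately have "AE y in \<mu>Y. pnorm_rep PM W y \<le> T h y"
      using pnW
    proof eventually_elim
      case (elim y)
      have "pnorm_rep PM W y \<le> (\<Sum>k\<in>K. T (g k) y)" using elim(3) by (intro order_trans[OF elim(4)] sum_mono) auto
      then show ?case using elim(1,2) by simp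
    qed
    then have "mnorm PM W \<le> (\<integral>y. \<bar>T h y\<bar> powr p \<partial>\<mu>Y) powr (1 / p)"
      unfolding T_def using S.real_cond_exp_Lp_contraction(1)[OF _ h_int h_p] p
      by (intro PM.mnorm_le_mono[OF W]) auto
    also have "\<dots> \<le> (\<integral>y. \<bar>pnorm_rep PM V y\<bar> powr p \<partial>\<mu>Y) powr (1 / p)"
    proof (rule powr_mono2)
      have "(\<integral>y. \<bar>T h y\<bar> powr p \<partial>\<mu>Y) \<le> (\<integral>y. \<bar>h y\<bar> powr p \<partial>\<mu>Y)"
        unfolding T_def using p by (intro S.real_cond_exp_Lp_contraction(2)[OF _ h_int h_p]) auto
      also have "\<dots> \<le> (\<integral>y. \<bar>pnorm_rep PM V y\<bar> powr p \<partial>\<mu>Y)"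
        by (rule integral_mono[OF h_p PM.pnorm_rep_integrable[OF V]]) (simp add: h_pow indicator_def)
      finally show "(\<integral>y. \<bar>T h y\<bar> powr p \<partial>\<mu>Y) \<le> (\<integral>y. \<bar>pnorm_rep PM V y\<bar> powr p \<partial>\<mu>Y)" .
    qed (use p in auto)
    finally show ?thesis by (simp add: PM.mnorm_eq[OF V])
  qed
  finally show ?thesis using C0 by (simp add: R_def mult_left_mono)
qed

text \<open>The bound \<open>D\<close> that continuity provides for \<open>J\<close> may be much larger than \<open>C\<close>, but it only multiplies the
norm of the small difference \<open>V - G\<close>.\<close>

lemma bounded_if_bounded_piecewise:
  assumes J: "J \<in> dual_carrier \<mu>Y PM" and C0: "0 \<le> C"
    and pw: "\<And>V. piecewise V \<Longrightarrow> (\<integral>y. \<bar>ae_rep (J V) y\<bar> \<partial>\<mu>Y) \<le> C * mnorm PM V"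
    and V: "V \<in> carrier PM"
  shows "(\<integral>y. \<bar>ae_rep (J V) y\<bar> \<partial>\<mu>Y) \<le> C * mnorm PM V"
proof (rule field_le_epsilon)
  fix e :: real assume e: "0 < e"
  obtain D where D: "0 \<le> D" "\<And>V. V \<in> carrier PM \<Longrightarrow> (\<integral>y. \<bar>ae_rep (J V) y\<bar> \<partial>\<mu>Y) \<le> D * mnorm PM V"
    by (rule PM.dual_bounded[OF J]) auto
  define r where "r = e / (C + D + 1)"
  have r: "0 < r" using e C0 D by (simp add: r_def)
  obtain G where G: "piecewise G" "mnorm PM (V \<ominus>\<^bsub>PM\<^esub> G) < r" by (rule piecewise_dense[OF V r])
  have g: "G \<in> carrier PM" using G by (simp add: piecewise_def)
  note i = PM.dual_rep(3)[OF J V] PM.dual_rep(3)[OF J g] PM.dual_rep(3)[OF J PM.diff_closed[OF V g]]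
  have "(\<integral>y. \<bar>ae_rep (J V) y\<bar> \<partial>\<mu>Y) \<le> (\<integral>y. \<bar>ae_rep (J (V \<ominus>\<^bsub>PM\<^esub> G)) y\<bar> + \<bar>ae_rep (J G) y\<bar> \<partial>\<mu>Y)"
    by (rule integral_mono_AE)
      (use i PM.dual_diff[OF J V g] in \<open>auto elim!: eventually_mono\<close>)
  also have "\<dots> = (\<integral>y. \<bar>ae_rep (J (V \<ominus>\<^bsub>PM\<^esub> G)) y\<bar> \<partial>\<mu>Y) + (\<integral>y. \<bar>ae_rep (J G) y\<bar> \<partial>\<mu>Y)"
    using i by simp
  also have "\<dots> \<le> D * r + C * (mnorm PM V + r)"
  proof (rule add_mono)
    show "(\<integral>y. \<bar>ae_rep (J (V \<ominus>\<^bsub>PM\<^esub> G)) y\<bar> \<partial>\<mu>Y) \<le> D * r"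
      using D(2)[OF PM.diff_closed[OF V g]] mult_left_mono[OF less_imp_le[OF G(2)] D(1)] by linarith
    have "G = (G \<ominus>\<^bsub>PM\<^esub> V) \<oplus>\<^bsub>PM\<^esub> V" using V g by (simp add: a_minus_def PM.a_assoc PM.l_neg)
    then have "mnorm PM G \<le> mnorm PM (V \<ominus>\<^bsub>PM\<^esub> G) + mnorm PM V"
      using PM.norm_triangle[of "G \<ominus>\<^bsub>PM\<^esub> V" V] V g PM.mnorm_diff_commute[OF V g] by simp
    then have "C * mnorm PM G \<le> C * (mnorm PM V + r)" using G(2) C0 by (intro mult_left_mono) auto
    then show "(\<integral>y. \<bar>ae_rep (J G) y\<bar> \<partial>\<mu>Y) \<le> C * (mnorm PM V + r)" using pw[OF G(1)] by linarith
  qed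
  also have "\<dots> = C * mnorm PM V + (C + D) * r" by (simp add: algebra_simps)
  also have "\<dots> \<le> C * mnorm PM V + (C + D + 1) * r" using r by (simp add: mult_right_mono)
  also have "(C + D + 1) * r = e" using C0 D by (simp add: r_def)
  finally show "(\<integral>y. \<bar>ae_rep (J V) y\<bar> \<partial>\<mu>Y) \<le> C * mnorm PM V + e" .
qed

end

section \<open>Convergence\<close>

context dual_of_pullback
begin

lemma gen_algebra_pred: "{y \<in> space \<mu>Y. Q (\<iota> y)} \<in> sets (gen_algebra \<iota>)"
  using measurable_sets[OF gen_algebra_iota, of "{i. Q i}" \<iota>]
  by (simp add: space_gen_algebra vimage_def Int_def conj_commute)

text \<open>The index at stage \<open>n\<close> encodes the piece of the partition containing the point, which makes the fibres
finite in measure, and the membership in \<open>A 0, \<dots>, A (n - 1)\<close>.\<close>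

lemma refining_index_maps:
  fixes P A :: "nat \<Rightarrow> 'y set"
  assumes P: "\<And>i. P i \<in> sets \<mu>Y" "(\<Union>i. P i) = space \<mu>Y" "disjoint_family P"
    and P_fin: "\<And>i. emeasure \<mu>Y (P i) < \<infinity>" and A: "\<And>k. A k \<in> sets \<mu>Y"
  obtains \<iota> :: "nat \<Rightarrow> 'y \<Rightarrow> nat" where
    "\<And>n. \<iota> n \<in> \<mu>Y \<rightarrow>\<^sub>M count_space UNIV"
    "\<And>n i. emeasure \<mu>Y {y \<in> space \<mu>Y. \<iota> n y = i} < \<infinity>"
    "\<And>n i. P i \<in> sets (gen_algebra (\<iota> n))" "\<And>k n. k < n \<Longrightarrow> A k \<in> sets (gen_algebra (\<iota> n))"
proof -
  note [measurable] = P(1) A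
  define j where "j y = (THE i. y \<in> P i)" for y
  have jP: "y \<in> P i \<longleftrightarrow> j y = i" if y: "y \<in> space \<mu>Y" for y i
  proof -
    obtain i0 where i0: "y \<in> P i0" using P(2) y by blast
    have "i = i0" if "y \<in> P i" for i
      using P(3) that i0 by (auto simp: disjoint_family_on_def disjoint_iff)
    then have "j y = i0" unfolding j_def using i0 by blast
    then show ?thesis using i0 \<open>\<And>i. y \<in> P i \<Longrightarrow> i = i0\<close> by blast
  qed
  have j[measurable]: "j \<in> \<mu>Y \<rightarrow>\<^sub>M count_space UNIV"
  proof (rule iffD2[OF measurable_count_space_eq2_countable])
    have "j -` {i} \<inter> space \<mu>Y = P i" for i
      using jP sets.sets_into_space[OF P(1), of i] by auto
    then show "j \<in> space \<mu>Y \<rightarrow> UNIV \<and> (\<forall>i\<in>UNIV. j -` {i} \<inter> space \<mu>Y \<in> sets \<mu>Y)" using P(1) by simp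
  qed
  define \<iota> where "\<iota> n y = rec_nat (j y) (\<lambda>k i. prod_encode (i, if y \<in> A k then 1 else 0)) n" for n y
  have \<iota>0: "\<iota> 0 y = j y" and \<iota>Suc: "\<iota> (Suc n) y = prod_encode (\<iota> n y, if y \<in> A n then 1 else 0)" for n y
    by (simp_all add: \<iota>_def)
  have \<iota>_meas: "\<iota> n \<in> \<mu>Y \<rightarrow>\<^sub>M count_space UNIV" for n
  proof (induction n)
    case 0
    then show ?case using j by (simp add: \<iota>0[abs_def])
  next
    case (Suc n)
    note [measurable] = Suc
    show ?case unfolding \<iota>Suc[abs_def] by measurable
  qed
  have j_dec: "\<exists>b. \<forall>y. j y = b (\<iota> n y)" for n
  proof (induction n)
    case (Suc n)
    then obtain b where "\<forall>y. j y = b (\<iota> n y)" by blast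
    then show ?case by (intro exI[of _ "\<lambda>i. b (fst (prod_decode i))"]) (simp add: \<iota>Suc)
  qed (auto simp: \<iota>0)
  have A_dec: "\<exists>b. \<forall>y. y \<in> A k \<longleftrightarrow> b (\<iota> n y)" if "k < n" for k n
    using that
  proof (induction n)
    case (Suc n)
    show ?case
    proof (cases "k = n")
      case True
      then show ?thesis by (intro exI[of _ "\<lambda>i. snd (prod_decode i) = 1"]) (simp add: \<iota>Suc)
    next
      case False
      with Suc.prems have "k < n" by simp
      from Suc.IH[OF this] obtain b where "\<forall>y. y \<in> A k \<longleftrightarrow> b (\<iota> n y)" by blast
      then show ?thesis by (intro exI[of _ "\<lambda>i. b (fst (prod_decode i))"]) (simp add: \<iota>Suc)
    qed
  qed simp
  show thesis
  proof (rule that[OF \<iota>_meas])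
    fix n i
    obtain b where b: "\<And>y. j y = b (\<iota> n y)" using j_dec by blast
    have "{y \<in> space \<mu>Y. \<iota> n y = i} \<subseteq> P (b i)" using jP b by auto
    then have "emeasure \<mu>Y {y \<in> space \<mu>Y. \<iota> n y = i} \<le> emeasure \<mu>Y (P (b i))"
      by (rule emeasure_mono) (rule P(1))
    then show "emeasure \<mu>Y {y \<in> space \<mu>Y. \<iota> n y = i} < \<infinity>" using P_fin le_less_trans by blast
    have "P i = {y \<in> space \<mu>Y. b (\<iota> n y) = i}"
      using jP b sets.sets_into_space[OF P(1), of i] by auto
    then show "P i \<in> sets (gen_algebra (\<iota> n))" using gen_algebra_pred[of "\<lambda>x. b x = i" "\<iota> n"] by simp
  next
    fix k n :: nat assume "k < n"
    then obtain b where b: "\<And>y. y \<in> A k \<longleftrightarrow> b (\<iota> n y)" using A_dec by blast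
    have "A k = {y \<in> space \<mu>Y. b (\<iota> n y)}"
      using b sets.sets_into_space[OF A, of k] by auto
    then show "A k \<in> sets (gen_algebra (\<iota> n))" using gen_algebra_pred[of b "\<iota> n"] by simp
  qed
qed

lemma weak_star_sequential_density:
  assumes sep: "separable_measure \<mu>Y" and L: "L \<in> dual_carrier \<mu>Y PM"
  shows "\<exists>Ln :: nat \<Rightarrow> 'k. (\<forall>n. Ln n \<in> carrier PD) \<and>
    (\<forall>V\<in>carrier PM. (\<lambda>n. mnorm (L1 \<mu>Y) (I (Ln n) V \<ominus>\<^bsub>L1 \<mu>Y\<^esub> L V)) \<longlonglongrightarrow> 0)"
proof -
  obtain P :: "nat \<Rightarrow> 'y set" where P0: "range P \<subseteq> sets \<mu>Y" and P_UN: "(\<Union>i. P i) = space \<mu>Y"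
    and P_fin0: "\<And>i. emeasure \<mu>Y (P i) \<noteq> \<infinity>" and P_disj: "disjoint_family P"
    by (rule Y.sigma_finite_disjoint) blast
  have P[measurable]: "P i \<in> sets \<mu>Y" for i using P0 by auto
  have P_fin: "emeasure \<mu>Y (P i) < \<infinity>" for i using P_fin0 by (simp add: less_top)
  obtain A :: "nat \<Rightarrow> 'y set" where A0: "range A \<subseteq> sets \<mu>Y"
    and A_sep: "\<And>B. B \<in> sets \<mu>Y \<Longrightarrow> emeasure \<mu>Y B < \<infinity> \<Longrightarrow> (INF n. emeasure \<mu>Y (sym_diff (A n) B)) = 0"
    using sep unfolding separable_measure_def by blast
  have A[measurable]: "A k \<in> sets \<mu>Y" for k using A0 by auto
  obtain \<iota> :: "nat \<Rightarrow> 'y \<Rightarrow> nat" where \<iota>: "\<And>n. \<iota> n \<in> \<mu>Y \<rightarrow>\<^sub>M count_space UNIV"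
    and \<iota>_fin: "\<And>n i. emeasure \<mu>Y {y \<in> space \<mu>Y. \<iota> n y = i} < \<infinity>"
    and P_sig: "\<And>n i. P i \<in> sets (gen_algebra (\<iota> n))" and A_sig: "\<And>k n. k < n \<Longrightarrow> A k \<in> sets (gen_algebra (\<iota> n))"
    by (rule refining_index_maps[of P A, OF P P_UN P_disj P_fin A]) blast
  define D where "D m = (\<Union>i\<le>m. P i)" for m :: nat
  have D[measurable]: "D m \<in> sets \<mu>Y" for m unfolding D_def by measurable
  have D_mono: "incseq D" unfolding incseq_def D_def by (blast intro: order_trans)
  have D_UN: "(\<Union>m. D m) = space \<mu>Y" using P_UN by (auto simp: D_def)
  have D_sig: "D m \<in> sets (gen_algebra (\<iota> n))" for m n unfolding D_def using P_sig by (intro sets.finite_UN) auto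
  have D_fin: "emeasure \<mu>Y (D m) < \<infinity>" for m
  proof -
    have "emeasure \<mu>Y (D m) \<le> (\<Sum>i\<le>m. emeasure \<mu>Y (P i))"
      unfolding D_def by (rule emeasure_subadditive_finite) auto
    also have "\<dots> < \<infinity>" using P_fin by (simp add: less_top)
    finally show ?thesis .
  qed
  define good where "good n \<Lambda> H \<longleftrightarrow> \<Lambda> \<in> carrier PD \<and> H \<in> sets (gen_algebra (\<iota> n)) \<and> emeasure \<mu>Y H < \<infinity> \<and>
      emeasure \<mu>Y (D n - H) \<le> ennreal (1 / real (Suc n)) \<and>
      (\<forall>v\<in>carrier M. AE y in \<mu>Y. ae_rep (I \<Lambda> (pbM v)) y =
        indicator H y * real_cond_exp \<mu>Y (gen_algebra (\<iota> n)) (ae_rep (L (pbM v))) y)" for n \<Lambda> H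
  have "\<exists>\<Lambda> H. good n \<Lambda> H" for n
  proof -
    obtain \<Lambda> H where "\<Lambda> \<in> carrier PD" "H \<in> sets (gen_algebra (\<iota> n))" "emeasure \<mu>Y H < \<infinity>"
      "emeasure \<mu>Y (D n - H) \<le> ennreal (1 / real (Suc n))"
      "\<And>v. v \<in> carrier M \<Longrightarrow> AE y in \<mu>Y. ae_rep (I \<Lambda> (pbM v)) y =
        indicator H y * real_cond_exp \<mu>Y (gen_algebra (\<iota> n)) (ae_rep (L (pbM v))) y"
      by (rule dual_step[OF L \<iota> \<iota>_fin D D_fin, of "1 / real (Suc n)" n n]) (simp, rule that)
    then show ?thesis unfolding good_def by (intro exI[of _ \<Lambda>] exI[of _ H] conjI ballI)
  qed
  then obtain \<Lambda> H where good: "\<And>n. good n (\<Lambda> n) (H n)" by metis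
  have \<Lambda>: "\<Lambda> n \<in> carrier PD" and H_sig: "H n \<in> sets (gen_algebra (\<iota> n))"
    and H_fin: "emeasure \<mu>Y (H n) < \<infinity>"
    and DH: "emeasure \<mu>Y (D n - H n) \<le> ennreal (1 / real (Suc n))" for n
    using good[of n] unfolding good_def by blast+
  have I\<Lambda>: "AE y in \<mu>Y. ae_rep (I (\<Lambda> n) (pbM v)) y =
        indicator (H n) y * real_cond_exp \<mu>Y (gen_algebra (\<iota> n)) (ae_rep (L (pbM v))) y"
    if "v \<in> carrier M" for n v
    using good[of n] that unfolding good_def by blast
  note sub = sigma_finite_subalgebra_gen_algebra[OF \<iota> \<iota>_fin]
  have H[measurable]: "H n \<in> sets \<mu>Y" for n
    using sigma_finite_subalgebra.subalg[OF sub, of n] H_sig[of n] by (auto simp: subalgebra_def)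
  have DH0: "(\<lambda>n. emeasure \<mu>Y (D m - H n)) \<longlonglongrightarrow> 0" for m
  proof (rule tendsto_sandwich[OF _ _ tendsto_const])
    show "\<forall>\<^sub>F n in sequentially. emeasure \<mu>Y (D m - H n) \<le> ennreal (1 / real (Suc n))"
      using eventually_ge_at_top[of m]
    proof eventually_elim
      case (elim n)
      then have "D m - H n \<subseteq> D n - H n" using D_mono by (auto simp: incseq_def)
      then have "emeasure \<mu>Y (D m - H n) \<le> emeasure \<mu>Y (D n - H n)" by (rule emeasure_mono) simp
      then show ?case using DH[of n] by simp
    qed
    have "(\<lambda>n. 1 / real (Suc n)) \<longlonglongrightarrow> 0" using LIMSEQ_inverse_real_of_nat by (simp add: inverse_eq_divide)
    then show "(\<lambda>n. ennreal (1 / real (Suc n))) \<longlonglongrightarrow> 0" using tendsto_ennrealI by fastforce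
  qed simp
  define err where "err n V = (\<integral>y. \<bar>ae_rep (I (\<Lambda> n) V) y - ae_rep (L V) y\<bar> \<partial>\<mu>Y)" for n V
  note J = I_closed[OF \<Lambda>]
  note J_int = PM.dual_rep(3)[OF J] and L_int = PM.dual_rep(3)[OF L]
  have err_pb: "(\<lambda>n. err n (pbM v)) \<longlonglongrightarrow> 0" if v: "v \<in> carrier M" for v
  proof -
    note l = L_int[OF pbM_closed[OF v]]
    have "err n (pbM v) = (\<integral>y. \<bar>indicator (H n) y * real_cond_exp \<mu>Y (gen_algebra (\<iota> n)) (ae_rep (L (pbM v))) y
        - ae_rep (L (pbM v)) y\<bar> \<partial>\<mu>Y)" for n
      unfolding err_def
      by (rule integral_cong_AE)
        (use I\<Lambda>[OF v, of n] l J_int[OF pbM_closed[OF v], of n] in \<open>auto elim!: eventually_mono\<close>)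
    then show ?thesis
      using truncated_cond_exp_tendsto_L1[of \<mu>Y "\<lambda>n. gen_algebra (\<iota> n)" A D H, OF sub A A_sep D D_mono D_UN D_fin D_sig A_sig H DH0 l]
      by simp
  qed
  have err_pw: "(\<lambda>n. err n V) \<longlonglongrightarrow> 0" if pw: "piecewise V" for V
  proof -
    obtain \<kappa> K w where V: "V \<in> carrier PM" and \<kappa>[measurable]: "\<kappa> \<in> \<mu>Y \<rightarrow>\<^sub>M count_space (UNIV :: nat set)"
      and K: "finite K" "\<And>y. y \<in> space \<mu>Y \<Longrightarrow> \<kappa> y \<in> K" and w: "\<And>k. w k \<in> carrier M"
      and eq: "\<And>k. act \<mu>Y PM (indicator {y \<in> space \<mu>Y. \<kappa> y = k}) V
           = act \<mu>Y PM (indicator {y \<in> space \<mu>Y. \<kappa> y = k}) (pbM (w k))"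
      using pw unfolding piecewise_def by blast
    have Bb: "ess_bdd \<mu>Y (indicator {y \<in> space \<mu>Y. \<kappa> y = k})" for k by (rule ess_bdd_indicator) measurable
    have on_piece: "AE y in \<mu>Y. \<kappa> y = k \<longrightarrow> ae_rep (F V) y = ae_rep (F (pbM (w k))) y"
      if F: "F \<in> dual_carrier \<mu>Y PM" for F k
      using PM.dual_act[OF F Bb V, of k] PM.dual_act[OF F Bb pbM_closed[OF w], of k k] AE_space
      by eventually_elim (auto simp: eq)
    have "err n V \<le> (\<Sum>k\<in>K. err n (pbM (w k)))" for n
    proof -
      have "AE y in \<mu>Y. \<forall>k\<in>K. \<kappa> y = k \<longrightarrow> ae_rep (I (\<Lambda> n) V) y = ae_rep (I (\<Lambda> n) (pbM (w k))) y"
        by (rule AE_finite_allI[OF K(1) on_piece[OF J]])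
      moreover have "AE y in \<mu>Y. \<forall>k\<in>K. \<kappa> y = k \<longrightarrow> ae_rep (L V) y = ae_rep (L (pbM (w k))) y"
        by (rule AE_finite_allI[OF K(1) on_piece[OF L]])
      ultimately have "AE y in \<mu>Y. \<bar>ae_rep (I (\<Lambda> n) V) y - ae_rep (L V) y\<bar>
          \<le> (\<Sum>k\<in>K. \<bar>ae_rep (I (\<Lambda> n) (pbM (w k))) y - ae_rep (L (pbM (w k))) y\<bar>)"
        using AE_space
      proof eventually_elim
        case (elim y)
        have k: "\<kappa> y \<in> K" by (rule K(2)[OF elim(3)])
        have "\<bar>ae_rep (I (\<Lambda> n) V) y - ae_rep (L V) y\<bar>
            = \<bar>ae_rep (I (\<Lambda> n) (pbM (w (\<kappa> y)))) y - ae_rep (L (pbM (w (\<kappa> y)))) y\<bar>"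
          using elim(1,2) k by simp
        also have "\<dots> \<le> (\<Sum>k\<in>K. \<bar>ae_rep (I (\<Lambda> n) (pbM (w k))) y - ae_rep (L (pbM (w k))) y\<bar>)"
          by (rule member_le_sum[OF k _ K(1)]) simp
        finally show ?case .
      qed
      then have "err n V \<le> (\<integral>y. (\<Sum>k\<in>K. \<bar>ae_rep (I (\<Lambda> n) (pbM (w k))) y - ae_rep (L (pbM (w k))) y\<bar>) \<partial>\<mu>Y)"
        unfolding err_def
        by (rule integral_mono_AE[rotated 2])
          (use J_int[OF V] L_int[OF V] J_int[OF pbM_closed[OF w]] L_int[OF pbM_closed[OF w]] in auto)
      also have "\<dots> = (\<Sum>k\<in>K. err n (pbM (w k)))"
        unfolding err_def
        by (rule Bochner_Integration.integral_sum) (use J_int[OF pbM_closed[OF w]] L_int[OF pbM_closed[OF w]] in auto)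
      finally show ?thesis .
    qed
    moreover have "(\<lambda>n. \<Sum>k\<in>K. err n (pbM (w k))) \<longlonglongrightarrow> 0"
      by (rule tendsto_null_sum) (rule err_pb[OF w])
    moreover have "0 \<le> err n V" for n by (simp add: err_def integral_nonneg)
    ultimately show ?thesis by (intro tendsto_sandwich[OF _ _ tendsto_const, of 0 "\<lambda>n. err n V"]) auto
  qed
  obtain C where C: "0 \<le> C" "\<And>V. V \<in> carrier PM \<Longrightarrow> (\<integral>y. \<bar>ae_rep (L V) y\<bar> \<partial>\<mu>Y) \<le> C * mnorm PM V"
    by (rule PM.dual_bounded[OF L]) auto
  have J_bound: "(\<integral>y. \<bar>ae_rep (I (\<Lambda> n) V) y\<bar> \<partial>\<mu>Y) \<le> C * mnorm PM V" if "V \<in> carrier PM" for n V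
    by (rule bounded_if_bounded_piecewise[OF J C(1) step_bounded_piecewise[OF L C \<iota> \<iota>_fin \<Lambda> H_sig H_fin I\<Lambda>] that])
  have err_all: "(\<lambda>n. err n V) \<longlonglongrightarrow> 0" if V: "V \<in> carrier PM" for V
  proof (rule LIMSEQ_I)
    fix e :: real assume e: "0 < e"
    define r where "r = e / (3 * (C + 1))"
    have r: "0 < r" using e C by (simp add: r_def)
    have Cr: "C * r \<le> e / 3" using e C by (simp add: r_def field_simps)
    obtain G where G: "piecewise G" "mnorm PM (V \<ominus>\<^bsub>PM\<^esub> G) < r" by (rule piecewise_dense[OF V r])
    have g: "G \<in> carrier PM" using G by (simp add: piecewise_def)
    note d = PM.diff_closed[OF V g]
    obtain N where N: "\<And>n. N \<le> n \<Longrightarrow> norm (err n G - 0) < e / 3"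
      using LIMSEQ_D[OF err_pw[OF G(1)], of "e / 3"] e by auto
    show "\<exists>no. \<forall>n\<ge>no. norm (err n V - 0) < e"
    proof (intro exI allI impI)
      fix n assume n: "N \<le> n"
      note i = J_int[OF V, of n] J_int[OF g, of n] J_int[OF d, of n] L_int[OF V] L_int[OF g] L_int[OF d]
      have "err n V \<le> (\<integral>y. \<bar>ae_rep (I (\<Lambda> n) (V \<ominus>\<^bsub>PM\<^esub> G)) y\<bar> + \<bar>ae_rep (L (V \<ominus>\<^bsub>PM\<^esub> G)) y\<bar>
          + \<bar>ae_rep (I (\<Lambda> n) G) y - ae_rep (L G) y\<bar> \<partial>\<mu>Y)"
        unfolding err_def
      proof (rule integral_mono_AE)
        show "AE y in \<mu>Y. \<bar>ae_rep (I (\<Lambda> n) V) y - ae_rep (L V) y\<bar>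
            \<le> \<bar>ae_rep (I (\<Lambda> n) (V \<ominus>\<^bsub>PM\<^esub> G)) y\<bar> + \<bar>ae_rep (L (V \<ominus>\<^bsub>PM\<^esub> G)) y\<bar>
              + \<bar>ae_rep (I (\<Lambda> n) G) y - ae_rep (L G) y\<bar>"
          using PM.dual_diff[OF J V g, of n] PM.dual_diff[OF L V g] by eventually_elim linarith
      qed (use i in auto)
      also have "\<dots> = (\<integral>y. \<bar>ae_rep (I (\<Lambda> n) (V \<ominus>\<^bsub>PM\<^esub> G)) y\<bar> \<partial>\<mu>Y)
          + (\<integral>y. \<bar>ae_rep (L (V \<ominus>\<^bsub>PM\<^esub> G)) y\<bar> \<partial>\<mu>Y) + err n G"
        using i by (simp add: err_def)
      also have "\<dots> < e"
      proof -
        have "C * mnorm PM (V \<ominus>\<^bsub>PM\<^esub> G) \<le> C * r" using G(2) C(1) by (intro mult_left_mono) auto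
        then show ?thesis using J_bound[OF d, of n] C(2)[OF d] Cr N[OF n] by (simp add: abs_less_iff)
      qed
      finally have "err n V < e" .
      moreover have "0 \<le> err n V" by (simp add: err_def integral_nonneg)
      ultimately show "norm (err n V - 0) < e" by simp
    qed
  qed
  have err_eq: "mnorm (L1 \<mu>Y) (I (\<Lambda> n) V \<ominus>\<^bsub>L1 \<mu>Y\<^esub> L V) = err n V" if V: "V \<in> carrier PM" for n V
    using mnorm_L1_minus[OF J_int[OF V, of n] L_int[OF V]] PM.dual_rep(2)[OF J V, of n] PM.dual_rep(2)[OF L V]
    by (simp add: err_def)
  show ?thesis
  proof (intro exI conjI allI ballI)
    show "\<Lambda> n \<in> carrier PD" for n by (rule \<Lambda>)
    show "(\<lambda>n. mnorm (L1 \<mu>Y) (I (\<Lambda> n) V \<ominus>\<^bsub>L1 \<mu>Y\<^esub> L V)) \<longlonglongrightarrow> 0" if V: "V \<in> carrier PM" for V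
      unfolding err_eq[OF V] by (rule err_all[OF V])
  qed
qed

end

theorem theoremB1:
  fixes \<mu>X :: "'x measure" and \<mu>Y :: "'y measure" and \<phi> :: "'y \<Rightarrow> 'x" and p q :: real
    and M :: "('x, 'm) normed_module"
    and PM :: "('y, 'n) normed_module" and pbM :: "'m \<Rightarrow> 'n"
    and PD :: "('y, 'k) normed_module" and pbD :: "('m \<Rightarrow> 'x fclass) \<Rightarrow> 'k"
    and I :: "'k \<Rightarrow> 'n \<Rightarrow> 'y fclass"
  assumes "sigma_finite_measure \<mu>X" "separable_measure \<mu>X"
    and "sigma_finite_measure \<mu>Y" "separable_measure \<mu>Y"
    and "\<phi> \<in> \<mu>Y \<rightarrow>\<^sub>M \<mu>X" "absolutely_continuous \<mu>X (distr \<mu>Y \<mu>X \<phi>)"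
    and "1 < p" "1 < q" "1 / p + 1 / q = 1"
    and "Lp_normed_module \<mu>X p M"
    and "is_pullback \<mu>X \<mu>Y \<phi> p M PM pbM"
    and "is_pullback \<mu>X \<mu>Y \<phi> q (dual \<mu>X M) PD pbD"
    and "Linf_linear \<mu>Y PD (dual \<mu>Y PM) I"
    and "\<forall>\<Lambda>\<in>carrier PD. pnorm (dual \<mu>Y PM) (I \<Lambda>) = pnorm PD \<Lambda>"
    and "\<forall>\<omega>\<in>carrier (dual \<mu>X M). \<forall>v\<in>carrier M. I (pbD \<omega>) (pbM v) = ae_comp \<mu>Y (\<omega> v) \<phi>"
    and "L \<in> carrier (dual \<mu>Y PM)"
  shows "\<exists>Ln :: nat \<Rightarrow> 'k. (\<forall>n. Ln n \<in> carrier PD) \<and>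
    (\<forall>V\<in>carrier PM. (\<lambda>n. mnorm (L1 \<mu>Y) (I (Ln n) V \<ominus>\<^bsub>L1 \<mu>Y\<^esub> L V)) \<longlonglongrightarrow> 0)"
proof -
  have PM: "Lp_normed_module \<mu>Y p PM" and PD: "Lp_normed_module \<mu>Y q PD"
    using assms(11,12) unfolding is_pullback_def by (blast dest: conjunct1)+
  interpret dual_of_pullback \<mu>X \<mu>Y p q M PM PD \<phi> pbM pbD I
  proof (intro dual_of_pullback.intro Lp_normed_module_pos.intro Lp_normed_module_pos_axioms.intro
      dual_of_pullback_axioms.intro)
    show "0 < p" "0 < p" using assms(7) by simp_all
    show "I (pbD \<omega>) (pbM v) = ae_comp \<mu>Y (\<omega> v) \<phi>"
      if "\<omega> \<in> carrier (dual \<mu>X M)" "v \<in> carrier M" for \<omega> v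
      using assms(15) that by blast
  qed (rule PM PD assms(1,3,5,6,7,10,11,12,13))+
  show ?thesis
    by (rule weak_star_sequential_density[OF assms(4)]) (use assms(16) in \<open>simp add: dual_def\<close>)
qed

end
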